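(* Let $G$ be a finite abelian group, and let $A$ be an abelian group for which there is a unique set $\pi$ of primes such that, for every positive integer $n$, the $n$-torsion subgroup of $A$ is cyclic of order $n_\pi$, the $\pi$-part of $n$. If $\pi$ contains every prime divisor of $|G|$, then the $A$-fibred double Burnside algebra $\mathbb{K}B^A(G,G)$ is not semisimple.
   Context: $\mathbb{K}$ is a field of characteristic zero with sufficiently many roots of unity. $A$ is written multiplicatively. For a finite group $F$, $F^*=\mathrm{Hom}(F,A)$. An $A$-fibred $G$-$G$-biset is an $A$-free $A\times(G\times G)$-set with finitely many $A$-orbits. $B^A(G,G)$ is the Grothendieck group of isomorphism classes of such bisets with respect to disjoint union, and $\mathbb{K}B^A(G,G)=\mathbb{K}\otimes B^A(G,G)$ is a $\mathbb{K}$-algebra under the tensor product $[X][Y]=[X\otimes_{AG}Y]$ of fibred bisets. Concretely, for $G$ abelian: for $U\le G\times G$ let $p_1(U),p_2(U)$ be the images of $U$ under the coordinate projections, $k_1(U)=\{u:(u,1)\in U\}$, $k_2(U)=\{u:(1,u)\in U\}$, and $U\ast V=\{(u,v):\exists g\in G,\ (u,g)\in U,(g,v)\in V\}$. Then $\mathbb{K}B^A(G,G)$ has a $\mathbb{K}$-basis $\left[\frac{G\times G}{U,\varphi}\right]$ indexed by the pairs $(U,\varphi)$ with $U\le G\times G$, $\varphi\in U^*$ (isomorphism classes of transitive fibred bisets), and $$\left[\tfrac{G\times G}{U,\varphi}\right]\left[\tfrac{G\times G}{V,\psi}\right]=|G:p_2(U)p_1(V)|\left[\tfrac{G\times G}{U\ast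 V,\varphi\ast\psi}\right]$$ if $\varphi(1,g)\psi(g,1)=1$ for all $g\in k_2(U)\cap k_1(V)$, and the product is $0$ otherwise; here $(\varphi\ast\psi)(u,v)=\varphi(u,g)\psi(g,v)$ for any $g$ with $(u,g)\in U$, $(g,v)\in V$.
   Formalization: The group G is assumed to be nontrivial, because for trivial G the algebra KB^A(G,G) is the field K itself, which is semisimple, so the claim as printed fails in that case. *)

theory Defs
  imports "HOL-Algebra.Group_Action" "HOL-Algebra.Elementary_Groups" "HOL-Algebra.QuotRing"
    "HOL-Algebra.Multiplicative_Group" "HOL-Library.Poly_Mapping"
    "HOL-Computational_Algebra.Primes"
begin

section \<open>Fibred bisets\<close>

text \<open>
  An \<open>A \<times> (G \<times> G)\<close>-set is a pair \<open>(E, \<phi>)\<close> such that \<open>\<phi>\<close> is a (left) action of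
  \<open>A \<times> (G \<times> G)\<close> on \<open>E\<close>. As a biset, \<open>(u, v)\<close> acts on \<open>x\<close> by \<open>u x v\<^sup>-\<^sup>1\<close>.
\<close>

type_synonym ('a, 'g, 'x) aset = "'x set \<times> ('a \<times> 'g \<times> 'g \<Rightarrow> 'x \<Rightarrow> 'x)"

definition fibre_action ::
    "('g, 'n) monoid_scheme \<Rightarrow> ('a \<times> 'g \<times> 'g \<Rightarrow> 'x \<Rightarrow> 'x) \<Rightarrow> 'a \<Rightarrow> 'x \<Rightarrow> 'x" where
  "fibre_action G act a = act (a, \<one>\<^bsub>G\<^esub>, \<one>\<^bsub>G\<^esub>)"

definition fibred_biset ::
    "('a, 'm) monoid_scheme \<Rightarrow> ('g, 'n) monoid_scheme \<Rightarrow> ('a, 'g, 'x) aset \<Rightarrow> bool" where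
  "fibred_biset A G X \<longleftrightarrow>
     group_action (A \<times>\<times> (G \<times>\<times> G)) (fst X) (snd X) \<and>
     (\<forall>x\<in>fst X. stabilizer A (fibre_action G (snd X)) x = {\<one>\<^bsub>A\<^esub>}) \<and>
     finite (orbits A (fst X) (fibre_action G (snd X)))"

definition aset_iso ::
    "('a, 'm) monoid_scheme \<Rightarrow> ('g, 'n) monoid_scheme \<Rightarrow>
     ('a, 'g, 'x) aset \<Rightarrow> ('a, 'g, 'y) aset \<Rightarrow> bool" where
  "aset_iso A G X Y \<longleftrightarrow>
     (\<exists>f. bij_betw f (fst X) (fst Y) \<and>
          (\<forall>p\<in>carrier (A \<times>\<times> (G \<times>\<times> G)). \<forall>x\<in>fst X. f (snd X p x) = snd Y p (f x)))"

definition disjoint_union ::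
    "('a, 'g, 'x) aset \<Rightarrow> ('a, 'g, 'y) aset \<Rightarrow> ('a, 'g, 'x + 'y) aset" where
  "disjoint_union X Y =
     (fst X <+> fst Y, \<lambda>p. \<lambda>z\<in>fst X <+> fst Y. map_sum (snd X p) (snd Y p) z)"

text \<open>
  \<open>X \<otimes>\<^sub>A\<^sub>G Y\<close> is formed from the orbits of \<open>X \<times> Y\<close> under
  \<open>(a, g) (x, y) = (x (a, g)\<^sup>-\<^sup>1, (a, g) y)\<close>, where the right action of \<open>g\<^sup>-\<^sup>1\<close> on \<open>X\<close> is
  the left action of \<open>(1, g)\<close>. As \<open>A\<close> need not act freely on these orbits, the tensor product
  of fibred bisets consists of those with trivial stabilizer in \<open>A\<close>; this is the
  source of the condition \<open>\<phi>(1, g) \<psi>(g, 1) = 1\<close> in the product formula for transitive bisets.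
\<close>

definition middle_action ::
    "('a, 'm) monoid_scheme \<Rightarrow> ('g, 'n) monoid_scheme \<Rightarrow> ('a, 'g, 'x) aset \<Rightarrow>
     ('a, 'g, 'y) aset \<Rightarrow> 'a \<times> 'g \<Rightarrow> 'x \<times> 'y \<Rightarrow> 'x \<times> 'y" where
  "middle_action A G X Y =
     (\<lambda>(a, g) (x, y). (snd X (inv\<^bsub>A\<^esub> a, \<one>\<^bsub>G\<^esub>, g) x, snd Y (a, g, \<one>\<^bsub>G\<^esub>) y))"

definition outer_action ::
    "('a, 'm) monoid_scheme \<Rightarrow> ('g, 'n) monoid_scheme \<Rightarrow> ('a, 'g, 'x) aset \<Rightarrow>
     ('a, 'g, 'y) aset \<Rightarrow> 'a \<times> 'g \<times> 'g \<Rightarrow> ('x \<times> 'y) set \<Rightarrow> ('x \<times> 'y) set" where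
  "outer_action A G X Y =
     (\<lambda>(a, u, v) T. (\<lambda>(x, y). (snd X (a, u, \<one>\<^bsub>G\<^esub>) x, snd Y (\<one>\<^bsub>A\<^esub>, \<one>\<^bsub>G\<^esub>, v) y)) ` T)"

definition tensor_carrier ::
    "('a, 'm) monoid_scheme \<Rightarrow> ('g, 'n) monoid_scheme \<Rightarrow> ('a, 'g, 'x) aset \<Rightarrow>
     ('a, 'g, 'y) aset \<Rightarrow> ('x \<times> 'y) set set" where
  "tensor_carrier A G X Y =
     {T \<in> orbits (A \<times>\<times> G) (fst X \<times> fst Y) (middle_action A G X Y).
        stabilizer A (fibre_action G (outer_action A G X Y)) T = {\<one>\<^bsub>A\<^esub>}}"

definition tensor ::
    "('a, 'm) monoid_scheme \<Rightarrow> ('g, 'n) monoid_scheme \<Rightarrow> ('a, 'g, 'x) aset \<Rightarrow>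
     ('a, 'g, 'y) aset \<Rightarrow> ('a, 'g, ('x \<times> 'y) set) aset" where
  "tensor A G X Y =
     (tensor_carrier A G X Y,
      \<lambda>p. restrict (outer_action A G X Y p) (tensor_carrier A G X Y))"

text \<open>The unit for the tensor product: \<open>A \<times> G\<close>, on which \<open>(a, u, v)\<close> acts by
  \<open>(b, g) \<mapsto> (a b, u g v\<^sup>-\<^sup>1)\<close>.\<close>

definition identity_biset ::
    "('a, 'm) monoid_scheme \<Rightarrow> ('g, 'n) monoid_scheme \<Rightarrow> ('a, 'g, 'a \<times> 'g) aset" where
  "identity_biset A G =
     (carrier A \<times> carrier G,
      \<lambda>(a, u, v). \<lambda>(b, g)\<in>carrier A \<times> carrier G.
        (a \<otimes>\<^bsub>A\<^esub> b, u \<otimes>\<^bsub>G\<^esub> g \<otimes>\<^bsub>G\<^esub> inv\<^bsub>G\<^esub> v))"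


section \<open>The fibred double Burnside algebra\<close>

text \<open>
  Being \<open>A\<close>-free with finitely many \<open>A\<close>-orbits, every fibred biset is isomorphic to one whose
  elements have type \<^typ>\<open>nat \<times> 'a\<close> (choose finitely many orbit representatives).
  Isomorphism classes are therefore taken among the fibred bisets on this type.
\<close>

type_synonym ('a, 'g) biset_class = "('a, 'g, nat \<times> 'a) aset set"

definition iso_class ::
    "('a, 'm) monoid_scheme \<Rightarrow> ('g, 'n) monoid_scheme \<Rightarrow> ('a, 'g, 'x) aset \<Rightarrow>
     ('a, 'g) biset_class" where
  "iso_class A G X = {Y. fibred_biset A G Y \<and> aset_iso A G Y X}"

definition biset_classes ::
    "('a, 'm) monoid_scheme \<Rightarrow> ('g, 'n) monoid_scheme \<Rightarrow> ('a, 'g) biset_class set" where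
  "biset_classes A G = {iso_class A G X |X :: ('a, 'g, nat \<times> 'a) aset. fibred_biset A G X}"

definition class_union ::
    "('a, 'm) monoid_scheme \<Rightarrow> ('g, 'n) monoid_scheme \<Rightarrow> ('a, 'g) biset_class \<Rightarrow>
     ('a, 'g) biset_class \<Rightarrow> ('a, 'g) biset_class" where
  "class_union A G C D = (\<Union>X\<in>C. \<Union>Y\<in>D. iso_class A G (disjoint_union X Y))"

definition class_tensor ::
    "('a, 'm) monoid_scheme \<Rightarrow> ('g, 'n) monoid_scheme \<Rightarrow> ('a, 'g) biset_class \<Rightarrow>
     ('a, 'g) biset_class \<Rightarrow> ('a, 'g) biset_class" where
  "class_tensor A G C D = (\<Union>X\<in>C. \<Union>Y\<in>D. iso_class A G (tensor A G X Y))"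

text \<open>
  \<open>K \<otimes> B\<^sup>A(G, G)\<close> is the free \<open>K\<close>-module on the isomorphism classes, modulo the \<open>K\<close>-span
  of the elements \<open>[X \<squnion> Y] - [X] - [Y]\<close>. On the free module, the tensor product is
  extended bilinearly.
\<close>

definition free_algebra ::
    "'k::field itself \<Rightarrow> ('a, 'm) monoid_scheme \<Rightarrow> ('g, 'n) monoid_scheme \<Rightarrow>
     (('a, 'g) biset_class \<Rightarrow>\<^sub>0 'k) ring" where
  "free_algebra _ A G =
     \<lparr>carrier = {f. Poly_Mapping.keys f \<subseteq> biset_classes A G},
      monoid.mult = (\<lambda>f h. \<Sum>C\<in>Poly_Mapping.keys f. \<Sum>D\<in>Poly_Mapping.keys h.
                Poly_Mapping.single (class_tensor A G C D)
                  (Poly_Mapping.lookup f C * Poly_Mapping.lookup h D)),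
      one = Poly_Mapping.single (iso_class A G (identity_biset A G)) 1,
      zero = 0,
      add = (+)\<rparr>"

text \<open>All scalar multiples occur among the generators, so the additive subgroup they generate
  is the \<open>K\<close>-span.\<close>

definition union_relations ::
    "'k::field itself \<Rightarrow> ('a, 'm) monoid_scheme \<Rightarrow> ('g, 'n) monoid_scheme \<Rightarrow>
     (('a, 'g) biset_class \<Rightarrow>\<^sub>0 'k) set" where
  "union_relations K A G =
     generate (add_monoid (free_algebra K A G))
       {Poly_Mapping.single (class_union A G C D) c
          - Poly_Mapping.single C c - Poly_Mapping.single D c |C D c.
        C \<in> biset_classes A G \<and> D \<in> biset_classes A G}"

definition fibred_double_burnside_algebra ::
    "'k::field itself \<Rightarrow> ('a, 'm) monoid_scheme \<Rightarrow> ('g, 'n) monoid_scheme \<Rightarrow>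
     (('a, 'g) biset_class \<Rightarrow>\<^sub>0 'k) set ring" where
  "fibred_double_burnside_algebra K A G = free_algebra K A G Quot union_relations K A G"


section \<open>Semisimple rings\<close>

definition left_ideal :: "'r set \<Rightarrow> ('r, 'm) ring_scheme \<Rightarrow> bool" where
  "left_ideal L R \<longleftrightarrow>
     additive_subgroup L R \<and> (\<forall>r\<in>carrier R. \<forall>x\<in>L. r \<otimes>\<^bsub>R\<^esub> x \<in> L)"

definition simple_left_ideal :: "'r set \<Rightarrow> ('r, 'm) ring_scheme \<Rightarrow> bool" where
  "simple_left_ideal L R \<longleftrightarrow>
     left_ideal L R \<and> L \<noteq> {\<zero>\<^bsub>R\<^esub>} \<and>
     (\<forall>M. left_ideal M R \<and> M \<subseteq> L \<longrightarrow> M = {\<zero>\<^bsub>R\<^esub>} \<or> M = L)"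

text \<open>The regular left module is a sum of simple submodules.\<close>

definition semisimple_ring :: "('r, 'm) ring_scheme \<Rightarrow> bool" where
  "semisimple_ring R \<longleftrightarrow> carrier R = generate (add_monoid R) (\<Union>{L. simple_left_ideal L R})"


section \<open>Hypotheses on the fibre group and on the scalars\<close>

definition pi_part :: "nat set \<Rightarrow> nat \<Rightarrow> nat" where
  "pi_part \<pi> n = (\<Prod>p\<in>prime_factors n \<inter> \<pi>. p ^ multiplicity p n)"

definition torsion_subgroup :: "('a, 'm) monoid_scheme \<Rightarrow> nat \<Rightarrow> 'a set" where
  "torsion_subgroup A n = {a \<in> carrier A. a [^]\<^bsub>A\<^esub> n = \<one>\<^bsub>A\<^esub>}"

definition cyclic_torsion :: "('a, 'm) monoid_scheme \<Rightarrow> nat set \<Rightarrow> bool" where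
  "cyclic_torsion A \<pi> \<longleftrightarrow>
     (\<forall>p\<in>\<pi>. prime p) \<and>
     (\<forall>n>0. cyclic_group (A\<lparr>carrier := torsion_subgroup A n\<rparr>) \<and>
            card (torsion_subgroup A n) = pi_part \<pi> n)"

definition group_exponent :: "('g, 'n) monoid_scheme \<Rightarrow> nat" where
  "group_exponent G = Lcm (group.ord G ` carrier G)"

definition primitive_root_of_unity :: "nat \<Rightarrow> 'k::field \<Rightarrow> bool" where
  "primitive_root_of_unity n \<zeta> \<longleftrightarrow> n > 0 \<and> \<zeta> ^ n = 1 \<and> (\<forall>m. 0 < m \<and> m < n \<longrightarrow> \<zeta> ^ m \<noteq> 1)"

end

theory Submission
  imports Defs
begin

text \<open>
  Let \<open>c \<in> G\<close> have prime order \<open>p\<close>, and let \<open>A\<^sub>p\<close> be the \<open>p\<close>-torsion of \<open>A\<close>, so that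
  \<open>|A\<^sub>p| = p\<close>. Write \<open>X\<close> for the regular biset \<open>A \<times> G \<times> G\<close> and \<open>n(Z)\<close> for the number of
  \<open>A\<close>-orbits of \<open>Z\<close>. Then \<open>[X] [Z] [X] = n(Z) [X]\<close>. For \<open>z \<in> A\<^sub>p\<close> let \<open>Q\<^sub>z\<close> be the identity biset
  divided by the subgroup generated by \<open>(z, c)\<close>. The group generated by \<open>c\<close> acts on the
  \<open>A\<close>-orbits of a biset \<open>Z\<close>; an orbit of length \<open>p\<close> of this action contributes \<open>1\<close> to
  \<open>n(Q\<^sub>z \<otimes> Z)\<close> for every \<open>z\<close>, and a fixed point contributes \<open>1\<close> for exactly one \<open>z\<close>. Hence
  \<open>n(Z)\<close> is the sum of the \<open>n(Q\<^sub>z \<otimes> Z)\<close>, that is, \<open>n(u r) = 0\<close> for all \<open>r\<close>, where \<open>u\<close> is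
  \<open>1\<close> minus the sum of the \<open>[Q\<^sub>z]\<close>. So \<open>x = [X] u\<close> satisfies \<open>x r x = n(u r) [X] u = 0\<close> for
  all \<open>r\<close>, while \<open>x \<noteq> 0\<close>: the right action of \<open>c\<close> fixes no \<open>A\<close>-orbit of \<open>X\<close> but fixes some
  \<open>A\<close>-orbit of each \<open>X \<otimes> Q\<^sub>z\<close>. A semisimple ring contains no such \<open>x\<close>.
\<close>

text \<open>A product [X] f [X] is a multiple of [X], so everything that survives of f between two
  copies of X is the scalar n(f). Hence [X] u generates a nilpotent ideal as soon as u lies in the
  radical of the form (f, h) \<mapsto> n(f h), and the problem is to find such a u with [X] u
  \<noteq> 0. The sum over A_p lies in this radical because |A_p| = p: an orbit of length p consists
  of p A-orbits of Z and has to be counted p times, once for each z. The algebra is a free module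
  modulo the span of the union relations, and the proof does not pass through the basis of
  transitive bisets. Identities are congruences modulo this span. That x is nonzero is detected by a
  linear functional: the number of A-orbits fixed by a given group element adds up over disjoint
  unions, so it vanishes on all relations.\<close>

section \<open>Elements x with x R x = 0 in a semisimple ring R\<close>

text \<open>Such an x kills every simple left ideal L: for l in L, the left ideal R x l lies in L.
  It is zero, which gives x l = 0, or it is L, and then l = r x l for some r, so that x l = (x r x)
  l = 0. As 1 is a sum of elements of simple left ideals, x = x 1 = 0.\<close>

lemma not_semisimple_ring_if_square_zero:
  assumes "ring R" and x: "x \<in> carrier R" and nz: "x \<noteq> \<zero>\<^bsub>R\<^esub>"
    and sq: "\<And>r. r \<in> carrier R \<Longrightarrow> x \<otimes>\<^bsub>R\<^esub> (r \<otimes>\<^bsub>R\<^esub> x) = \<zero>\<^bsub>R\<^esub>"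
  shows "\<not> semisimple_ring R"
proof
  interpret ring R by fact
  assume ss: "semisimple_ring R"
  have kill: "x \<otimes>\<^bsub>R\<^esub> l = \<zero>\<^bsub>R\<^esub>" if L: "simple_left_ideal L R" and l: "l \<in> L" for L l
  proof -
    from L have LI: "left_ideal L R" by (simp add: simple_left_ideal_def)
    then interpret L: additive_subgroup L R by (simp add: left_ideal_def)
    have lc: "l \<in> carrier R" using l L.a_subset by auto
    define M where "M = {r \<otimes>\<^bsub>R\<^esub> (x \<otimes>\<^bsub>R\<^esub> l) | r. r \<in> carrier R}"
    have MI: "left_ideal M R"
      unfolding left_ideal_def
    proof (intro conjI ballI)
      show "additive_subgroup M R"
      proof (rule additive_subgroupI, rule group.subgroupI)
        show "M \<noteq> {}" using zero_closed by (auto simp: M_def)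
        show "group (add_monoid R)" by (rule a_group)
        show "M \<subseteq> carrier (add_monoid R)" using lc x by (auto simp: M_def)
        fix a assume "a \<in> M"
        then obtain r where r: "r \<in> carrier R" "a = r \<otimes>\<^bsub>R\<^esub> (x \<otimes>\<^bsub>R\<^esub> l)" by (auto simp: M_def)
        have "\<ominus>\<^bsub>R\<^esub> a = (\<ominus>\<^bsub>R\<^esub> r) \<otimes>\<^bsub>R\<^esub> (x \<otimes>\<^bsub>R\<^esub> l)"
          using r lc x by (simp add: l_minus)
        then show "inv\<^bsub>add_monoid R\<^esub> a \<in> M"
          unfolding M_def a_inv_def[symmetric] using r by blast
        fix b assume "b \<in> M"
        then obtain s where s: "s \<in> carrier R" "b = s \<otimes>\<^bsub>R\<^esub> (x \<otimes>\<^bsub>R\<^esub> l)" by (auto simp: M_def)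
        have "a \<oplus>\<^bsub>R\<^esub> b = (r \<oplus>\<^bsub>R\<^esub> s) \<otimes>\<^bsub>R\<^esub> (x \<otimes>\<^bsub>R\<^esub> l)"
          using r s lc x by (simp add: l_distr)
        then show "a \<otimes>\<^bsub>add_monoid R\<^esub> b \<in> M"
          unfolding M_def using r s by auto
      qed
    next
      fix s a assume s: "s \<in> carrier R" and "a \<in> M"
      then obtain r where r: "r \<in> carrier R" "a = r \<otimes>\<^bsub>R\<^esub> (x \<otimes>\<^bsub>R\<^esub> l)" by (auto simp: M_def)
      have "s \<otimes>\<^bsub>R\<^esub> a = (s \<otimes>\<^bsub>R\<^esub> r) \<otimes>\<^bsub>R\<^esub> (x \<otimes>\<^bsub>R\<^esub> l)"
        using r s lc x by (simp add: m_assoc)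
      then show "s \<otimes>\<^bsub>R\<^esub> a \<in> M" unfolding M_def using r s by auto
    qed
    have "M \<subseteq> L"
      using LI l x by (auto simp: left_ideal_def M_def)
    then consider "M = {\<zero>\<^bsub>R\<^esub>}" | "M = L"
      using L MI by (auto simp: simple_left_ideal_def)
    then show ?thesis
    proof cases
      case 1
      have "\<one>\<^bsub>R\<^esub> \<otimes>\<^bsub>R\<^esub> (x \<otimes>\<^bsub>R\<^esub> l) \<in> M" unfolding M_def by blast
      with 1 lc x show ?thesis by simp
    next
      case 2
      then obtain r where r: "r \<in> carrier R" "l = r \<otimes>\<^bsub>R\<^esub> (x \<otimes>\<^bsub>R\<^esub> l)"
        using l by (auto simp: M_def)
      have "x \<otimes>\<^bsub>R\<^esub> l = (x \<otimes>\<^bsub>R\<^esub> (r \<otimes>\<^bsub>R\<^esub> x)) \<otimes>\<^bsub>R\<^esub> l"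
        using r x lc by (metis m_assoc m_closed)
      then show ?thesis using sq r lc by simp
    qed
  qed
  have "x \<otimes>\<^bsub>R\<^esub> y = \<zero>\<^bsub>R\<^esub> \<and> y \<in> carrier R"
    if "y \<in> generate (add_monoid R) (\<Union>{L. simple_left_ideal L R})" for y
    using that
  proof induction
    case one
    then show ?case using x by simp
  next
    case (incl h)
    then obtain L where L: "simple_left_ideal L R" "h \<in> L" by auto
    then interpret L: additive_subgroup L R by (simp add: left_ideal_def simple_left_ideal_def)
    show ?case using kill[OF L] L L.a_subset by auto
  next
    case (inv h)
    then obtain L where L: "simple_left_ideal L R" "h \<in> L" by auto
    then interpret L: additive_subgroup L R by (simp add: left_ideal_def simple_left_ideal_def)
    have "h \<in> carrier R" using L L.a_subset by auto
    then show ?case using kill[OF L] x unfolding a_inv_def[symmetric] by (simp add: r_minus)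
  next
    case (eng h k)
    then show ?case using x by (simp add: r_distr)
  qed
  then have "x \<otimes>\<^bsub>R\<^esub> \<one>\<^bsub>R\<^esub> = \<zero>\<^bsub>R\<^esub>" using ss one_closed unfolding semisimple_ring_def by blast
  with nz x show False by simp
qed

text \<open>\<open>f\<close> and \<open>g\<close> induce the same partition of \<open>S\<close>, and
  both images are in bijection with its set of parts, finite or not. This lets A-orbits of a tensor
  product be counted on representatives.\<close>

lemma card_image_cong:
  assumes "\<And>x y. x \<in> S \<Longrightarrow> y \<in> S \<Longrightarrow> f x = f y \<longleftrightarrow> g x = g y"
  shows "card (f ` S) = card (g ` S)"
proof -
  have "bij_betw (\<lambda>z. g (SOME x. x \<in> S \<and> f x = z)) (f ` S) (g ` S)"
  proof (rule bij_betw_byWitness[where f' = "\<lambda>z. f (SOME x. x \<in> S \<and> g x = z)"])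
    have 1: "(SOME y. y \<in> S \<and> f y = f x) \<in> S \<and> f (SOME y. y \<in> S \<and> f y = f x) = f x" if "x \<in> S" for x
      by (rule someI[of _ x]) (simp add: that)
    have 2: "(SOME y. y \<in> S \<and> g y = g x) \<in> S \<and> g (SOME y. y \<in> S \<and> g y = g x) = g x" if "x \<in> S" for x
      by (rule someI[of _ x]) (simp add: that)
    have 3: "g (SOME y. y \<in> S \<and> f y = f x) = g x" if "x \<in> S" for x
      using 1[OF that] assms that by blast
    have 4: "f (SOME y. y \<in> S \<and> g y = g x) = f x" if "x \<in> S" for x
      using 2[OF that] assms that by blast
    show "\<forall>a\<in>f ` S. f (SOME x. x \<in> S \<and> g x = g (SOME x. x \<in> S \<and> f x = a)) = a"
      using 3 4 by auto
    show "\<forall>a\<in>g ` S. g (SOME x. x \<in> S \<and> f x = f (SOME x. x \<in> S \<and> g x = a)) = a"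
      using 3 4 by auto
    show "(\<lambda>z. g (SOME x. x \<in> S \<and> f x = z)) ` f ` S \<subseteq> g ` S" using 3 by auto
    show "(\<lambda>z. f (SOME x. x \<in> S \<and> g x = z)) ` g ` S \<subseteq> f ` S" using 4 by auto
  qed
  then show ?thesis by (rule bij_betw_same_card)
qed

section \<open>The action on a fibred biset and its A-orbits\<close>

locale fibre_setting = A: comm_group A + G: comm_group G
  for A :: "('a, 'm) monoid_scheme" and G :: "('g, 'n) monoid_scheme"
begin

abbreviation acting_group :: "('a \<times> 'g \<times> 'g) monoid" where
  "acting_group \<equiv> A \<times>\<times> (G \<times>\<times> G)"

abbreviation fibred :: "('a, 'g, 'x) aset \<Rightarrow> bool" where
  "fibred \<equiv> fibred_biset A G"

abbreviation iso (infix "\<approx>" 50) where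
  "X \<approx> Y \<equiv> aset_iso A G X Y"

lemma group_acting_group: "group acting_group"
  by (intro DirProd_group A.group_axioms G.group_axioms)

context
  fixes X :: "('a, 'g, 'x) aset"
  assumes X: "fibred X"
begin

lemma group_action_fibred: "group_action acting_group (fst X) (snd X)"
  using X by (simp add: fibred_biset_def)

lemma act_closed:
  assumes "x \<in> fst X" "a \<in> carrier A" "u \<in> carrier G" "v \<in> carrier G"
  shows "snd X (a, u, v) x \<in> fst X"
  using group_action.element_image[OF group_action_fibred, of "(a,u,v)" x] assms by simp

lemma act_act:
  assumes "x \<in> fst X" "a \<in> carrier A" "u \<in> carrier G" "v \<in> carrier G"
    "b \<in> carrier A" "s \<in> carrier G" "t \<in> carrier G"
  shows "snd X (a, u, v) (snd X (b, s, t) x) = snd X (a \<otimes>\<^bsub>A\<^esub> b, u \<otimes>\<^bsub>G\<^esub> s, v \<otimes>\<^bsub>G\<^esub> t) x"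
  using group_action.composition_rule[OF group_action_fibred, of x "(a,u,v)" "(b,s,t)"] assms by simp

lemma act_one:
  assumes "x \<in> fst X"
  shows "snd X (\<one>\<^bsub>A\<^esub>, \<one>\<^bsub>G\<^esub>, \<one>\<^bsub>G\<^esub>) x = x"
  using fun_cong[OF group_action.id_eq_one[OF group_action_fibred], of x] assms by simp

lemma act_free:
  assumes "x \<in> fst X" "a \<in> carrier A" "snd X (a, \<one>\<^bsub>G\<^esub>, \<one>\<^bsub>G\<^esub>) x = x"
  shows "a = \<one>\<^bsub>A\<^esub>"
  using X assms unfolding fibred_biset_def stabilizer_def fibre_action_def by blast

lemma act_fibre_eq_iff:
  assumes "x \<in> fst X" "a \<in> carrier A" "b \<in> carrier A"
  shows "snd X (a, \<one>\<^bsub>G\<^esub>, \<one>\<^bsub>G\<^esub>) x = snd X (b, \<one>\<^bsub>G\<^esub>, \<one>\<^bsub>G\<^esub>) x \<longleftrightarrow> a = b"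
proof
  assume "snd X (a, \<one>\<^bsub>G\<^esub>, \<one>\<^bsub>G\<^esub>) x = snd X (b, \<one>\<^bsub>G\<^esub>, \<one>\<^bsub>G\<^esub>) x"
  then have "snd X (inv\<^bsub>A\<^esub> b, \<one>\<^bsub>G\<^esub>, \<one>\<^bsub>G\<^esub>) (snd X (a, \<one>\<^bsub>G\<^esub>, \<one>\<^bsub>G\<^esub>) x) =
    snd X (inv\<^bsub>A\<^esub> b, \<one>\<^bsub>G\<^esub>, \<one>\<^bsub>G\<^esub>) (snd X (b, \<one>\<^bsub>G\<^esub>, \<one>\<^bsub>G\<^esub>) x)" by simp
  then have "snd X (inv\<^bsub>A\<^esub> b \<otimes>\<^bsub>A\<^esub> a, \<one>\<^bsub>G\<^esub>, \<one>\<^bsub>G\<^esub>) x = x"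
    using assms by (simp add: act_act act_one)
  then have "inv\<^bsub>A\<^esub> b \<otimes>\<^bsub>A\<^esub> a = \<one>\<^bsub>A\<^esub>"
    using assms act_free by simp
  then show "a = b" using assms by (metis A.inv_closed A.inv_comm A.inv_equality A.inv_inv)
qed simp

lemma finite_fibre_orbits: "finite (orbits A (fst X) (fibre_action G (snd X)))"
  using X by (simp add: fibred_biset_def)

end

text \<open>With A-orbits as values of a function on points, the number n(X) becomes the cardinality
  of the image of \<open>fst X\<close> under \<open>fibre_orbit X\<close>.\<close>

definition fibre_orbit :: "('a, 'g, 'x) aset \<Rightarrow> 'x \<Rightarrow> 'x set" where
  "fibre_orbit X x = {snd X (a, \<one>\<^bsub>G\<^esub>, \<one>\<^bsub>G\<^esub>) x | a. a \<in> carrier A}"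

lemma fibre_orbits_eq: "orbits A (fst X) (fibre_action G (snd X)) = fibre_orbit X ` fst X"
  by (auto simp: orbits_def orbit_def fibre_orbit_def fibre_action_def)

lemma fibre_orbit_self:
  assumes "fibred X" "x \<in> fst X"
  shows "x \<in> fibre_orbit X x"
  unfolding fibre_orbit_def using act_one[OF assms, symmetric] by auto

lemma fibre_orbit_eq_iff:
  assumes "fibred X" "x \<in> fst X" "y \<in> fst X"
  shows "fibre_orbit X x = fibre_orbit X y \<longleftrightarrow> (\<exists>a\<in>carrier A. y = snd X (a, \<one>\<^bsub>G\<^esub>, \<one>\<^bsub>G\<^esub>) x)"
proof
  assume "fibre_orbit X x = fibre_orbit X y"
  then show "\<exists>a\<in>carrier A. y = snd X (a, \<one>\<^bsub>G\<^esub>, \<one>\<^bsub>G\<^esub>) x"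
    using fibre_orbit_self[OF assms(1,3)] by (auto simp: fibre_orbit_def)
next
  assume "\<exists>a\<in>carrier A. y = snd X (a, \<one>\<^bsub>G\<^esub>, \<one>\<^bsub>G\<^esub>) x"
  then obtain a where a: "a \<in> carrier A" "y = snd X (a, \<one>\<^bsub>G\<^esub>, \<one>\<^bsub>G\<^esub>) x" by auto
  have "\<exists>c. snd X (b, \<one>\<^bsub>G\<^esub>, \<one>\<^bsub>G\<^esub>) x = snd X (c, \<one>\<^bsub>G\<^esub>, \<one>\<^bsub>G\<^esub>) y \<and> c \<in> carrier A" if "b \<in> carrier A" for b
    using a that assms by (intro exI[of _ "b \<otimes>\<^bsub>A\<^esub> inv\<^bsub>A\<^esub> a"]) (simp add: act_act A.m_assoc)
  moreover have "\<exists>c. snd X (b, \<one>\<^bsub>G\<^esub>, \<one>\<^bsub>G\<^esub>) y = snd X (c, \<one>\<^bsub>G\<^esub>, \<one>\<^bsub>G\<^esub>) x \<and> c \<in> carrier A" if "b \<in> carrier A" for b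
    using a that assms by (intro exI[of _ "b \<otimes>\<^bsub>A\<^esub> a"]) (simp add: act_act)
  ultimately show "fibre_orbit X x = fibre_orbit X y"
    unfolding fibre_orbit_def by auto
qed

text \<open>Bijectivity of each acting element comes from \<open>one\<close> and \<open>act\<close>
  applied to the inverse group element. The condition \<open>ext\<close> reflects that members of
  \<open>Bij\<close> are extensional functions; for this reason the actions of concrete bisets are
  cut off outside their carriers.\<close>

lemma fibred_bisetI:
  assumes closed: "\<And>a u v x. a \<in> carrier A \<Longrightarrow> u \<in> carrier G \<Longrightarrow> v \<in> carrier G \<Longrightarrow> x \<in> fst X \<Longrightarrow>
      snd X (a, u, v) x \<in> fst X"
    and ext: "\<And>a u v. a \<in> carrier A \<Longrightarrow> u \<in> carrier G \<Longrightarrow> v \<in> carrier G \<Longrightarrow>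
      snd X (a, u, v) \<in> extensional (fst X)"
    and one: "\<And>x. x \<in> fst X \<Longrightarrow> snd X (\<one>\<^bsub>A\<^esub>, \<one>\<^bsub>G\<^esub>, \<one>\<^bsub>G\<^esub>) x = x"
    and act: "\<And>a u v b s t x. a \<in> carrier A \<Longrightarrow> u \<in> carrier G \<Longrightarrow> v \<in> carrier G \<Longrightarrow>
      b \<in> carrier A \<Longrightarrow> s \<in> carrier G \<Longrightarrow> t \<in> carrier G \<Longrightarrow> x \<in> fst X \<Longrightarrow>
      snd X (a, u, v) (snd X (b, s, t) x) = snd X (a \<otimes>\<^bsub>A\<^esub> b, u \<otimes>\<^bsub>G\<^esub> s, v \<otimes>\<^bsub>G\<^esub> t) x"
    and free: "\<And>a x. a \<in> carrier A \<Longrightarrow> x \<in> fst X \<Longrightarrow> snd X (a, \<one>\<^bsub>G\<^esub>, \<one>\<^bsub>G\<^esub>) x = x \<Longrightarrow> a = \<one>\<^bsub>A\<^esub>"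
    and fin: "finite (fibre_orbit X ` fst X)"
  shows "fibred X"
proof -
  have Bij: "snd X (a, u, v) \<in> Bij (fst X)"
    if "a \<in> carrier A" "u \<in> carrier G" "v \<in> carrier G" for a u v
  proof -
    have "bij_betw (snd X (a, u, v)) (fst X) (fst X)"
      by (rule bij_betw_byWitness[where f' = "snd X (inv\<^bsub>A\<^esub> a, inv\<^bsub>G\<^esub> u, inv\<^bsub>G\<^esub> v)"])
        (use that closed in \<open>auto simp: act one\<close>)
    with ext[OF that] show ?thesis by (simp add: Bij_def)
  qed
  have "group_action acting_group (fst X) (snd X)"
  proof (rule group_action.intro, rule group_hom.intro)
    show "group acting_group" by (rule group_acting_group)
    show "group (BijGroup (fst X))" by (rule group_BijGroup)
    show "group_hom_axioms acting_group (BijGroup (fst X)) (snd X)"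
    proof (rule group_hom_axioms.intro, rule homI)
      fix p assume "p \<in> carrier acting_group"
      then show "snd X p \<in> carrier (BijGroup (fst X))" using Bij by (auto simp: BijGroup_def)
    next
      fix p q assume "p \<in> carrier acting_group" "q \<in> carrier acting_group"
      then obtain a u v b s t where pq: "p = (a, u, v)" "q = (b, s, t)"
        "a \<in> carrier A" "u \<in> carrier G" "v \<in> carrier G" "b \<in> carrier A" "s \<in> carrier G" "t \<in> carrier G"
        by auto
      have "snd X (a \<otimes>\<^bsub>A\<^esub> b, u \<otimes>\<^bsub>G\<^esub> s, v \<otimes>\<^bsub>G\<^esub> t) = compose (fst X) (snd X p) (snd X q)"
        by (rule extensionalityI[of _ "fst X"]) (use pq in \<open>auto simp: ext compose_eq act\<close>)
      with pq Bij show "snd X (p \<otimes>\<^bsub>acting_group\<^esub> q) = snd X p \<otimes>\<^bsub>BijGroup (fst X)\<^esub> snd X q"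
        by (simp add: BijGroup_def)
    qed
  qed
  moreover have "stabilizer A (fibre_action G (snd X)) x = {\<one>\<^bsub>A\<^esub>}" if "x \<in> fst X" for x
    using free one that by (auto simp: stabilizer_def fibre_action_def)
  ultimately show ?thesis
    using fin by (simp add: fibred_biset_def fibre_orbits_eq)
qed

section \<open>Isomorphisms and tensor products\<close>

text \<open>Points of a tensor product are classes, and maps out of them are awkward to define. If
  both carriers are images of one index set \<open>S\<close>, and \<open>h\<close> and
  \<open>k\<close> identify the same indices, then sending \<open>h s\<close> to \<open>k s\<close>
  is well defined and bijective, and equivariance can be checked on indices.\<close>

lemma isoI_pairing:
  assumes "fst X = h ` S" "fst Y = k ` S"
    and "\<And>s t. s \<in> S \<Longrightarrow> t \<in> S \<Longrightarrow> h s = h t \<longleftrightarrow> k s = k t"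
    and "\<And>a u v s. a \<in> carrier A \<Longrightarrow> u \<in> carrier G \<Longrightarrow> v \<in> carrier G \<Longrightarrow> s \<in> S \<Longrightarrow>
      \<exists>t\<in>S. snd X (a, u, v) (h s) = h t \<and> snd Y (a, u, v) (k s) = k t"
  shows "X \<approx> Y"
proof -
  define f where "f x = k (SOME s. s \<in> S \<and> h s = x)" for x
  have f: "f (h s) = k s" if "s \<in> S" for s
  proof -
    have "(SOME t. t \<in> S \<and> h t = h s) \<in> S \<and> h (SOME t. t \<in> S \<and> h t = h s) = h s"
      by (rule someI[of _ s]) (simp add: that)
    then show ?thesis unfolding f_def using assms(3) that by blast
  qed
  have "inj_on f (fst X)" 
  proof (rule inj_onI)
    fix x y assume "x \<in> fst X" "y \<in> fst X" "f x = f y"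
    then obtain s t where "s \<in> S" "t \<in> S" "x = h s" "y = h t" "k s = k t"
      using assms(1) f by auto
    then show "x = y" using assms(3) by metis
  qed
  moreover have "f ` fst X = fst Y" using f by (simp add: assms(1,2) image_image cong: image_cong)
  moreover have "f (snd X (a, u, v) x) = snd Y (a, u, v) (f x)"
    if p: "a \<in> carrier A" "u \<in> carrier G" "v \<in> carrier G" and x: "x \<in> fst X" for a u v x
  proof -
    obtain s where s: "s \<in> S" "x = h s" using x assms(1) by auto
    obtain t where "t \<in> S" "snd X (a, u, v) (h s) = h t" "snd Y (a, u, v) (k s) = k t"
      using assms(4)[OF p s(1)] by blast
    then show ?thesis using f s by simp
  qed
  ultimately show ?thesis unfolding aset_iso_def bij_betw_def by (intro exI[of _ f]) auto
qed

lemma isoE: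
  assumes "X \<approx> Y"
  obtains f where "bij_betw f (fst X) (fst Y)"
    "\<And>a u v x. a \<in> carrier A \<Longrightarrow> u \<in> carrier G \<Longrightarrow> v \<in> carrier G \<Longrightarrow> x \<in> fst X \<Longrightarrow>
      f (snd X (a, u, v) x) = snd Y (a, u, v) (f x)"
  using assms unfolding aset_iso_def by auto

lemma iso_trans:
  assumes "X \<approx> Y" "Y \<approx> Z"
  shows "X \<approx> Z"
proof -
  obtain f where f: "bij_betw f (fst X) (fst Y)"
    "\<And>a u v x. a \<in> carrier A \<Longrightarrow> u \<in> carrier G \<Longrightarrow> v \<in> carrier G \<Longrightarrow> x \<in> fst X \<Longrightarrow>
      f (snd X (a, u, v) x) = snd Y (a, u, v) (f x)" by (rule isoE[OF assms(1)]) blast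
  obtain g where g: "bij_betw g (fst Y) (fst Z)"
    "\<And>a u v x. a \<in> carrier A \<Longrightarrow> u \<in> carrier G \<Longrightarrow> v \<in> carrier G \<Longrightarrow> x \<in> fst Y \<Longrightarrow>
      g (snd Y (a, u, v) x) = snd Z (a, u, v) (g x)" by (rule isoE[OF assms(2)]) blast
  have "f x \<in> fst Y" if "x \<in> fst X" for x using f(1) that by (auto simp: bij_betw_def)
  with f g show ?thesis
    unfolding aset_iso_def
    by (intro exI[of _ "g \<circ> f"]) (auto intro: bij_betw_trans)
qed

lemma iso_sym:
  assumes "fibred X" "X \<approx> Y"
  shows "Y \<approx> X"
proof -
  obtain f where f: "bij_betw f (fst X) (fst Y)"
    "\<And>a u v x. a \<in> carrier A \<Longrightarrow> u \<in> carrier G \<Longrightarrow> v \<in> carrier G \<Longrightarrow> x \<in> fst X \<Longrightarrow>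
      f (snd X (a, u, v) x) = snd Y (a, u, v) (f x)" by (rule isoE[OF assms(2)]) blast
  show ?thesis
  proof (rule isoI_pairing[where S = "fst X" and h = f and k = "\<lambda>x. x"])
    show "fst Y = f ` fst X" using f(1) by (auto simp: bij_betw_def)
    show "f s = f t \<longleftrightarrow> s = t" if "s \<in> fst X" "t \<in> fst X" for s t
      using f(1) that by (auto simp: bij_betw_def inj_on_def)
  qed (use f(2) act_closed[OF assms(1)] in \<open>auto intro!: bexI\<close>)
qed

lemma fibred_transport:
  assumes X: "fibred X" and f: "inj_on f (fst X)"
  defines "Y \<equiv> (f ` fst X, \<lambda>p. \<lambda>y\<in>f ` fst X. f (snd X p (the_inv_into (fst X) f y)))"
  shows "fibred Y" "Y \<approx> X"
proof -
  have act: "snd Y p (f x) = f (snd X p x)" if "x \<in> fst X" for p x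
    using that f by (simp add: Y_def the_inv_into_f_f)
  have fst: "fst Y = f ` fst X" by (simp add: Y_def)
  show "fibred Y"
  proof (rule fibred_bisetI)
    show "finite (fibre_orbit Y ` fst Y)"
    proof -
      have "fibre_orbit Y (f x) = f ` fibre_orbit X x" if "x \<in> fst X" for x
        using that by (auto simp: fibre_orbit_def act)
      then have "fibre_orbit Y ` fst Y = (`) f ` fibre_orbit X ` fst X"
        unfolding fst image_image by (intro image_cong) auto
      then show ?thesis using finite_fibre_orbits[OF X] by (simp add: fibre_orbits_eq)
    qed
  next
    fix a x assume "a \<in> carrier A" "x \<in> fst Y" "snd Y (a, \<one>\<^bsub>G\<^esub>, \<one>\<^bsub>G\<^esub>) x = x"
    then obtain z where z: "z \<in> fst X" "x = f z" "f (snd X (a, \<one>\<^bsub>G\<^esub>, \<one>\<^bsub>G\<^esub>) z) = f z"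
      using act fst by auto
    then have "snd X (a, \<one>\<^bsub>G\<^esub>, \<one>\<^bsub>G\<^esub>) z = z"
      using f act_closed[OF X] \<open>a \<in> carrier A\<close> by (auto dest: inj_onD)
    then show "a = \<one>\<^bsub>A\<^esub>" using act_free[OF X] z \<open>a \<in> carrier A\<close> by blast
  next
    show "snd Y (a, u, v) \<in> extensional (fst Y)" for a u v by (simp add: Y_def)
  qed (auto simp: fst act act_closed[OF X] act_one[OF X] act_act[OF X])
  show "Y \<approx> X"
  proof (rule isoI_pairing[where S = "fst X" and h = f and k = "\<lambda>x. x"])
    show "f s = f t \<longleftrightarrow> s = t" if "s \<in> fst X" "t \<in> fst X" for s t
      using f that by (auto simp: inj_on_def)
  qed (use act act_closed[OF X] in \<open>auto simp: fst intro!: bexI\<close>)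
qed

text \<open>Isomorphism classes consist of bisets on the type \<open>nat \<times> 'a\<close>,
  whereas tensor products, unions and quotients live on other types. A point x is encoded by the
  number of its A-orbit and a scalar carrying the chosen representative of that orbit to x.\<close>

lemma ex_fibred_nat:
  assumes X: "fibred X"
  obtains Y :: "('a, 'g, nat \<times> 'a) aset" where "fibred Y" "Y \<approx> X"
proof -
  let ?O = "fibre_orbit X ` fst X"
  have "finite ?O" using finite_fibre_orbits[OF X] by (simp add: fibre_orbits_eq)
  then obtain i :: "'b set \<Rightarrow> nat" where i: "inj_on i ?O"
    using finite_imp_inj_to_nat_seg by blast
  define r where "r x = (SOME y. y \<in> fst X \<and> fibre_orbit X y = fibre_orbit X x)" for x
  have r: "r x \<in> fst X \<and> fibre_orbit X (r x) = fibre_orbit X x" if "x \<in> fst X" for x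
    unfolding r_def by (rule someI[of _ x]) (simp add: that)
  define c where "c x = (SOME a. a \<in> carrier A \<and> x = snd X (a, \<one>\<^bsub>G\<^esub>, \<one>\<^bsub>G\<^esub>) (r x))" for x
  have c: "c x \<in> carrier A \<and> x = snd X (c x, \<one>\<^bsub>G\<^esub>, \<one>\<^bsub>G\<^esub>) (r x)" if "x \<in> fst X" for x
  proof -
    have "\<exists>a\<in>carrier A. x = snd X (a, \<one>\<^bsub>G\<^esub>, \<one>\<^bsub>G\<^esub>) (r x)"
      using r[OF that] fibre_orbit_eq_iff[OF X, of "r x" x] that by simp
    then have "\<exists>a. a \<in> carrier A \<and> x = snd X (a, \<one>\<^bsub>G\<^esub>, \<one>\<^bsub>G\<^esub>) (r x)" by blast
    then show ?thesis unfolding c_def by (rule someI_ex)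
  qed
  define f where "f x = (i (fibre_orbit X x), c x)" for x
  have "inj_on f (fst X)"
  proof (rule inj_onI)
    fix x y assume xy: "x \<in> fst X" "y \<in> fst X" "f x = f y"
    then have "fibre_orbit X x = fibre_orbit X y" using i by (auto simp: f_def inj_on_def)
    then have "r x = r y" by (simp add: r_def)
    moreover have "c x = c y" using xy(3) by (simp add: f_def)
    ultimately show "x = y" using c[OF xy(1)] c[OF xy(2)] by simp
  qed
  from fibred_transport[OF X this] show thesis by (rule that)
qed

section \<open>Elementary tensors: classes of pairs under the middle action\<close>

definition cls :: "('a, 'g, 'x) aset \<Rightarrow> ('a, 'g, 'y) aset \<Rightarrow> 'x \<Rightarrow> 'y \<Rightarrow> ('x \<times> 'y) set" where
  "cls X Y x y = orbit (A \<times>\<times> G) (middle_action A G X Y) (x, y)"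

lemma cls_eq:
  "cls X Y x y = {(snd X (inv\<^bsub>A\<^esub> a, \<one>\<^bsub>G\<^esub>, g) x, snd Y (a, g, \<one>\<^bsub>G\<^esub>) y) | a g. a \<in> carrier A \<and> g \<in> carrier G}"
  by (auto simp: cls_def orbit_def middle_action_def)

text \<open>\<open>A\<close> acts freely at the class of \<open>(x, y)\<close>, that is, the class belongs to the tensor product.\<close>

definition good :: "('a, 'g, 'x) aset \<Rightarrow> ('a, 'g, 'y) aset \<Rightarrow> 'x \<Rightarrow> 'y \<Rightarrow> bool" where
  "good X Y x y \<longleftrightarrow> (\<forall>a\<in>carrier A. cls X Y (snd X (a, \<one>\<^bsub>G\<^esub>, \<one>\<^bsub>G\<^esub>) x) y = cls X Y x y \<longrightarrow> a = \<one>\<^bsub>A\<^esub>)"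

context
  fixes X :: "('a, 'g, 'x) aset" and Y :: "('a, 'g, 'y) aset"
  assumes X: "fibred X" and Y: "fibred Y"
begin

lemma cls_self:
  assumes "x \<in> fst X" "y \<in> fst Y"
  shows "(x, y) \<in> cls X Y x y"
  unfolding cls_eq
  using act_one[OF X assms(1)] act_one[OF Y assms(2)]
  by (auto intro!: exI[of _ "\<one>\<^bsub>A\<^esub>"] exI[of _ "\<one>\<^bsub>G\<^esub>"])

lemma cls_mid:
  assumes "x \<in> fst X" "y \<in> fst Y" "a \<in> carrier A" "g \<in> carrier G"
  shows "cls X Y (snd X (inv\<^bsub>A\<^esub> a, \<one>\<^bsub>G\<^esub>, g) x) (snd Y (a, g, \<one>\<^bsub>G\<^esub>) y) = cls X Y x y"
proof -
  have *: "cls X Y (snd X (inv\<^bsub>A\<^esub> a, \<one>\<^bsub>G\<^esub>, g) x) (snd Y (a, g, \<one>\<^bsub>G\<^esub>) y) \<subseteq> cls X Y x y"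
    if "x \<in> fst X" "y \<in> fst Y" "a \<in> carrier A" "g \<in> carrier G" for x y a g
  proof
    fix z assume "z \<in> cls X Y (snd X (inv\<^bsub>A\<^esub> a, \<one>\<^bsub>G\<^esub>, g) x) (snd Y (a, g, \<one>\<^bsub>G\<^esub>) y)"
    then obtain b h where "b \<in> carrier A" "h \<in> carrier G"
      "z = (snd X (inv\<^bsub>A\<^esub> b, \<one>\<^bsub>G\<^esub>, h) (snd X (inv\<^bsub>A\<^esub> a, \<one>\<^bsub>G\<^esub>, g) x),
        snd Y (b, h, \<one>\<^bsub>G\<^esub>) (snd Y (a, g, \<one>\<^bsub>G\<^esub>) y))" by (auto simp: cls_eq)
    then show "z \<in> cls X Y x y"
      using that unfolding cls_eq
      by (auto intro!: exI[of _ "b \<otimes>\<^bsub>A\<^esub> a"] exI[of _ "h \<otimes>\<^bsub>G\<^esub> g"]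
          simp: act_act[OF X] act_act[OF Y] A.inv_mult)
  qed
  moreover have "cls X Y x y \<subseteq> cls X Y (snd X (inv\<^bsub>A\<^esub> a, \<one>\<^bsub>G\<^esub>, g) x) (snd Y (a, g, \<one>\<^bsub>G\<^esub>) y)"
    using *[of "snd X (inv\<^bsub>A\<^esub> a, \<one>\<^bsub>G\<^esub>, g) x" "snd Y (a, g, \<one>\<^bsub>G\<^esub>) y" "inv\<^bsub>A\<^esub> a" "inv\<^bsub>G\<^esub> g"] assms
    by (simp add: act_closed[OF X] act_closed[OF Y] act_act[OF X] act_act[OF Y] act_one[OF X] act_one[OF Y])
  ultimately show ?thesis using assms by blast
qed

lemma cls_eq_iff:
  assumes "x \<in> fst X" "y \<in> fst Y" "x' \<in> fst X" "y' \<in> fst Y"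
  shows "cls X Y x y = cls X Y x' y' \<longleftrightarrow>
    (\<exists>a\<in>carrier A. \<exists>g\<in>carrier G. x' = snd X (inv\<^bsub>A\<^esub> a, \<one>\<^bsub>G\<^esub>, g) x \<and> y' = snd Y (a, g, \<one>\<^bsub>G\<^esub>) y)"
proof
  assume "cls X Y x y = cls X Y x' y'"
  then have "(x', y') \<in> cls X Y x y" using cls_self assms by simp
  then show "\<exists>a\<in>carrier A. \<exists>g\<in>carrier G. x' = snd X (inv\<^bsub>A\<^esub> a, \<one>\<^bsub>G\<^esub>, g) x \<and> y' = snd Y (a, g, \<one>\<^bsub>G\<^esub>) y"
    by (auto simp: cls_eq)
qed (use assms cls_mid in auto)

text \<open>The rule x h \<otimes> y = x \<otimes> h y with h = g^-1, since the right action of h on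
  X is the left action of h^-1 through the second G-coordinate. It moves group elements between the
  factors until a class is in normal form.\<close>

lemma cls_shift:
  assumes "x \<in> fst X" "y \<in> fst Y" "a \<in> carrier A" "g \<in> carrier G"
  shows "cls X Y (snd X (a, \<one>\<^bsub>G\<^esub>, g) x) y = cls X Y x (snd Y (a, inv\<^bsub>G\<^esub> g, \<one>\<^bsub>G\<^esub>) y)"
  using cls_mid[of "snd X (a, \<one>\<^bsub>G\<^esub>, g) x" y a "inv\<^bsub>G\<^esub> g"] assms
  by (simp add: act_closed[OF X] act_act[OF X] act_one[OF X])

text \<open>The outer and the middle action commute, as they use different G-coordinates and A is
  abelian; so a translate of a class is again a class.\<close>

lemma outer_cls:
  assumes "x \<in> fst X" "y \<in> fst Y" "a \<in> carrier A" "u \<in> carrier G" "v \<in> carrier G"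
  shows "outer_action A G X Y (a, u, v) (cls X Y x y) =
    cls X Y (snd X (a, u, \<one>\<^bsub>G\<^esub>) x) (snd Y (\<one>\<^bsub>A\<^esub>, \<one>\<^bsub>G\<^esub>, v) y)"
proof -
  have "outer_action A G X Y (a, u, v) (cls X Y x y) =
    {(snd X (a, u, \<one>\<^bsub>G\<^esub>) (snd X (inv\<^bsub>A\<^esub> b, \<one>\<^bsub>G\<^esub>, g) x), snd Y (\<one>\<^bsub>A\<^esub>, \<one>\<^bsub>G\<^esub>, v) (snd Y (b, g, \<one>\<^bsub>G\<^esub>) y))
      | b g. b \<in> carrier A \<and> g \<in> carrier G}"
    unfolding outer_action_def cls_eq by force
  also have "\<dots> = cls X Y (snd X (a, u, \<one>\<^bsub>G\<^esub>) x) (snd Y (\<one>\<^bsub>A\<^esub>, \<one>\<^bsub>G\<^esub>, v) y)"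
  proof -
    have "(snd X (a, u, \<one>\<^bsub>G\<^esub>) (snd X (inv\<^bsub>A\<^esub> b, \<one>\<^bsub>G\<^esub>, g) x), snd Y (\<one>\<^bsub>A\<^esub>, \<one>\<^bsub>G\<^esub>, v) (snd Y (b, g, \<one>\<^bsub>G\<^esub>) y)) =
      (snd X (inv\<^bsub>A\<^esub> b, \<one>\<^bsub>G\<^esub>, g) (snd X (a, u, \<one>\<^bsub>G\<^esub>) x), snd Y (b, g, \<one>\<^bsub>G\<^esub>) (snd Y (\<one>\<^bsub>A\<^esub>, \<one>\<^bsub>G\<^esub>, v) y))"
      if "b \<in> carrier A \<and> g \<in> carrier G" for b g
      using assms that by (simp add: act_act[OF X] act_act[OF Y] A.m_comm G.m_comm)
    then show ?thesis unfolding cls_eq by (intro Collect_cong) metis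
  qed
  finally show ?thesis .
qed

text \<open>By \<open>outer_cls\<close> a scalar acts on the class itself, so freeness of A there
  cannot depend on the representative.\<close>

lemma good_cls_cong:
  assumes "x \<in> fst X" "y \<in> fst Y" "x' \<in> fst X" "y' \<in> fst Y" "cls X Y x y = cls X Y x' y'"
  shows "good X Y x y \<longleftrightarrow> good X Y x' y'"
proof -
  have "cls X Y (snd X (a, \<one>\<^bsub>G\<^esub>, \<one>\<^bsub>G\<^esub>) x) y = cls X Y (snd X (a, \<one>\<^bsub>G\<^esub>, \<one>\<^bsub>G\<^esub>) x') y'"
    if "a \<in> carrier A" for a
    using outer_cls[of x y a "\<one>\<^bsub>G\<^esub>" "\<one>\<^bsub>G\<^esub>"] outer_cls[of x' y' a "\<one>\<^bsub>G\<^esub>" "\<one>\<^bsub>G\<^esub>"] assms that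
    by (simp add: act_one[OF Y])
  then show ?thesis using assms(5) by (simp add: good_def)
qed

lemma fst_tensor: "fst (tensor A G X Y) = {cls X Y x y | x y. x \<in> fst X \<and> y \<in> fst Y \<and> good X Y x y}"
proof -
  have "stabilizer A (fibre_action G (outer_action A G X Y)) (cls X Y x y) = {\<one>\<^bsub>A\<^esub>} \<longleftrightarrow> good X Y x y"
    if "x \<in> fst X" "y \<in> fst Y" for x y
    using that unfolding stabilizer_def fibre_action_def good_def
    by (auto simp: outer_cls act_one[OF X] act_one[OF Y])
  moreover have "orbits (A \<times>\<times> G) (fst X \<times> fst Y) (middle_action A G X Y) =
    {cls X Y x y | x y. x \<in> fst X \<and> y \<in> fst Y}"
    by (auto simp: orbits_def cls_def)
  ultimately show ?thesis
    unfolding tensor_def tensor_carrier_def by auto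
qed

lemma tensor_memI:
  assumes "x \<in> fst X" "y \<in> fst Y" "good X Y x y"
  shows "cls X Y x y \<in> fst (tensor A G X Y)"
  using assms by (auto simp: fst_tensor)

lemma tensor_memE:
  assumes "t \<in> fst (tensor A G X Y)"
  obtains x y where "t = cls X Y x y" "x \<in> fst X" "y \<in> fst Y" "good X Y x y"
  using assms by (auto simp: fst_tensor)

lemma good_mid_iff:
  assumes "x \<in> fst X" "y \<in> fst Y"
  shows "good X Y x y \<longleftrightarrow> (\<forall>a\<in>carrier A. \<forall>b\<in>carrier A. \<forall>g\<in>carrier G.
    snd X (a, \<one>\<^bsub>G\<^esub>, \<one>\<^bsub>G\<^esub>) x = snd X (inv\<^bsub>A\<^esub> b, \<one>\<^bsub>G\<^esub>, g) x \<longrightarrow> y = snd Y (b, g, \<one>\<^bsub>G\<^esub>) y \<longrightarrow> a = \<one>\<^bsub>A\<^esub>)"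
proof -
  have "cls X Y (snd X (a, \<one>\<^bsub>G\<^esub>, \<one>\<^bsub>G\<^esub>) x) y = cls X Y x y \<longleftrightarrow>
    (\<exists>b\<in>carrier A. \<exists>g\<in>carrier G. snd X (a, \<one>\<^bsub>G\<^esub>, \<one>\<^bsub>G\<^esub>) x = snd X (inv\<^bsub>A\<^esub> b, \<one>\<^bsub>G\<^esub>, g) x \<and> y = snd Y (b, g, \<one>\<^bsub>G\<^esub>) y)"
    if "a \<in> carrier A" for a
    using cls_eq_iff[of x y "snd X (a, \<one>\<^bsub>G\<^esub>, \<one>\<^bsub>G\<^esub>) x" y] assms that
    by (auto simp: act_closed[OF X])
  then show ?thesis unfolding good_def by blast
qed

text \<open>Scalars commute with all translations, so the stabilizer in A does not change. The proof
  undoes the translation by the outer action of (a^-1 b^-1, u^-1, v^-1). Outer scalars act on the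
  first factor while b sits on the second, so the remaining b is cancelled across the tensor sign by
  \<open>cls_mid\<close>.\<close>

lemma good_act:
  assumes "x \<in> fst X" "y \<in> fst Y" "good X Y x y"
    "a \<in> carrier A" "u \<in> carrier G" "b \<in> carrier A" "v \<in> carrier G"
  shows "good X Y (snd X (a, u, \<one>\<^bsub>G\<^esub>) x) (snd Y (b, \<one>\<^bsub>G\<^esub>, v) y)"
  unfolding good_def
proof (intro ballI impI)
  fix c assume c: "c \<in> carrier A"
    and "cls X Y (snd X (c, \<one>\<^bsub>G\<^esub>, \<one>\<^bsub>G\<^esub>) (snd X (a, u, \<one>\<^bsub>G\<^esub>) x)) (snd Y (b, \<one>\<^bsub>G\<^esub>, v) y) =
      cls X Y (snd X (a, u, \<one>\<^bsub>G\<^esub>) x) (snd Y (b, \<one>\<^bsub>G\<^esub>, v) y)" (is "?l = ?r")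
  moreover have c1: "inv\<^bsub>A\<^esub> a \<otimes>\<^bsub>A\<^esub> inv\<^bsub>A\<^esub> b \<otimes>\<^bsub>A\<^esub> (c \<otimes>\<^bsub>A\<^esub> a) = inv\<^bsub>A\<^esub> b \<otimes>\<^bsub>A\<^esub> c"
  proof -
    have "inv\<^bsub>A\<^esub> a \<otimes>\<^bsub>A\<^esub> inv\<^bsub>A\<^esub> b \<otimes>\<^bsub>A\<^esub> (c \<otimes>\<^bsub>A\<^esub> a) = inv\<^bsub>A\<^esub> a \<otimes>\<^bsub>A\<^esub> a \<otimes>\<^bsub>A\<^esub> (inv\<^bsub>A\<^esub> b \<otimes>\<^bsub>A\<^esub> c)"
      using assms(4,6) c by (simp only: A.m_ac A.m_closed A.inv_closed)
    then show ?thesis using assms(4,6) c by simp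
  qed
  moreover have c2: "inv\<^bsub>A\<^esub> a \<otimes>\<^bsub>A\<^esub> inv\<^bsub>A\<^esub> b \<otimes>\<^bsub>A\<^esub> a = inv\<^bsub>A\<^esub> b"
  proof -
    have "inv\<^bsub>A\<^esub> a \<otimes>\<^bsub>A\<^esub> inv\<^bsub>A\<^esub> b \<otimes>\<^bsub>A\<^esub> a = inv\<^bsub>A\<^esub> a \<otimes>\<^bsub>A\<^esub> a \<otimes>\<^bsub>A\<^esub> inv\<^bsub>A\<^esub> b"
      using assms(4,6) by (simp only: A.m_ac A.m_closed A.inv_closed)
    then show ?thesis using assms(4,6) by simp
  qed
  ultimately have "outer_action A G X Y (inv\<^bsub>A\<^esub> a \<otimes>\<^bsub>A\<^esub> inv\<^bsub>A\<^esub> b, inv\<^bsub>G\<^esub> u, inv\<^bsub>G\<^esub> v) ?l =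
     outer_action A G X Y (inv\<^bsub>A\<^esub> a \<otimes>\<^bsub>A\<^esub> inv\<^bsub>A\<^esub> b, inv\<^bsub>G\<^esub> u, inv\<^bsub>G\<^esub> v) ?r" by simp
  then have "cls X Y (snd X (inv\<^bsub>A\<^esub> b \<otimes>\<^bsub>A\<^esub> c, \<one>\<^bsub>G\<^esub>, \<one>\<^bsub>G\<^esub>) x) (snd Y (b, \<one>\<^bsub>G\<^esub>, \<one>\<^bsub>G\<^esub>) y) =
    cls X Y (snd X (inv\<^bsub>A\<^esub> b, \<one>\<^bsub>G\<^esub>, \<one>\<^bsub>G\<^esub>) x) (snd Y (b, \<one>\<^bsub>G\<^esub>, \<one>\<^bsub>G\<^esub>) y)"
    using assms c
    by (simp add: outer_cls act_closed[OF X] act_closed[OF Y] act_act[OF X] act_act[OF Y] c1 c2)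
  moreover have "cls X Y (snd X (inv\<^bsub>A\<^esub> b \<otimes>\<^bsub>A\<^esub> c, \<one>\<^bsub>G\<^esub>, \<one>\<^bsub>G\<^esub>) x) (snd Y (b, \<one>\<^bsub>G\<^esub>, \<one>\<^bsub>G\<^esub>) y) =
    cls X Y (snd X (c, \<one>\<^bsub>G\<^esub>, \<one>\<^bsub>G\<^esub>) x) y"
    using cls_mid[of "snd X (c, \<one>\<^bsub>G\<^esub>, \<one>\<^bsub>G\<^esub>) x" y b "\<one>\<^bsub>G\<^esub>"] assms c
    by (simp add: act_closed[OF X] act_act[OF X])
  moreover have "cls X Y (snd X (inv\<^bsub>A\<^esub> b, \<one>\<^bsub>G\<^esub>, \<one>\<^bsub>G\<^esub>) x) (snd Y (b, \<one>\<^bsub>G\<^esub>, \<one>\<^bsub>G\<^esub>) y) = cls X Y x y"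
    using cls_mid[of x y b "\<one>\<^bsub>G\<^esub>"] assms by simp
  ultimately show "c = \<one>\<^bsub>A\<^esub>" using assms(3) c by (simp add: good_def)
qed

lemma tensor_act:
  assumes "x \<in> fst X" "y \<in> fst Y" "good X Y x y" "a \<in> carrier A" "u \<in> carrier G" "v \<in> carrier G"
  shows "snd (tensor A G X Y) (a, u, v) (cls X Y x y) =
    cls X Y (snd X (a, u, \<one>\<^bsub>G\<^esub>) x) (snd Y (\<one>\<^bsub>A\<^esub>, \<one>\<^bsub>G\<^esub>, v) y)"
proof -
  have "cls X Y x y \<in> tensor_carrier A G X Y"
    using tensor_memI[OF assms(1-3)] by (simp add: tensor_def)
  then show ?thesis using assms by (simp add: tensor_def outer_cls)
qed

lemma fibred_tensor: "fibred (tensor A G X Y)"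
proof (rule fibred_bisetI)
  let ?T = "tensor A G X Y"
  note simps = act_closed[OF X] act_closed[OF Y] act_act[OF X] act_act[OF Y] act_one[OF X] act_one[OF Y]
  show "snd ?T (a, u, v) t \<in> fst ?T"
    if p: "a \<in> carrier A" "u \<in> carrier G" "v \<in> carrier G" and t: "t \<in> fst ?T" for a u v t
    using t p by (elim tensor_memE) (simp add: tensor_act tensor_memI simps good_act)
  show "snd ?T (a, u, v) \<in> extensional (fst ?T)" for a u v
    by (simp add: tensor_def)
  show "snd ?T (\<one>\<^bsub>A\<^esub>, \<one>\<^bsub>G\<^esub>, \<one>\<^bsub>G\<^esub>) t = t" if "t \<in> fst ?T" for t
    using that by (elim tensor_memE) (simp add: tensor_act simps)
  show "snd ?T (a, u, v) (snd ?T (b, s, w) t) = snd ?T (a \<otimes>\<^bsub>A\<^esub> b, u \<otimes>\<^bsub>G\<^esub> s, v \<otimes>\<^bsub>G\<^esub> w) t"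
    if p: "a \<in> carrier A" "u \<in> carrier G" "v \<in> carrier G"
      "b \<in> carrier A" "s \<in> carrier G" "w \<in> carrier G" and t: "t \<in> fst ?T" for a u v b s w t
    using t p by (elim tensor_memE) (simp add: tensor_act simps good_act)
  show "a = \<one>\<^bsub>A\<^esub>" if "a \<in> carrier A" "t \<in> fst ?T" "snd ?T (a, \<one>\<^bsub>G\<^esub>, \<one>\<^bsub>G\<^esub>) t = t" for a t
    using that(2,1,3) by (elim tensor_memE) (simp add: tensor_act simps good_def)
  show "finite (fibre_orbit ?T ` fst ?T)"
  proof -
    let ?OX = "fibre_orbit X ` fst X" and ?OY = "fibre_orbit Y ` fst Y"
    have fin: "finite (?OX \<times> ?OY)"
      using finite_fibre_orbits[OF X] finite_fibre_orbits[OF Y] by (simp add: fibre_orbits_eq)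
    \<comment> \<open>Scalars on the two factors merge into a single scalar on the class, so the
      A-orbit of the class of (x, y) is determined by the A-orbits of x and y. Hence there are at
      most as many as pairs of A-orbits.\<close>
    define f where "f = (\<lambda>(O1, O2). {cls X Y x y | x y. x \<in> O1 \<and> y \<in> O2})"
    have "fibre_orbit ?T t \<in> f ` (?OX \<times> ?OY)" if t: "t \<in> fst ?T" for t
    proof -
      from t obtain x y where xy: "t = cls X Y x y" "x \<in> fst X" "y \<in> fst Y" "good X Y x y"
        by (elim tensor_memE) blast
      have "fibre_orbit ?T t = f (fibre_orbit X x, fibre_orbit Y y)"
      proof (intro equalityI subsetI)
        fix s assume "s \<in> fibre_orbit ?T t"
        then obtain a where a: "a \<in> carrier A" "s = cls X Y (snd X (a, \<one>\<^bsub>G\<^esub>, \<one>\<^bsub>G\<^esub>) x) y"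
          using xy by (auto simp: fibre_orbit_def tensor_act simps)
        then show "s \<in> f (fibre_orbit X x, fibre_orbit Y y)"
          using fibre_orbit_self[OF Y xy(3)] by (auto simp: f_def fibre_orbit_def)
      next
        fix s assume "s \<in> f (fibre_orbit X x, fibre_orbit Y y)"
        then obtain a b where ab: "a \<in> carrier A" "b \<in> carrier A"
          "s = cls X Y (snd X (a, \<one>\<^bsub>G\<^esub>, \<one>\<^bsub>G\<^esub>) x) (snd Y (b, \<one>\<^bsub>G\<^esub>, \<one>\<^bsub>G\<^esub>) y)"
          by (auto simp: f_def fibre_orbit_def)
        have "s = cls X Y (snd X (a \<otimes>\<^bsub>A\<^esub> b, \<one>\<^bsub>G\<^esub>, \<one>\<^bsub>G\<^esub>) x) y"
          using cls_shift[of "snd X (a, \<one>\<^bsub>G\<^esub>, \<one>\<^bsub>G\<^esub>) x" y b "\<one>\<^bsub>G\<^esub>"] ab xy by (simp add: simps A.m_comm)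
        then have "s = snd ?T (a \<otimes>\<^bsub>A\<^esub> b, \<one>\<^bsub>G\<^esub>, \<one>\<^bsub>G\<^esub>) t"
          using ab xy by (simp add: tensor_act simps)
        then show "s \<in> fibre_orbit ?T t" using ab unfolding fibre_orbit_def by blast
      qed
      with xy show ?thesis by blast
    qed
    then have "fibre_orbit ?T ` fst ?T \<subseteq> f ` (?OX \<times> ?OY)" by (rule image_subsetI)
    then show ?thesis by (rule finite_subset) (rule finite_imageI[OF fin])
  qed
qed

end

section \<open>Invariance of the tensor product under isomorphism\<close>

lemma tensor_cong:
  assumes X: "fibred X" and Y: "fibred Y" and X': "fibred X'" and Y': "fibred Y'"
    and "X \<approx> X'" "Y \<approx> Y'"
  shows "tensor A G X Y \<approx> tensor A G X' Y'"
proof -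
  note simps = act_closed[OF X] act_closed[OF Y]
  obtain f where f: "bij_betw f (fst X) (fst X')"
    "\<And>a u v x. a \<in> carrier A \<Longrightarrow> u \<in> carrier G \<Longrightarrow> v \<in> carrier G \<Longrightarrow> x \<in> fst X \<Longrightarrow>
      f (snd X (a, u, v) x) = snd X' (a, u, v) (f x)" by (rule isoE[OF assms(5)]) blast
  obtain g where g: "bij_betw g (fst Y) (fst Y')"
    "\<And>a u v x. a \<in> carrier A \<Longrightarrow> u \<in> carrier G \<Longrightarrow> v \<in> carrier G \<Longrightarrow> x \<in> fst Y \<Longrightarrow>
      g (snd Y (a, u, v) x) = snd Y' (a, u, v) (g x)" by (rule isoE[OF assms(6)]) blast
  have fX: "f x \<in> fst X'" if "x \<in> fst X" for x using f(1) that by (auto simp: bij_betw_def)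
  have gY: "g y \<in> fst Y'" if "y \<in> fst Y" for y using g(1) that by (auto simp: bij_betw_def)
  have f_eq: "f x = f x' \<longleftrightarrow> x = x'" if "x \<in> fst X" "x' \<in> fst X" for x x'
    using f(1) that by (auto simp: bij_betw_def inj_on_def)
  have g_eq: "g y = g y' \<longleftrightarrow> y = y'" if "y \<in> fst Y" "y' \<in> fst Y" for y y'
    using g(1) that by (auto simp: bij_betw_def inj_on_def)
  have cls: "cls X' Y' (f x) (g y) = cls X' Y' (f x') (g y') \<longleftrightarrow> cls X Y x y = cls X Y x' y'"
    if "x \<in> fst X" "y \<in> fst Y" "x' \<in> fst X" "y' \<in> fst Y" for x y x' y'
    using that
    by (simp add: cls_eq_iff[OF X Y] cls_eq_iff[OF X' Y'] fX gY f(2)[symmetric] g(2)[symmetric] f_eq g_eq simps)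
  have good: "good X' Y' (f x) (g y) \<longleftrightarrow> good X Y x y" if "x \<in> fst X" "y \<in> fst Y" for x y
    using that by (simp add: good_def f(2)[symmetric] cls simps)
  show ?thesis
  proof (rule isoI_pairing[where S = "{(x, y). x \<in> fst X \<and> y \<in> fst Y \<and> good X Y x y}"
        and h = "\<lambda>(x, y). cls X Y x y" and k = "\<lambda>(x, y). cls X' Y' (f x) (g y)"])
    show "fst (tensor A G X Y) = (\<lambda>(x, y). cls X Y x y) ` {(x, y). x \<in> fst X \<and> y \<in> fst Y \<and> good X Y x y}"
      by (auto simp: fst_tensor[OF X Y])
    show "fst (tensor A G X' Y') = (\<lambda>(x, y). cls X' Y' (f x) (g y)) ` {(x, y). x \<in> fst X \<and> y \<in> fst Y \<and> good X Y x y}"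
    proof (intro equalityI subsetI)
      fix t assume "t \<in> fst (tensor A G X' Y')"
      then obtain x' y' where t: "t = cls X' Y' x' y'" "x' \<in> fst X'" "y' \<in> fst Y'" "good X' Y' x' y'"
        by (rule tensor_memE[OF X' Y'])
      then obtain x y where "x \<in> fst X" "y \<in> fst Y" "x' = f x" "y' = g y"
        using f(1) g(1) unfolding bij_betw_def by (metis imageE)
      with t good show "t \<in> (\<lambda>(x, y). cls X' Y' (f x) (g y)) ` {(x, y). x \<in> fst X \<and> y \<in> fst Y \<and> good X Y x y}"
        by auto
    qed (auto simp: good fX gY intro: tensor_memI[OF X' Y'])
  next
    fix a u v s
    assume p: "a \<in> carrier A" "u \<in> carrier G" "v \<in> carrier G"
      and "s \<in> {(x, y). x \<in> fst X \<and> y \<in> fst Y \<and> good X Y x y}"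
    then obtain x y where s: "s = (x, y)" "x \<in> fst X" "y \<in> fst Y" "good X Y x y" by auto
    show "\<exists>t\<in>{(x, y). x \<in> fst X \<and> y \<in> fst Y \<and> good X Y x y}.
      snd (tensor A G X Y) (a, u, v) (case s of (x, y) \<Rightarrow> cls X Y x y) = (case t of (x, y) \<Rightarrow> cls X Y x y) \<and>
      snd (tensor A G X' Y') (a, u, v) (case s of (x, y) \<Rightarrow> cls X' Y' (f x) (g y)) =
        (case t of (x, y) \<Rightarrow> cls X' Y' (f x) (g y))"
      by (rule bexI[of _ "(snd X (a, u, \<one>\<^bsub>G\<^esub>) x, snd Y (\<one>\<^bsub>A\<^esub>, \<one>\<^bsub>G\<^esub>, v) y)"])
        (use p s in \<open>simp_all add: tensor_act[OF X Y] tensor_act[OF X' Y'] fX gY good f(2) g(2) simps good_act[OF X Y]\<close>)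
  qed (simp add: case_prod_beta cls)
qed

section \<open>Associativity of the tensor product\<close>

context
  fixes X :: "('a, 'g, 'x) aset" and Y :: "('a, 'g, 'y) aset" and Z :: "('a, 'g, 'z) aset"
  assumes X: "fibred X" and Y: "fibred Y" and Z: "fibred Z"
begin

private lemmas simps =
  act_closed[OF X] act_closed[OF Y] act_closed[OF Z]
  act_act[OF X] act_act[OF Y] act_act[OF Z] act_one[OF X] act_one[OF Y] act_one[OF Z]

text \<open>The orbit relation of two middle actions on triples: (a, g) acts between x and y, (b, h)
  between y and z, and y feels both, as the right partner of x and the left partner of z. Both
  bracketings are compared with this symmetric description.\<close>

private definition mid3 :: "'x \<Rightarrow> 'y \<Rightarrow> 'z \<Rightarrow> 'x \<Rightarrow> 'y \<Rightarrow> 'z \<Rightarrow> bool" where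
  "mid3 x y z x' y' z' \<longleftrightarrow> (\<exists>a\<in>carrier A. \<exists>b\<in>carrier A. \<exists>g\<in>carrier G. \<exists>h\<in>carrier G.
    x' = snd X (inv\<^bsub>A\<^esub> a, \<one>\<^bsub>G\<^esub>, g) x \<and> y' = snd Y (a \<otimes>\<^bsub>A\<^esub> inv\<^bsub>A\<^esub> b, g, h) y \<and> z' = snd Z (b, h, \<one>\<^bsub>G\<^esub>) z)"

private definition good3 :: "'x \<Rightarrow> 'y \<Rightarrow> 'z \<Rightarrow> bool" where
  "good3 x y z \<longleftrightarrow> (\<forall>c\<in>carrier A. mid3 (snd X (c, \<one>\<^bsub>G\<^esub>, \<one>\<^bsub>G\<^esub>) x) y z x y z \<longrightarrow> c = \<one>\<^bsub>A\<^esub>)"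

text \<open>Each bracketing discards classes twice, in the inner and in the outer product. A scalar
  that fixes the class of (x, y) also fixes the triple, with (b, h) trivial. So \<open>good3\<close>
  contains the inner condition, and likewise the one for (y, z); therefore both bracketings keep the
  same triples.\<close>

private lemma good3_imp_good_left:
  assumes "good3 x y z" "x \<in> fst X" "y \<in> fst Y" "z \<in> fst Z"
  shows "good X Y x y"
  unfolding good_def
proof (intro ballI impI)
  fix c assume c: "c \<in> carrier A" and eq: "cls X Y (snd X (c, \<one>\<^bsub>G\<^esub>, \<one>\<^bsub>G\<^esub>) x) y = cls X Y x y"
  then obtain a g where "a \<in> carrier A" "g \<in> carrier G"
    "x = snd X (inv\<^bsub>A\<^esub> a, \<one>\<^bsub>G\<^esub>, g) (snd X (c, \<one>\<^bsub>G\<^esub>, \<one>\<^bsub>G\<^esub>) x)" "y = snd Y (a, g, \<one>\<^bsub>G\<^esub>) y"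
    using assms by (auto simp: cls_eq_iff[OF X Y] act_closed[OF X])
  then have "mid3 (snd X (c, \<one>\<^bsub>G\<^esub>, \<one>\<^bsub>G\<^esub>) x) y z x y z"
    unfolding mid3_def using assms
    by (intro bexI[of _ a] bexI[of _ "\<one>\<^bsub>A\<^esub>"] bexI[of _ g] bexI[of _ "\<one>\<^bsub>G\<^esub>"])
      (simp_all add: act_one[OF Z])
  then show "c = \<one>\<^bsub>A\<^esub>" using assms(1) c by (simp add: good3_def)
qed

private lemma good3_imp_good_right:
  assumes "good3 x y z" "x \<in> fst X" "y \<in> fst Y" "z \<in> fst Z"
  shows "good Y Z y z"
  unfolding good_def
proof (intro ballI impI)
  fix c assume c: "c \<in> carrier A" and eq: "cls Y Z (snd Y (c, \<one>\<^bsub>G\<^esub>, \<one>\<^bsub>G\<^esub>) y) z = cls Y Z y z"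
  then obtain b h where "b \<in> carrier A" "h \<in> carrier G"
    "y = snd Y (inv\<^bsub>A\<^esub> b, \<one>\<^bsub>G\<^esub>, h) (snd Y (c, \<one>\<^bsub>G\<^esub>, \<one>\<^bsub>G\<^esub>) y)" "z = snd Z (b, h, \<one>\<^bsub>G\<^esub>) z"
    using assms by (auto simp: cls_eq_iff[OF Y Z] act_closed[OF Y])
  \<comment> \<open>The scalar c on x is undone by taking c as the middle element between x and y,
    which passes it on to y.\<close>
  then have "mid3 (snd X (c, \<one>\<^bsub>G\<^esub>, \<one>\<^bsub>G\<^esub>) x) y z x y z"
    unfolding mid3_def using assms c
    by (intro bexI[of _ c] bexI[of _ b] bexI[of _ "\<one>\<^bsub>G\<^esub>"] bexI[of _ h])
      (simp_all add: simps A.m_comm)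
  then show "c = \<one>\<^bsub>A\<^esub>" using assms(1) c by (simp add: good3_def)
qed

text \<open>A middle element (b, h) between the class of (x, y) and z acts on that class with its
  scalar on x, so x receives a^-1 b^-1 and y the scalar a alone. Replacing a by a b gives
  \<open>mid3\<close>.\<close>

private lemma cls_left_eq_iff:
  assumes "x \<in> fst X" "y \<in> fst Y" "z \<in> fst Z" "good X Y x y"
    "x' \<in> fst X" "y' \<in> fst Y" "z' \<in> fst Z" "good X Y x' y'"
  shows "cls (tensor A G X Y) Z (cls X Y x y) z = cls (tensor A G X Y) Z (cls X Y x' y') z' \<longleftrightarrow>
    mid3 x y z x' y' z'" (is "?l \<longleftrightarrow> ?r")
proof -
  have "?l \<longleftrightarrow> (\<exists>b\<in>carrier A. \<exists>h\<in>carrier G.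
      cls X Y x' y' = cls X Y (snd X (inv\<^bsub>A\<^esub> b, \<one>\<^bsub>G\<^esub>, \<one>\<^bsub>G\<^esub>) x) (snd Y (\<one>\<^bsub>A\<^esub>, \<one>\<^bsub>G\<^esub>, h) y) \<and>
      z' = snd Z (b, h, \<one>\<^bsub>G\<^esub>) z)"
    using assms
    by (simp add: cls_eq_iff[OF fibred_tensor[OF X Y] Z] tensor_memI[OF X Y] tensor_act[OF X Y])
  also have "\<dots> \<longleftrightarrow> (\<exists>b\<in>carrier A. \<exists>h\<in>carrier G. \<exists>a\<in>carrier A. \<exists>g\<in>carrier G.
      x' = snd X (inv\<^bsub>A\<^esub> a \<otimes>\<^bsub>A\<^esub> inv\<^bsub>A\<^esub> b, \<one>\<^bsub>G\<^esub>, g) x \<and> y' = snd Y (a, g, h) y \<and> z' = snd Z (b, h, \<one>\<^bsub>G\<^esub>) z)"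
    using assms by (simp add: eq_commute[of "cls X Y x' y'"] cls_eq_iff[OF X Y] simps cong: conj_cong) blast
  also have "\<dots> \<longleftrightarrow> ?r"
  proof
    assume "\<exists>b\<in>carrier A. \<exists>h\<in>carrier G. \<exists>a\<in>carrier A. \<exists>g\<in>carrier G.
      x' = snd X (inv\<^bsub>A\<^esub> a \<otimes>\<^bsub>A\<^esub> inv\<^bsub>A\<^esub> b, \<one>\<^bsub>G\<^esub>, g) x \<and> y' = snd Y (a, g, h) y \<and> z' = snd Z (b, h, \<one>\<^bsub>G\<^esub>) z"
    then obtain a b g h where "a \<in> carrier A" "b \<in> carrier A" "g \<in> carrier G" "h \<in> carrier G"
      "x' = snd X (inv\<^bsub>A\<^esub> a \<otimes>\<^bsub>A\<^esub> inv\<^bsub>A\<^esub> b, \<one>\<^bsub>G\<^esub>, g) x" "y' = snd Y (a, g, h) y" "z' = snd Z (b, h, \<one>\<^bsub>G\<^esub>) z"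
      by blast
    then show ?r unfolding mid3_def
      by (intro bexI[of _ "a \<otimes>\<^bsub>A\<^esub> b"] bexI[of _ b] bexI[of _ g] bexI[of _ h])
        (simp_all add: A.inv_mult A.m_assoc)
  next
    assume ?r
    then obtain a b g h where "a \<in> carrier A" "b \<in> carrier A" "g \<in> carrier G" "h \<in> carrier G"
      "x' = snd X (inv\<^bsub>A\<^esub> a, \<one>\<^bsub>G\<^esub>, g) x" "y' = snd Y (a \<otimes>\<^bsub>A\<^esub> inv\<^bsub>A\<^esub> b, g, h) y" "z' = snd Z (b, h, \<one>\<^bsub>G\<^esub>) z"
      unfolding mid3_def by blast
    then show "\<exists>b\<in>carrier A. \<exists>h\<in>carrier G. \<exists>a\<in>carrier A. \<exists>g\<in>carrier G.
      x' = snd X (inv\<^bsub>A\<^esub> a \<otimes>\<^bsub>A\<^esub> inv\<^bsub>A\<^esub> b, \<one>\<^bsub>G\<^esub>, g) x \<and> y' = snd Y (a, g, h) y \<and> z' = snd Z (b, h, \<one>\<^bsub>G\<^esub>) z"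
      by (intro bexI[of _ "a \<otimes>\<^bsub>A\<^esub> inv\<^bsub>A\<^esub> b"] bexI[of _ b] bexI[of _ g] bexI[of _ h])
        (simp_all add: A.inv_mult A.m_assoc)
  qed
  finally show ?thesis .
qed

private lemma cls_right_eq_iff:
  assumes "x \<in> fst X" "y \<in> fst Y" "z \<in> fst Z" "good Y Z y z"
    "x' \<in> fst X" "y' \<in> fst Y" "z' \<in> fst Z" "good Y Z y' z'"
  shows "cls X (tensor A G Y Z) x (cls Y Z y z) = cls X (tensor A G Y Z) x' (cls Y Z y' z') \<longleftrightarrow>
    mid3 x y z x' y' z'" (is "?l \<longleftrightarrow> ?r")
proof -
  have "?l \<longleftrightarrow> (\<exists>a\<in>carrier A. \<exists>g\<in>carrier G. x' = snd X (inv\<^bsub>A\<^esub> a, \<one>\<^bsub>G\<^esub>, g) x \<and>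
      cls Y Z y' z' = cls Y Z (snd Y (a, g, \<one>\<^bsub>G\<^esub>) y) z)"
    using assms
    by (simp add: cls_eq_iff[OF X fibred_tensor[OF Y Z]] tensor_memI[OF Y Z] tensor_act[OF Y Z] simps)
  also have "\<dots> \<longleftrightarrow> ?r"
    unfolding mid3_def
    using assms by (simp add: eq_commute[of "cls Y Z y' z'"] cls_eq_iff[OF Y Z] simps A.m_comm cong: conj_cong) blast
  finally show ?thesis .
qed

text \<open>Points of either side are the triples satisfying \<open>good3\<close> modulo
  \<open>mid3\<close>, so the identity on triples induces the isomorphism.\<close>

lemma tensor_assoc: "tensor A G (tensor A G X Y) Z \<approx> tensor A G X (tensor A G Y Z)"
proof -
  let ?L = "tensor A G X Y" and ?R = "tensor A G Y Z"
  have gl: "good ?L Z (cls X Y x y) z \<longleftrightarrow> good3 x y z"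
    if "x \<in> fst X" "y \<in> fst Y" "z \<in> fst Z" and g: "good X Y x y" for x y z
  proof -
    have "good X Y (snd X (c, \<one>\<^bsub>G\<^esub>, \<one>\<^bsub>G\<^esub>) x) y" if "c \<in> carrier A" for c
      using good_act[OF X Y _ _ g, of c "\<one>\<^bsub>G\<^esub>" "\<one>\<^bsub>A\<^esub>" "\<one>\<^bsub>G\<^esub>"] that \<open>x \<in> fst X\<close> \<open>y \<in> fst Y\<close> by (simp add: simps)
    then show ?thesis
      unfolding good_def[of ?L] good3_def using that
      by (simp add: tensor_act[OF X Y] simps cls_left_eq_iff)
  qed
  have gr: "good X ?R x (cls Y Z y z) \<longleftrightarrow> good3 x y z"
    if "x \<in> fst X" "y \<in> fst Y" "z \<in> fst Z" and g: "good Y Z y z" for x y z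
    unfolding good_def[of X ?R] good3_def using that
    by (simp add: simps cls_right_eq_iff)
  define S where "S = {(x, y, z). x \<in> fst X \<and> y \<in> fst Y \<and> z \<in> fst Z \<and> good3 x y z}"
  have S: "\<exists>x y z. s = (x, y, z) \<and> x \<in> fst X \<and> y \<in> fst Y \<and> z \<in> fst Z \<and> good3 x y z \<and>
     good X Y x y \<and> good Y Z y z \<and> good ?L Z (cls X Y x y) z \<and> good X ?R x (cls Y Z y z)" if "s \<in> S" for s
    using that unfolding S_def by (auto simp: gl gr good3_imp_good_left good3_imp_good_right)
  show ?thesis
  proof (rule isoI_pairing[where S = S
        and h = "\<lambda>(x, y, z). cls ?L Z (cls X Y x y) z" and k = "\<lambda>(x, y, z). cls X ?R x (cls Y Z y z)"])
    show "fst (tensor A G ?L Z) = (\<lambda>(x, y, z). cls ?L Z (cls X Y x y) z) ` S"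
    proof (intro equalityI subsetI)
      fix t assume "t \<in> fst (tensor A G ?L Z)"
      then obtain w z where w: "t = cls ?L Z w z" "w \<in> fst ?L" "z \<in> fst Z" "good ?L Z w z"
        by (rule tensor_memE[OF fibred_tensor[OF X Y] Z])
      from w(2) obtain x y where "w = cls X Y x y" "x \<in> fst X" "y \<in> fst Y" "good X Y x y"
        by (rule tensor_memE[OF X Y])
      with w show "t \<in> (\<lambda>(x, y, z). cls ?L Z (cls X Y x y) z) ` S"
        by (intro image_eqI[of _ _ "(x, y, z)"]) (auto simp: S_def gl)
    next
      fix t assume "t \<in> (\<lambda>(x, y, z). cls ?L Z (cls X Y x y) z) ` S"
      then show "t \<in> fst (tensor A G ?L Z)"
        using S by (force intro!: tensor_memI[OF fibred_tensor[OF X Y] Z] tensor_memI[OF X Y])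
    qed
    show "fst (tensor A G X ?R) = (\<lambda>(x, y, z). cls X ?R x (cls Y Z y z)) ` S"
    proof (intro equalityI subsetI)
      fix t assume "t \<in> fst (tensor A G X ?R)"
      then obtain x w where w: "t = cls X ?R x w" "x \<in> fst X" "w \<in> fst ?R" "good X ?R x w"
        by (rule tensor_memE[OF X fibred_tensor[OF Y Z]])
      from w(3) obtain y z where "w = cls Y Z y z" "y \<in> fst Y" "z \<in> fst Z" "good Y Z y z"
        by (rule tensor_memE[OF Y Z])
      with w show "t \<in> (\<lambda>(x, y, z). cls X ?R x (cls Y Z y z)) ` S"
        by (intro image_eqI[of _ _ "(x, y, z)"]) (auto simp: S_def gr)
    next
      fix t assume "t \<in> (\<lambda>(x, y, z). cls X ?R x (cls Y Z y z)) ` S"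
      then show "t \<in> fst (tensor A G X ?R)"
        using S by (force intro!: tensor_memI[OF X fibred_tensor[OF Y Z]] tensor_memI[OF Y Z])
    qed
  next
    fix s t assume "s \<in> S" "t \<in> S"
    then obtain x y z x' y' z' where st: "s = (x, y, z)" "t = (x', y', z')"
      "x \<in> fst X" "y \<in> fst Y" "z \<in> fst Z" "x' \<in> fst X" "y' \<in> fst Y" "z' \<in> fst Z"
      "good X Y x y" "good Y Z y z" "good X Y x' y'" "good Y Z y' z'"
      using S by meson
    then show "(case s of (x, y, z) \<Rightarrow> cls ?L Z (cls X Y x y) z) = (case t of (x, y, z) \<Rightarrow> cls ?L Z (cls X Y x y) z) \<longleftrightarrow>
       (case s of (x, y, z) \<Rightarrow> cls X ?R x (cls Y Z y z)) = (case t of (x, y, z) \<Rightarrow> cls X ?R x (cls Y Z y z))"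
      by (simp add: cls_left_eq_iff cls_right_eq_iff)
  next
    fix a u v s
    assume p: "a \<in> carrier A" "u \<in> carrier G" "v \<in> carrier G" and "s \<in> S"
    then obtain x y z where s: "s = (x, y, z)" "x \<in> fst X" "y \<in> fst Y" "z \<in> fst Z"
      "good X Y x y" "good Y Z y z" "good ?L Z (cls X Y x y) z" "good X ?R x (cls Y Z y z)"
      using S by meson
    let ?x = "snd X (a, u, \<one>\<^bsub>G\<^esub>) x" and ?z = "snd Z (\<one>\<^bsub>A\<^esub>, \<one>\<^bsub>G\<^esub>, v) z"
    have g: "good X Y ?x y"
      using good_act[OF X Y _ _ s(5), of a u "\<one>\<^bsub>A\<^esub>" "\<one>\<^bsub>G\<^esub>"] p s by (simp add: simps)
    have "good ?L Z (snd ?L (a, u, \<one>\<^bsub>G\<^esub>) (cls X Y x y)) ?z"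
      using s p by (intro good_act[OF fibred_tensor[OF X Y] Z] tensor_memI[OF X Y]) auto
    then have "good ?L Z (cls X Y ?x y) ?z"
      using s p by (simp add: tensor_act[OF X Y] simps)
    then have "(?x, y, ?z) \<in> S"
      using p s g by (simp add: S_def simps gl)
    moreover have "snd (tensor A G ?L Z) (a, u, v) (cls ?L Z (cls X Y x y) z) = cls ?L Z (cls X Y ?x y) ?z"
      using p s by (simp add: tensor_act[OF fibred_tensor[OF X Y] Z] tensor_act[OF X Y] tensor_memI[OF X Y] simps)
    moreover have "snd (tensor A G X ?R) (a, u, v) (cls X ?R x (cls Y Z y z)) = cls X ?R ?x (cls Y Z y ?z)"
      using p s by (simp add: tensor_act[OF X fibred_tensor[OF Y Z]] tensor_act[OF Y Z] tensor_memI[OF Y Z] simps)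
    ultimately show "\<exists>t\<in>S.
      snd (tensor A G ?L Z) (a, u, v) (case s of (x, y, z) \<Rightarrow> cls ?L Z (cls X Y x y) z) =
        (case t of (x, y, z) \<Rightarrow> cls ?L Z (cls X Y x y) z) \<and>
      snd (tensor A G X ?R) (a, u, v) (case s of (x, y, z) \<Rightarrow> cls X ?R x (cls Y Z y z)) =
        (case t of (x, y, z) \<Rightarrow> cls X ?R x (cls Y Z y z))"
      using s(1) by (intro bexI[of _ "(?x, y, ?z)"]) simp_all
  qed
qed

end

section \<open>The unit of the tensor product\<close>

lemma fst_identity: "fst (identity_biset A G) = carrier A \<times> carrier G"
  by (simp add: identity_biset_def)

lemma identity_act:
  assumes "b \<in> carrier A" "g \<in> carrier G"
  shows "snd (identity_biset A G) (a, u, v) (b, g) = (a \<otimes>\<^bsub>A\<^esub> b, u \<otimes>\<^bsub>G\<^esub> g \<otimes>\<^bsub>G\<^esub> inv\<^bsub>G\<^esub> v)"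
  using assms by (simp add: identity_biset_def)

lemma fibred_identity:
  assumes "finite (carrier G)"
  shows "fibred (identity_biset A G)"
proof (rule fibred_bisetI)
  let ?I = "identity_biset A G"
  show "snd ?I (a, u, v) \<in> extensional (fst ?I)" for a u v by (simp add: identity_biset_def)
  show "finite (fibre_orbit ?I ` fst ?I)"
  proof -
    have "fibre_orbit ?I x = carrier A \<times> {snd x}" if x: "x \<in> fst ?I" for x
    proof (intro equalityI subsetI)
      fix y assume "y \<in> carrier A \<times> {snd x}"
      then have "y = snd ?I (fst y \<otimes>\<^bsub>A\<^esub> inv\<^bsub>A\<^esub> fst x, \<one>\<^bsub>G\<^esub>, \<one>\<^bsub>G\<^esub>) x" "fst y \<otimes>\<^bsub>A\<^esub> inv\<^bsub>A\<^esub> fst x \<in> carrier A"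
        using x by (auto simp: fst_identity identity_act A.m_assoc)
      then show "y \<in> fibre_orbit ?I x" unfolding fibre_orbit_def by blast
    qed (use x in \<open>auto simp: fibre_orbit_def fst_identity identity_act\<close>)
    then have "fibre_orbit ?I ` fst ?I \<subseteq> (\<lambda>g. carrier A \<times> {g}) ` carrier G"
      by (auto simp: fst_identity)
    then show ?thesis using assms finite_surj by blast
  qed
qed (auto simp: fst_identity identity_act A.m_assoc G.m_ac G.inv_mult)

text \<open>Moving the group element across brings every class to the form e \<otimes> y with e =
  (1, 1). The middle action is free on the identity biset, so y is determined by its class, and A is
  free at the class because it is free on Y.\<close>

lemma tensor_identity_left:
  assumes "finite (carrier G)" "fibred Y"
  shows "tensor A G (identity_biset A G) Y \<approx> Y"
proof -
  let ?I = "identity_biset A G" and ?e = "(\<one>\<^bsub>A\<^esub>, \<one>\<^bsub>G\<^esub>)"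
  note I = fibred_identity[OF assms(1)] and Y = assms(2)
  note simps = act_closed[OF I] act_act[OF I] act_one[OF I] act_closed[OF Y] act_act[OF Y] act_one[OF Y]
  have e: "?e \<in> fst ?I" by (simp add: fst_identity)
  have cls: "cls ?I Y ?e y = cls ?I Y ?e y' \<longleftrightarrow> y = y'" if "y \<in> fst Y" "y' \<in> fst Y" for y y'
  proof -
    have "cls ?I Y ?e y = cls ?I Y ?e y' \<longleftrightarrow>
      (\<exists>a\<in>carrier A. \<exists>g\<in>carrier G. a = \<one>\<^bsub>A\<^esub> \<and> g = \<one>\<^bsub>G\<^esub> \<and> y' = snd Y (a, g, \<one>\<^bsub>G\<^esub>) y)"
      using that e by (simp add: cls_eq_iff[OF I Y] identity_act eq_commute[of "\<one>\<^bsub>A\<^esub>"] eq_commute[of "\<one>\<^bsub>G\<^esub>"] cong: conj_cong)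
    then show ?thesis using that by (auto simp: simps)
  qed
  have norm: "cls ?I Y (a, g) y = cls ?I Y ?e (snd Y (a, g, \<one>\<^bsub>G\<^esub>) y)"
    if "a \<in> carrier A" "g \<in> carrier G" "y \<in> fst Y" for a g y
    using cls_shift[OF I Y e that(3), of a "inv\<^bsub>G\<^esub> g"] that by (simp add: identity_act)
  have good: "good ?I Y ?e y" if "y \<in> fst Y" for y
    unfolding good_def
  proof (intro ballI impI)
    fix c assume c: "c \<in> carrier A" "cls ?I Y (snd ?I (c, \<one>\<^bsub>G\<^esub>, \<one>\<^bsub>G\<^esub>) ?e) y = cls ?I Y ?e y"
    then show "c = \<one>\<^bsub>A\<^esub>"
      using norm[of c "\<one>\<^bsub>G\<^esub>" y] act_free[OF Y that] that by (simp add: identity_act cls simps)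
  qed
  show ?thesis
  proof (rule isoI_pairing[where S = "fst Y" and h = "cls ?I Y ?e" and k = "\<lambda>y. y"])
    show "fst (tensor A G ?I Y) = cls ?I Y ?e ` fst Y"
    proof (intro equalityI subsetI)
      fix t assume "t \<in> fst (tensor A G ?I Y)"
      then obtain x y where "t = cls ?I Y x y" "x \<in> fst ?I" "y \<in> fst Y"
        by (rule tensor_memE[OF I Y])
      then show "t \<in> cls ?I Y ?e ` fst Y"
        using norm[of "fst x" "snd x" y] by (auto simp: fst_identity simps)
    qed (auto intro!: tensor_memI[OF I Y] good e)
    show "\<exists>t\<in>fst Y. snd (tensor A G ?I Y) (a, u, v) (cls ?I Y ?e s) = cls ?I Y ?e t \<and> snd Y (a, u, v) s = t"
      if p: "a \<in> carrier A" "u \<in> carrier G" "v \<in> carrier G" "s \<in> fst Y" for a u v s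
      using p norm[of a u "snd Y (\<one>\<^bsub>A\<^esub>, \<one>\<^bsub>G\<^esub>, v) s"]
      by (simp add: tensor_act[OF I Y e] good identity_act simps)
  qed (simp_all add: cls)
qed

lemma tensor_identity_right:
  assumes "finite (carrier G)" "fibred X"
  shows "tensor A G X (identity_biset A G) \<approx> X"
proof -
  let ?I = "identity_biset A G" and ?e = "(\<one>\<^bsub>A\<^esub>, \<one>\<^bsub>G\<^esub>)"
  note I = fibred_identity[OF assms(1)] and X = assms(2)
  note simps = act_closed[OF I] act_act[OF I] act_one[OF I] act_closed[OF X] act_act[OF X] act_one[OF X]
  have e: "?e \<in> fst ?I" by (simp add: fst_identity)
  have cls: "cls X ?I x ?e = cls X ?I x' ?e \<longleftrightarrow> x = x'" if "x \<in> fst X" "x' \<in> fst X" for x x'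
  proof -
    have "cls X ?I x ?e = cls X ?I x' ?e \<longleftrightarrow>
      (\<exists>a\<in>carrier A. \<exists>g\<in>carrier G. a = \<one>\<^bsub>A\<^esub> \<and> g = \<one>\<^bsub>G\<^esub> \<and> x' = snd X (inv\<^bsub>A\<^esub> a, \<one>\<^bsub>G\<^esub>, g) x)"
      using that e by (simp add: cls_eq_iff[OF X I] identity_act eq_commute[of "\<one>\<^bsub>A\<^esub>"] eq_commute[of "\<one>\<^bsub>G\<^esub>"] cong: conj_cong)
    then show ?thesis using that by (auto simp: simps)
  qed
  have norm: "cls X ?I x (a, g) = cls X ?I (snd X (a, \<one>\<^bsub>G\<^esub>, inv\<^bsub>G\<^esub> g) x) ?e"
    if "a \<in> carrier A" "g \<in> carrier G" "x \<in> fst X" for a g x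
    using cls_shift[OF X I that(3) e, of a "inv\<^bsub>G\<^esub> g"] that by (simp add: identity_act)
  have good: "good X ?I x ?e" if "x \<in> fst X" for x
    unfolding good_def using that act_free[OF X that] by (simp add: cls simps)
  show ?thesis
  proof (rule isoI_pairing[where S = "fst X" and h = "\<lambda>x. cls X ?I x ?e" and k = "\<lambda>x. x"])
    show "fst (tensor A G X ?I) = (\<lambda>x. cls X ?I x ?e) ` fst X"
    proof (intro equalityI subsetI)
      fix t assume "t \<in> fst (tensor A G X ?I)"
      then obtain x y where "t = cls X ?I x y" "x \<in> fst X" "y \<in> fst ?I"
        by (rule tensor_memE[OF X I])
      then show "t \<in> (\<lambda>x. cls X ?I x ?e) ` fst X"
        using norm[of "fst y" "snd y" x] by (auto simp: fst_identity simps)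
    qed (auto intro!: tensor_memI[OF X I] good e)
    show "\<exists>t\<in>fst X. snd (tensor A G X ?I) (a, u, v) (cls X ?I s ?e) = cls X ?I t ?e \<and> snd X (a, u, v) s = t"
      if p: "a \<in> carrier A" "u \<in> carrier G" "v \<in> carrier G" "s \<in> fst X" for a u v s
      using p norm[of "\<one>\<^bsub>A\<^esub>" "inv\<^bsub>G\<^esub> v" "snd X (a, u, \<one>\<^bsub>G\<^esub>) s"]
      by (simp add: tensor_act[OF X I _ e] good identity_act simps)
  qed (simp_all add: cls)
qed

section \<open>Disjoint unions and distributivity\<close>

lemma fst_disjoint_union: "fst (disjoint_union X Y) = fst X <+> fst Y"
  by (simp add: disjoint_union_def)

lemma disjoint_union_act:
  "x \<in> fst X \<Longrightarrow> snd (disjoint_union X Y) p (Inl x) = Inl (snd X p x)"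
  "y \<in> fst Y \<Longrightarrow> snd (disjoint_union X Y) p (Inr y) = Inr (snd Y p y)"
  by (auto simp: disjoint_union_def)

lemma fibre_orbit_disjoint_union:
  "x \<in> fst X \<Longrightarrow> fibre_orbit (disjoint_union X Y) (Inl x) = Inl ` fibre_orbit X x"
  "y \<in> fst Y \<Longrightarrow> fibre_orbit (disjoint_union X Y) (Inr y) = Inr ` fibre_orbit Y y"
  by (auto simp: fibre_orbit_def disjoint_union_act)

lemma fibre_orbits_disjoint_union:
  "fibre_orbit (disjoint_union X Y) ` fst (disjoint_union X Y) =
    (`) Inl ` fibre_orbit X ` fst X \<union> (`) Inr ` fibre_orbit Y ` fst Y"
  by (force simp: fst_disjoint_union fibre_orbit_disjoint_union Plus_def image_Un image_image cong: image_cong)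

lemma fibred_disjoint_union:
  assumes X: "fibred X" and Y: "fibred Y"
  shows "fibred (disjoint_union X Y)"
proof (rule fibred_bisetI)
  let ?U = "disjoint_union X Y"
  show "snd ?U (a, u, v) \<in> extensional (fst ?U)" for a u v by (simp add: disjoint_union_def)
  show "finite (fibre_orbit ?U ` fst ?U)"
    using finite_fibre_orbits[OF X] finite_fibre_orbits[OF Y]
    by (simp add: fibre_orbits_disjoint_union fibre_orbits_eq)
qed (use act_free[OF X] act_free[OF Y] in \<open>auto simp: fst_disjoint_union disjoint_union_act
    act_closed[OF X] act_one[OF X] act_act[OF X] act_closed[OF Y] act_one[OF Y] act_act[OF Y]\<close>)

lemma disjoint_union_cong:
  assumes X: "fibred X" and Y: "fibred Y" and "X \<approx> X'" "Y \<approx> Y'"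
  shows "disjoint_union X Y \<approx> disjoint_union X' Y'"
proof -
  obtain f where f: "bij_betw f (fst X) (fst X')"
    "\<And>a u v x. a \<in> carrier A \<Longrightarrow> u \<in> carrier G \<Longrightarrow> v \<in> carrier G \<Longrightarrow> x \<in> fst X \<Longrightarrow>
      f (snd X (a, u, v) x) = snd X' (a, u, v) (f x)" by (rule isoE[OF assms(3)]) blast
  obtain g where g: "bij_betw g (fst Y) (fst Y')"
    "\<And>a u v x. a \<in> carrier A \<Longrightarrow> u \<in> carrier G \<Longrightarrow> v \<in> carrier G \<Longrightarrow> x \<in> fst Y \<Longrightarrow>
      g (snd Y (a, u, v) x) = snd Y' (a, u, v) (g x)" by (rule isoE[OF assms(4)]) blast
  have fX: "f x \<in> fst X'" if "x \<in> fst X" for x using f(1) that by (auto simp: bij_betw_def)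
  have gY: "g y \<in> fst Y'" if "y \<in> fst Y" for y using g(1) that by (auto simp: bij_betw_def)
  show ?thesis
  proof (rule isoI_pairing[where S = "fst X <+> fst Y" and h = "\<lambda>z. z" and k = "map_sum f g"])
    show "fst (disjoint_union X' Y') = map_sum f g ` (fst X <+> fst Y)"
      using f(1) g(1) by (force simp: fst_disjoint_union bij_betw_def Plus_def image_Un image_image)
    show "s = t \<longleftrightarrow> map_sum f g s = map_sum f g t" if "s \<in> Sum_Type.Plus (fst X) (fst Y)" "t \<in> Sum_Type.Plus (fst X) (fst Y)" for s t
      using that f(1) g(1) by (auto simp: bij_betw_def inj_on_def)
    show "\<exists>t\<in>fst X <+> fst Y. snd (disjoint_union X Y) (a, u, v) s = t \<and>
      snd (disjoint_union X' Y') (a, u, v) (map_sum f g s) = map_sum f g t"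
      if "a \<in> carrier A" "u \<in> carrier G" "v \<in> carrier G" "s \<in> fst X <+> fst Y" for a u v s
      using that by (auto simp: disjoint_union_act f(2) g(2) fX gY act_closed[OF X] act_closed[OF Y])
  qed (simp add: fst_disjoint_union)
qed

lemma fst_tensor_image:
  assumes "fibred X" "fibred Y"
  shows "fst (tensor A G X Y) = (\<lambda>(x, y). cls X Y x y) ` {(x, y). x \<in> fst X \<and> y \<in> fst Y \<and> good X Y x y}"
  by (auto simp: fst_tensor[OF assms])

text \<open>The middle action preserves the two summands, so no class meets both, and freeness of A
  at a class is decided inside one summand.\<close>

lemma tensor_disjoint_union_left:
  assumes X: "fibred X" and Y: "fibred Y" and Z: "fibred Z"
  shows "tensor A G (disjoint_union X Y) Z \<approx> disjoint_union (tensor A G X Z) (tensor A G Y Z)"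
proof -
  let ?U = "disjoint_union X Y"
  note U = fibred_disjoint_union[OF X Y]
  note simps = fst_disjoint_union disjoint_union_act act_closed[OF X] act_closed[OF Y] act_closed[OF Z] InlI InrI
  have cls: "cls ?U Z (Inl x) z = cls ?U Z (Inl x') z' \<longleftrightarrow> cls X Z x z = cls X Z x' z'"
    if "x \<in> fst X" "x' \<in> fst X" "z \<in> fst Z" "z' \<in> fst Z" for x x' z z'
    using that by (simp add: cls_eq_iff[OF U Z] cls_eq_iff[OF X Z] simps)
  have cls': "cls ?U Z (Inr y) z = cls ?U Z (Inr y') z' \<longleftrightarrow> cls Y Z y z = cls Y Z y' z'"
    if "y \<in> fst Y" "y' \<in> fst Y" "z \<in> fst Z" "z' \<in> fst Z" for y y' z z'
    using that by (simp add: cls_eq_iff[OF U Z] cls_eq_iff[OF Y Z] simps)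
  have cls'': "cls ?U Z (Inl x) z \<noteq> cls ?U Z (Inr y) z'"
    if "x \<in> fst X" "y \<in> fst Y" "z \<in> fst Z" "z' \<in> fst Z" for x y z z'
    using that by (simp add: cls_eq_iff[OF U Z] simps)
  have good: "good ?U Z (Inl x) z \<longleftrightarrow> good X Z x z" if "x \<in> fst X" "z \<in> fst Z" for x z
    using that by (simp add: good_def simps cls)
  have good': "good ?U Z (Inr y) z \<longleftrightarrow> good Y Z y z" if "y \<in> fst Y" "z \<in> fst Z" for y z
    using that by (simp add: good_def simps cls')
  define S where "S = {(x, z). x \<in> fst X \<and> z \<in> fst Z \<and> good X Z x z} <+> {(y, z). y \<in> fst Y \<and> z \<in> fst Z \<and> good Y Z y z}"
  define h where "h = case_sum (\<lambda>(x, z). cls ?U Z (Inl x) z) (\<lambda>(y, z). cls ?U Z (Inr y) z)"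
  define k where "k = map_sum (\<lambda>(x, z). cls X Z x z) (\<lambda>(y, z). cls Y Z y z)"
  show ?thesis
  proof (rule isoI_pairing[where S = S and h = h and k = k])
    show "fst (tensor A G ?U Z) = h ` S"
    proof (intro equalityI subsetI)
      fix t assume "t \<in> fst (tensor A G ?U Z)"
      then obtain w z where w: "t = cls ?U Z w z" "w \<in> fst ?U" "z \<in> fst Z" "good ?U Z w z"
        by (rule tensor_memE[OF U Z])
      then show "t \<in> h ` S"
      proof (cases w)
        case (Inl x)
        with w show ?thesis
          by (intro image_eqI[of _ _ "Inl (x, z)"]) (auto simp: S_def h_def good simps)
      next
        case (Inr y)
        with w show ?thesis
          by (intro image_eqI[of _ _ "Inr (y, z)"]) (auto simp: S_def h_def good' simps)
      qed
    qed (auto simp: S_def h_def good good' simps intro!: tensor_memI[OF U Z])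
    show "fst (disjoint_union (tensor A G X Z) (tensor A G Y Z)) = k ` S"
      by (auto simp: fst_disjoint_union S_def k_def Plus_def image_Un image_image fst_tensor_image[OF X Z]
          fst_tensor_image[OF Y Z] case_prod_beta conj_ac)
    show "h s = h t \<longleftrightarrow> k s = k t" if "s \<in> S" "t \<in> S" for s t
      using that unfolding S_def h_def k_def
      by (elim PlusE) (simp_all add: case_prod_beta cls cls' cls'' cls''[symmetric])
    fix a u v s assume p: "a \<in> carrier A" "u \<in> carrier G" "v \<in> carrier G" and s: "s \<in> S"
    show "\<exists>t\<in>S. snd (tensor A G ?U Z) (a, u, v) (h s) = h t \<and>
      snd (disjoint_union (tensor A G X Z) (tensor A G Y Z)) (a, u, v) (k s) = k t"
    proof (cases s)
      case (Inl w)
      obtain x z where w: "w = (x, z)" by (cases w)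
      with s Inl have xz: "x \<in> fst X" "z \<in> fst Z" "good X Z x z" by (auto simp: S_def)
      with p show ?thesis unfolding Inl w
        by (intro bexI[of _ "Inl (snd X (a, u, \<one>\<^bsub>G\<^esub>) x, snd Z (\<one>\<^bsub>A\<^esub>, \<one>\<^bsub>G\<^esub>, v) z)"])
          (simp_all add: S_def h_def k_def tensor_act[OF U Z] tensor_act[OF X Z] tensor_memI[OF X Z] simps good good_act[OF X Z] InlI)
    next
      case (Inr w)
      obtain y z where w: "w = (y, z)" by (cases w)
      with s Inr have xz: "y \<in> fst Y" "z \<in> fst Z" "good Y Z y z" by (auto simp: S_def)
      with p show ?thesis unfolding Inr w
        by (intro bexI[of _ "Inr (snd Y (a, u, \<one>\<^bsub>G\<^esub>) y, snd Z (\<one>\<^bsub>A\<^esub>, \<one>\<^bsub>G\<^esub>, v) z)"])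
          (simp_all add: S_def h_def k_def tensor_act[OF U Z] tensor_act[OF Y Z] tensor_memI[OF Y Z] simps good' good_act[OF Y Z] InrI)
    qed
  qed
qed

lemma tensor_disjoint_union_right:
  assumes X: "fibred X" and Y: "fibred Y" and Z: "fibred Z"
  shows "tensor A G Z (disjoint_union X Y) \<approx> disjoint_union (tensor A G Z X) (tensor A G Z Y)"
proof -
  let ?U = "disjoint_union X Y"
  note U = fibred_disjoint_union[OF X Y]
  note simps = fst_disjoint_union disjoint_union_act act_closed[OF X] act_closed[OF Y] act_closed[OF Z] InlI InrI
  have cls: "cls Z ?U z (Inl x) = cls Z ?U z' (Inl x') \<longleftrightarrow> cls Z X z x = cls Z X z' x'"
    if "x \<in> fst X" "x' \<in> fst X" "z \<in> fst Z" "z' \<in> fst Z" for x x' z z'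
    using that by (simp add: cls_eq_iff[OF Z U] cls_eq_iff[OF Z X] simps)
  have cls': "cls Z ?U z (Inr y) = cls Z ?U z' (Inr y') \<longleftrightarrow> cls Z Y z y = cls Z Y z' y'"
    if "y \<in> fst Y" "y' \<in> fst Y" "z \<in> fst Z" "z' \<in> fst Z" for y y' z z'
    using that by (simp add: cls_eq_iff[OF Z U] cls_eq_iff[OF Z Y] simps)
  have cls'': "cls Z ?U z (Inl x) \<noteq> cls Z ?U z' (Inr y)"
    if "x \<in> fst X" "y \<in> fst Y" "z \<in> fst Z" "z' \<in> fst Z" for x y z z'
    using that by (simp add: cls_eq_iff[OF Z U] simps)
  have good: "good Z ?U z (Inl x) \<longleftrightarrow> good Z X z x" if "x \<in> fst X" "z \<in> fst Z" for x z
    using that by (simp add: good_def simps cls)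
  have good': "good Z ?U z (Inr y) \<longleftrightarrow> good Z Y z y" if "y \<in> fst Y" "z \<in> fst Z" for y z
    using that by (simp add: good_def simps cls')
  define S where "S = {(z, x). x \<in> fst X \<and> z \<in> fst Z \<and> good Z X z x} <+> {(z, y). y \<in> fst Y \<and> z \<in> fst Z \<and> good Z Y z y}"
  define h where "h = case_sum (\<lambda>(z, x). cls Z ?U z (Inl x)) (\<lambda>(z, y). cls Z ?U z (Inr y))"
  define k where "k = map_sum (\<lambda>(z, x). cls Z X z x) (\<lambda>(z, y). cls Z Y z y)"
  show ?thesis
  proof (rule isoI_pairing[where S = S and h = h and k = k])
    show "fst (tensor A G Z ?U) = h ` S"
    proof (intro equalityI subsetI)
      fix t assume "t \<in> fst (tensor A G Z ?U)"
      then obtain z w where w: "t = cls Z ?U z w" "z \<in> fst Z" "w \<in> fst ?U" "good Z ?U z w"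
        by (rule tensor_memE[OF Z U])
      then show "t \<in> h ` S"
      proof (cases w)
        case (Inl x)
        with w show ?thesis
          by (intro image_eqI[of _ _ "Inl (z, x)"]) (auto simp: S_def h_def good simps)
      next
        case (Inr y)
        with w show ?thesis
          by (intro image_eqI[of _ _ "Inr (z, y)"]) (auto simp: S_def h_def good' simps)
      qed
    qed (auto simp: S_def h_def good good' simps intro!: tensor_memI[OF Z U])
    show "fst (disjoint_union (tensor A G Z X) (tensor A G Z Y)) = k ` S"
      by (auto simp: fst_disjoint_union S_def k_def Plus_def image_Un image_image fst_tensor_image[OF Z X]
          fst_tensor_image[OF Z Y] case_prod_beta conj_ac)
    show "h s = h t \<longleftrightarrow> k s = k t" if "s \<in> S" "t \<in> S" for s t
      using that unfolding S_def h_def k_def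
      by (elim PlusE) (simp_all add: case_prod_beta cls cls' cls'' cls''[symmetric])
    fix a u v s assume p: "a \<in> carrier A" "u \<in> carrier G" "v \<in> carrier G" and s: "s \<in> S"
    show "\<exists>t\<in>S. snd (tensor A G Z ?U) (a, u, v) (h s) = h t \<and>
      snd (disjoint_union (tensor A G Z X) (tensor A G Z Y)) (a, u, v) (k s) = k t"
    proof (cases s)
      case (Inl w)
      obtain z x where w: "w = (z, x)" by (cases w)
      with s Inl have xz: "x \<in> fst X" "z \<in> fst Z" "good Z X z x" by (auto simp: S_def)
      with p show ?thesis unfolding Inl w
        by (intro bexI[of _ "Inl (snd Z (a, u, \<one>\<^bsub>G\<^esub>) z, snd X (\<one>\<^bsub>A\<^esub>, \<one>\<^bsub>G\<^esub>, v) x)"])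
          (simp_all add: S_def h_def k_def tensor_act[OF Z U] tensor_act[OF Z X] tensor_memI[OF Z X] simps good good_act[OF Z X] InlI)
    next
      case (Inr w)
      obtain z y where w: "w = (z, y)" by (cases w)
      with s Inr have xz: "y \<in> fst Y" "z \<in> fst Z" "good Z Y z y" by (auto simp: S_def)
      with p show ?thesis unfolding Inr w
        by (intro bexI[of _ "Inr (snd Z (a, u, \<one>\<^bsub>G\<^esub>) z, snd Y (\<one>\<^bsub>A\<^esub>, \<one>\<^bsub>G\<^esub>, v) y)"])
          (simp_all add: S_def h_def k_def tensor_act[OF Z U] tensor_act[OF Z Y] tensor_memI[OF Z Y] simps good' good_act[OF Z Y] InrI)
    qed
  qed
qed

section \<open>Operations on isomorphism classes\<close>

lemma iso_class_eqI:
  assumes "fibred X" "X \<approx> Y"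
  shows "iso_class A G X = iso_class A G Y"
proof -
  have "Z \<approx> X \<longleftrightarrow> Z \<approx> Y" for Z :: "('a, 'g, nat \<times> 'a) aset"
    using iso_trans[of Z X Y] iso_trans[of Z Y X] iso_sym[OF assms] assms(2) by blast
  then show ?thesis by (simp add: iso_class_def)
qed

lemma iso_class_nonempty:
  assumes "fibred X"
  shows "iso_class A G X \<noteq> {}"
proof -
  obtain Y :: "('a, 'g, nat \<times> 'a) aset" where "fibred Y" "Y \<approx> X"
    by (rule ex_fibred_nat[OF assms])
  then have "Y \<in> iso_class A G X" by (simp add: iso_class_def)
  then show ?thesis by blast
qed

lemma iso_class_in_biset_classes:
  assumes "fibred X"
  shows "iso_class A G X \<in> biset_classes A G"
proof -
  obtain Y :: "('a, 'g, nat \<times> 'a) aset" where "fibred Y" "Y \<approx> X"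
    by (rule ex_fibred_nat[OF assms])
  then show ?thesis unfolding biset_classes_def using iso_class_eqI by blast
qed

lemma biset_classesE:
  assumes "C \<in> biset_classes A G"
  obtains X :: "('a, 'g, nat \<times> 'a) aset" where "fibred X" "C = iso_class A G X"
  using assms by (auto simp: biset_classes_def)

text \<open>All choices of representatives give the same class, so the double union collapses to it.
  For this the classes must be nonempty, which rests on \<open>ex_fibred_nat\<close>.\<close>

lemma class_union_iso_class:
  assumes X: "fibred X" and Y: "fibred Y"
  shows "class_union A G (iso_class A G X) (iso_class A G Y) = iso_class A G (disjoint_union X Y)"
proof -
  have *: "iso_class A G (disjoint_union X' Y') = iso_class A G (disjoint_union X Y)"
    if "X' \<in> iso_class A G X" "Y' \<in> iso_class A G Y" for X' Y'
  proof -
    from that have X': "fibred X'" and Y': "fibred Y'" and "X' \<approx> X" "Y' \<approx> Y"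
      by (simp_all add: iso_class_def)
    then show ?thesis by (intro iso_class_eqI fibred_disjoint_union[OF X' Y'] disjoint_union_cong[OF X' Y'])
  qed
  show ?thesis unfolding class_union_def by (simp add: * iso_class_nonempty X Y cong: SUP_cong_simp)
qed

lemma class_tensor_iso_class:
  assumes X: "fibred X" and Y: "fibred Y"
  shows "class_tensor A G (iso_class A G X) (iso_class A G Y) = iso_class A G (tensor A G X Y)"
proof -
  have *: "iso_class A G (tensor A G X' Y') = iso_class A G (tensor A G X Y)"
    if "X' \<in> iso_class A G X" "Y' \<in> iso_class A G Y" for X' Y'
  proof -
    from that have X': "fibred X'" and Y': "fibred Y'" and "X' \<approx> X" "Y' \<approx> Y"
      by (simp_all add: iso_class_def)
    then show ?thesis by (intro iso_class_eqI fibred_tensor[OF X' Y'] tensor_cong[OF X' Y' X Y])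
  qed
  show ?thesis unfolding class_tensor_def by (simp add: * iso_class_nonempty X Y cong: SUP_cong_simp)
qed

end

section \<open>The free algebra and its quotient\<close>

definition linear_extension :: "('c \<Rightarrow> 'k::comm_ring_1) \<Rightarrow> ('c \<Rightarrow>\<^sub>0 'k) \<Rightarrow> 'k" where
  "linear_extension \<phi> f = (\<Sum>C\<in>Poly_Mapping.keys f. Poly_Mapping.lookup f C * \<phi> C)"

lemma linear_extension_superset:
  assumes "finite S" "Poly_Mapping.keys f \<subseteq> S"
  shows "linear_extension \<phi> f = (\<Sum>C\<in>S. Poly_Mapping.lookup f C * \<phi> C)"
  unfolding linear_extension_def using assms
  by (intro sum.mono_neutral_left) (auto simp: in_keys_iff)

lemma linear_extension_add:
  "linear_extension \<phi> (f + g) = linear_extension \<phi> f + linear_extension \<phi> g"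
proof -
  let ?S = "Poly_Mapping.keys f \<union> Poly_Mapping.keys g"
  have "finite ?S" "Poly_Mapping.keys (f + g) \<subseteq> ?S" by (auto dest: subsetD[OF Poly_Mapping.keys_add])
  then show ?thesis
    by (simp add: linear_extension_superset[of ?S] lookup_add distrib_right sum.distrib)
qed

lemma linear_extension_single: "linear_extension \<phi> (Poly_Mapping.single C c) = c * \<phi> C"
  by (simp add: linear_extension_def)

lemma linear_extension_zero: "linear_extension \<phi> 0 = 0"
  by (simp add: linear_extension_def)

lemma linear_extension_uminus: "linear_extension \<phi> (- f) = - linear_extension \<phi> f"
  using linear_extension_add[of \<phi> f "- f"] by (simp add: linear_extension_zero eq_neg_iff_add_eq_0 add.commute)

lemma linear_extension_diff: "linear_extension \<phi> (f - g) = linear_extension \<phi> f - linear_extension \<phi> g"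
  using linear_extension_add[of \<phi> f "- g"] by (simp add: linear_extension_uminus)

lemma poly_mapping_keys_induct [consumes 1, case_names zero single add]:
  fixes f :: "'c \<Rightarrow>\<^sub>0 'k::comm_monoid_add"
  assumes "Poly_Mapping.keys f \<subseteq> S"
    and zero: "P 0" and single: "\<And>C c. C \<in> S \<Longrightarrow> P (Poly_Mapping.single C c)"
    and add: "\<And>f g. Poly_Mapping.keys f \<subseteq> S \<Longrightarrow> Poly_Mapping.keys g \<subseteq> S \<Longrightarrow> P f \<Longrightarrow> P g \<Longrightarrow> P (f + g)"
  shows "P f"
proof -
  have *: "f = (\<Sum>C\<in>Poly_Mapping.keys f. Poly_Mapping.single C (Poly_Mapping.lookup f C))"
    by (rule poly_mapping_eqI) (auto simp: lookup_sum lookup_single when_def in_keys_iff)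
  \<comment> \<open>The bound on the support is carried along because the case \<open>add\<close>
    asks for it at every partial sum.\<close>
  have "P (\<Sum>C\<in>T. Poly_Mapping.single C (Poly_Mapping.lookup f C)) \<and>
    Poly_Mapping.keys (\<Sum>C\<in>T. Poly_Mapping.single C (Poly_Mapping.lookup f C)) \<subseteq> S"
    if "finite T" "T \<subseteq> Poly_Mapping.keys f" for T
    using that
  proof induction
    case (insert C T)
    then have "C \<in> S" using assms(1) by auto
    then have "Poly_Mapping.keys (Poly_Mapping.single C (Poly_Mapping.lookup f C)) \<subseteq> S" by auto
    have IH: "P (\<Sum>C\<in>T. Poly_Mapping.single C (Poly_Mapping.lookup f C))"
      "Poly_Mapping.keys (\<Sum>C\<in>T. Poly_Mapping.single C (Poly_Mapping.lookup f C)) \<subseteq> S"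
      using insert by auto
    let ?g = "Poly_Mapping.single C (Poly_Mapping.lookup f C)"
      and ?h = "\<Sum>C\<in>T. Poly_Mapping.single C (Poly_Mapping.lookup f C)"
    have "Poly_Mapping.keys ?g \<subseteq> S" using \<open>C \<in> S\<close> by simp
    then have "P (?g + ?h)" using IH single[OF \<open>C \<in> S\<close>] by (intro add)
    moreover have "Poly_Mapping.keys (?g + ?h) \<subseteq> S"
      using \<open>Poly_Mapping.keys ?g \<subseteq> S\<close> IH(2) by (intro order_trans[OF Poly_Mapping.keys_add] Un_least)
    ultimately have "P (?g + ?h)" "Poly_Mapping.keys (?g + ?h) \<subseteq> S" .
    with insert(1,2) show ?case by simp
  qed (simp add: zero)
  from this[OF finite_keys order_refl, THEN conjunct1] show ?thesis by (rule ssubst[OF *])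
qed

context fibre_setting
begin

lemma class_tensor_closed:
  assumes "C \<in> biset_classes A G" "D \<in> biset_classes A G"
  shows "class_tensor A G C D \<in> biset_classes A G"
  using assms
  by (elim biset_classesE) (simp add: class_tensor_iso_class fibred_tensor iso_class_in_biset_classes)

lemma class_union_closed:
  assumes "C \<in> biset_classes A G" "D \<in> biset_classes A G"
  shows "class_union A G C D \<in> biset_classes A G"
  using assms
  by (elim biset_classesE) (simp add: class_union_iso_class fibred_disjoint_union iso_class_in_biset_classes)

lemma class_tensor_assoc:
  assumes "C \<in> biset_classes A G" "D \<in> biset_classes A G" "E \<in> biset_classes A G"
  shows "class_tensor A G (class_tensor A G C D) E = class_tensor A G C (class_tensor A G D E)"
  using assms
  by (elim biset_classesE)
    (simp add: class_tensor_iso_class fibred_tensor iso_class_eqI[OF fibred_tensor tensor_assoc])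

lemma class_tensor_union_left:
  assumes "C \<in> biset_classes A G" "D \<in> biset_classes A G" "E \<in> biset_classes A G"
  shows "class_tensor A G (class_union A G C D) E =
    class_union A G (class_tensor A G C E) (class_tensor A G D E)"
  using assms
  by (elim biset_classesE)
    (simp add: class_tensor_iso_class class_union_iso_class fibred_tensor fibred_disjoint_union
      iso_class_eqI[OF fibred_tensor tensor_disjoint_union_left])

lemma class_tensor_union_right:
  assumes "C \<in> biset_classes A G" "D \<in> biset_classes A G" "E \<in> biset_classes A G"
  shows "class_tensor A G E (class_union A G C D) =
    class_union A G (class_tensor A G E C) (class_tensor A G E D)"
  using assms
  by (elim biset_classesE)
    (simp add: class_tensor_iso_class class_union_iso_class fibred_tensor fibred_disjoint_union
      iso_class_eqI[OF fibred_tensor tensor_disjoint_union_right])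

end

section \<open>The ring structure of the free algebra\<close>

locale finite_fibre_setting = fibre_setting A G
  for A :: "('a, 'm) monoid_scheme" and G :: "('g, 'n) monoid_scheme" +
  fixes K :: "'k::field_char_0 itself"
  assumes finite_G: "finite (carrier G)"
begin

abbreviation R :: "(('a, 'g) biset_class \<Rightarrow>\<^sub>0 'k) ring" where
  "R \<equiv> free_algebra TYPE('k) A G"

abbreviation I :: "(('a, 'g) biset_class \<Rightarrow>\<^sub>0 'k) set" where
  "I \<equiv> union_relations TYPE('k) A G"

abbreviation Id :: "('a, 'g, 'a \<times> 'g) aset" where
  "Id \<equiv> identity_biset A G"

abbreviation bas :: "('a, 'g, 'x) aset \<Rightarrow> ('a, 'g) biset_class \<Rightarrow>\<^sub>0 'k" where
  "bas X \<equiv> Poly_Mapping.single (iso_class A G X) 1"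

lemma carrier_R: "carrier R = {f. Poly_Mapping.keys f \<subseteq> biset_classes A G}"
  by (simp add: free_algebra_def)

lemma add_R: "f \<oplus>\<^bsub>R\<^esub> g = f + g"
  by (simp add: free_algebra_def)

lemma zero_R: "\<zero>\<^bsub>R\<^esub> = 0"
  by (simp add: free_algebra_def)

lemma one_R: "\<one>\<^bsub>R\<^esub> = bas Id"
  by (simp add: free_algebra_def)

text \<open>Supports can shrink in a sum by cancellation, so a product summed over exact supports is
  not visibly bilinear. Over fixed finite supersets the additional terms vanish and additivity is
  immediate.\<close>

lemma mult_R_superset:
  assumes "finite S" "Poly_Mapping.keys f \<subseteq> S" "finite T" "Poly_Mapping.keys h \<subseteq> T"
  shows "f \<otimes>\<^bsub>R\<^esub> h = (\<Sum>C\<in>S. \<Sum>D\<in>T.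
    Poly_Mapping.single (class_tensor A G C D) (Poly_Mapping.lookup f C * Poly_Mapping.lookup h D))"
proof -
  have "f \<otimes>\<^bsub>R\<^esub> h = (\<Sum>C\<in>Poly_Mapping.keys f. \<Sum>D\<in>T.
    Poly_Mapping.single (class_tensor A G C D) (Poly_Mapping.lookup f C * Poly_Mapping.lookup h D))"
    unfolding free_algebra_def monoid.simps using assms
    by (intro sum.cong[OF refl] sum.mono_neutral_left) (auto simp: in_keys_iff)
  also have "\<dots> = (\<Sum>C\<in>S. \<Sum>D\<in>T.
    Poly_Mapping.single (class_tensor A G C D) (Poly_Mapping.lookup f C * Poly_Mapping.lookup h D))"
    using assms by (intro sum.mono_neutral_left) (auto simp: in_keys_iff)
  finally show ?thesis .
qed

lemma mult_R_add_left: "(f + g) \<otimes>\<^bsub>R\<^esub> h = f \<otimes>\<^bsub>R\<^esub> h + g \<otimes>\<^bsub>R\<^esub> h"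
proof -
  let ?S = "Poly_Mapping.keys f \<union> Poly_Mapping.keys g"
  have "finite ?S" "Poly_Mapping.keys (f + g) \<subseteq> ?S" by (auto dest: subsetD[OF Poly_Mapping.keys_add])
  then show ?thesis
    by (simp add: mult_R_superset[of ?S _ "Poly_Mapping.keys h"] lookup_add distrib_right
        Poly_Mapping.single_add sum.distrib)
qed

lemma mult_R_add_right: "h \<otimes>\<^bsub>R\<^esub> (f + g) = h \<otimes>\<^bsub>R\<^esub> f + h \<otimes>\<^bsub>R\<^esub> g"
proof -
  let ?S = "Poly_Mapping.keys f \<union> Poly_Mapping.keys g"
  have "finite ?S" "Poly_Mapping.keys (f + g) \<subseteq> ?S" by (auto dest: subsetD[OF Poly_Mapping.keys_add])
  then show ?thesis
    by (simp add: mult_R_superset[of "Poly_Mapping.keys h" _ ?S] lookup_add distrib_left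
        Poly_Mapping.single_add sum.distrib)
qed

lemma mult_R_zero: "0 \<otimes>\<^bsub>R\<^esub> h = 0" "h \<otimes>\<^bsub>R\<^esub> 0 = 0"
  by (simp_all add: mult_R_superset[of "{}" 0 "Poly_Mapping.keys h" h] mult_R_superset[of "Poly_Mapping.keys h" h "{}" 0])

lemma mult_R_diff_left: "(f - g) \<otimes>\<^bsub>R\<^esub> h = f \<otimes>\<^bsub>R\<^esub> h - g \<otimes>\<^bsub>R\<^esub> h"
  using mult_R_add_left[of "f - g" g h] by (simp add: algebra_simps)

lemma mult_R_diff_right: "h \<otimes>\<^bsub>R\<^esub> (f - g) = h \<otimes>\<^bsub>R\<^esub> f - h \<otimes>\<^bsub>R\<^esub> g"
  using mult_R_add_right[of h "f - g" g] by (simp add: algebra_simps)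

lemma mult_R_uminus: "(- f) \<otimes>\<^bsub>R\<^esub> h = - (f \<otimes>\<^bsub>R\<^esub> h)" "h \<otimes>\<^bsub>R\<^esub> (- f) = - (h \<otimes>\<^bsub>R\<^esub> f)"
  using mult_R_diff_left[of 0 f h] mult_R_diff_right[of h 0 f] by (simp_all add: mult_R_zero)

lemma mult_R_single:
  "Poly_Mapping.single C c \<otimes>\<^bsub>R\<^esub> Poly_Mapping.single D d = Poly_Mapping.single (class_tensor A G C D) (c * d)"
  by (simp add: mult_R_superset[of "{C}" _ "{D}"])

lemma mult_R_bas:
  assumes "fibred X" "fibred Y"
  shows "bas X \<otimes>\<^bsub>R\<^esub> bas Y = bas (tensor A G X Y)"
  by (simp add: mult_R_single class_tensor_iso_class assms)

lemma add_closed_R: "f \<in> carrier R \<Longrightarrow> g \<in> carrier R \<Longrightarrow> f + g \<in> carrier R"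
  by (auto simp: carrier_R dest: subsetD[OF Poly_Mapping.keys_add])

lemma single_closed_R: "C \<in> biset_classes A G \<Longrightarrow> Poly_Mapping.single C c \<in> carrier R"
  by (auto simp: carrier_R)

lemma uminus_closed_R: "f \<in> carrier R \<Longrightarrow> - f \<in> carrier R"
  by (simp add: carrier_R)

lemma diff_closed_R: "f \<in> carrier R \<Longrightarrow> g \<in> carrier R \<Longrightarrow> f - g \<in> carrier R"
  using add_closed_R[of f "- g"] uminus_closed_R[of g] by simp

lemma zero_closed_R: "0 \<in> carrier R"
  by (simp add: carrier_R)

lemma R_induct [consumes 1, case_names zero single add]:
  assumes "f \<in> carrier R" and "P 0" and "\<And>C c. C \<in> biset_classes A G \<Longrightarrow> P (Poly_Mapping.single C c)"
    and "\<And>f g. f \<in> carrier R \<Longrightarrow> g \<in> carrier R \<Longrightarrow> P f \<Longrightarrow> P g \<Longrightarrow> P (f + g)"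
  shows "P f"
  using assms unfolding carrier_R mem_Collect_eq by (rule poly_mapping_keys_induct)

lemma mult_closed_R:
  assumes "f \<in> carrier R" "g \<in> carrier R"
  shows "f \<otimes>\<^bsub>R\<^esub> g \<in> carrier R"
  using assms(1)
proof (induction f rule: R_induct)
  case (single C c)
  show ?case using assms(2)
    by (induction g rule: R_induct)
      (simp_all add: mult_R_zero zero_closed_R mult_R_single single_closed_R class_tensor_closed single
        mult_R_add_right add_closed_R)
qed (simp_all add: mult_R_zero zero_closed_R mult_R_add_left add_closed_R)

lemma mult_assoc_R:
  assumes f: "f \<in> carrier R" and g: "g \<in> carrier R" and h: "h \<in> carrier R"
  shows "f \<otimes>\<^bsub>R\<^esub> g \<otimes>\<^bsub>R\<^esub> h = f \<otimes>\<^bsub>R\<^esub> (g \<otimes>\<^bsub>R\<^esub> h)"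
  using f
proof (induction f rule: R_induct)
  case C: (single C c)
  show ?case using g
  proof (induction g rule: R_induct)
    case D: (single D d)
    show ?case using h
      by (induction h rule: R_induct)
        (simp_all add: mult_R_zero mult_R_add_right mult_R_single class_tensor_assoc C D mult.assoc)
  qed (simp_all add: mult_R_zero mult_R_add_left mult_R_add_right)
qed (simp_all add: mult_R_zero mult_R_add_left)

lemma bas_closed: "fibred X \<Longrightarrow> bas X \<in> carrier R"
  by (simp add: single_closed_R iso_class_in_biset_classes)

lemma mult_one_R:
  assumes "f \<in> carrier R"
  shows "bas Id \<otimes>\<^bsub>R\<^esub> f = f" "f \<otimes>\<^bsub>R\<^esub> bas Id = f"
proof -
  have 1: "class_tensor A G (iso_class A G Id) C = C" if "C \<in> biset_classes A G" for C
    using that by (elim biset_classesE)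
      (simp add: class_tensor_iso_class fibred_identity finite_G iso_class_eqI[OF fibred_tensor tensor_identity_left])
  have 2: "class_tensor A G C (iso_class A G Id) = C" if "C \<in> biset_classes A G" for C
    using that by (elim biset_classesE)
      (simp add: class_tensor_iso_class fibred_identity finite_G iso_class_eqI[OF fibred_tensor tensor_identity_right])
  show "bas Id \<otimes>\<^bsub>R\<^esub> f = f"
    using assms by (induction f rule: R_induct) (simp_all add: mult_R_zero mult_R_add_right mult_R_single 1)
  show "f \<otimes>\<^bsub>R\<^esub> bas Id = f"
    using assms by (induction f rule: R_induct) (simp_all add: mult_R_zero mult_R_add_left mult_R_single 2)
qed

lemma ring_R: "ring R"
proof (rule ringI)
  show "abelian_group R"
    by (rule abelian_groupI)
      (auto simp: add_R zero_R add_closed_R zero_closed_R algebra_simps intro!: bexI[OF _ uminus_closed_R])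
  show "monoid R"
    by (rule monoidI)
      (simp_all add: mult_closed_R mult_assoc_R one_R mult_one_R bas_closed fibred_identity finite_G)
qed (simp_all add: add_R mult_R_add_left mult_R_add_right)

lemma inv_R: "f \<in> carrier R \<Longrightarrow> inv\<^bsub>add_monoid R\<^esub> f = - f"
  unfolding a_inv_def[symmetric]
  by (rule abelian_group.minus_equality[OF ring.is_abelian_group[OF ring_R]])
    (simp_all add: add_R zero_R uminus_closed_R)

section \<open>The ideal of union relations\<close>

definition relators :: "(('a, 'g) biset_class \<Rightarrow>\<^sub>0 'k) set" where
  "relators = {Poly_Mapping.single (class_union A G C D) c
          - Poly_Mapping.single C c - Poly_Mapping.single D c |C D c.
        C \<in> biset_classes A G \<and> D \<in> biset_classes A G}"

lemma I_eq: "I = generate (add_monoid R) relators"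
  by (simp add: union_relations_def relators_def)

lemma relators_closed: "relators \<subseteq> carrier R"
  by (auto simp: relators_def intro!: diff_closed_R single_closed_R class_union_closed)

lemma subgroup_I: "subgroup I (add_monoid R)"
  unfolding I_eq using relators_closed
  by (intro group.generate_is_subgroup abelian_group.a_group ring.is_abelian_group ring_R) auto

lemma I_closed: "I \<subseteq> carrier R"
  using subgroup.subset[OF subgroup_I] by simp

lemma I_zero: "0 \<in> I"
  using subgroup.one_closed[OF subgroup_I] by (simp add: zero_R)

lemma I_add: "f \<in> I \<Longrightarrow> g \<in> I \<Longrightarrow> f + g \<in> I"
  using subgroup.m_closed[OF subgroup_I, of f g] by (simp add: add_R)

lemma I_uminus:
  assumes "f \<in> I"
  shows "- f \<in> I"
  using subgroup.m_inv_closed[OF subgroup_I assms] unfolding inv_R[OF subsetD[OF I_closed assms]] .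

lemma relators_incl: "f \<in> relators \<Longrightarrow> f \<in> I"
  unfolding I_eq by (rule generate.incl)

lemma I_induct [consumes 1, case_names zero relator uminus add]:
  assumes "f \<in> I" and "P 0" and "\<And>f. f \<in> relators \<Longrightarrow> P f" and "\<And>f. f \<in> relators \<Longrightarrow> P (- f)"
    and "\<And>f g. P f \<Longrightarrow> P g \<Longrightarrow> P (f + g)"
  shows "P f"
  using assms(1) unfolding I_eq
proof induction
  case (inv h)
  then show ?case using assms(4)[OF inv] unfolding inv_R[OF subsetD[OF relators_closed inv]] by simp
qed (use assms in \<open>auto simp: zero_R add_R\<close>)

text \<open>Distributivity turns a generating relation times a basis element into another generating
  relation, with the two coefficients multiplied. This makes the additive subgroup \<open>I\<close>
  a two-sided ideal.\<close>

lemma relators_mult: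
  assumes "f \<in> relators" "E \<in> biset_classes A G"
  shows "Poly_Mapping.single E e \<otimes>\<^bsub>R\<^esub> f \<in> relators" "f \<otimes>\<^bsub>R\<^esub> Poly_Mapping.single E e \<in> relators"
proof -
  obtain C D c where f: "f = Poly_Mapping.single (class_union A G C D) c
          - Poly_Mapping.single C c - Poly_Mapping.single D c"
    "C \<in> biset_classes A G" "D \<in> biset_classes A G"
    using assms(1) by (auto simp: relators_def)
  show "Poly_Mapping.single E e \<otimes>\<^bsub>R\<^esub> f \<in> relators"
    unfolding relators_def mem_Collect_eq
    by (intro exI[of _ "class_tensor A G E C"] exI[of _ "class_tensor A G E D"] exI[of _ "e * c"])
      (use f assms(2) in \<open>simp add: mult_R_diff_right mult_R_single class_tensor_union_right class_tensor_closed\<close>)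
  show "f \<otimes>\<^bsub>R\<^esub> Poly_Mapping.single E e \<in> relators"
    unfolding relators_def mem_Collect_eq
    by (intro exI[of _ "class_tensor A G C E"] exI[of _ "class_tensor A G D E"] exI[of _ "c * e"])
      (use f assms(2) in \<open>simp add: mult_R_diff_left mult_R_single class_tensor_union_left class_tensor_closed\<close>)
qed

lemma I_mult:
  assumes "f \<in> I" "r \<in> carrier R"
  shows "r \<otimes>\<^bsub>R\<^esub> f \<in> I" "f \<otimes>\<^bsub>R\<^esub> r \<in> I"
proof -
  show "r \<otimes>\<^bsub>R\<^esub> f \<in> I"
    using assms(2)
  proof (induction r rule: R_induct)
    case (single C c)
    show ?case using assms(1)
      by (induction f rule: I_induct)
        (simp_all add: mult_R_zero I_zero mult_R_add_right I_add mult_R_uminus I_uminus relators_incl relators_mult single)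
  qed (simp_all add: mult_R_zero I_zero mult_R_add_left I_add)
  show "f \<otimes>\<^bsub>R\<^esub> r \<in> I"
    using assms(2)
  proof (induction r rule: R_induct)
    case (single C c)
    show ?case using assms(1)
      by (induction f rule: I_induct)
        (simp_all add: mult_R_zero I_zero mult_R_add_left I_add mult_R_uminus I_uminus relators_incl relators_mult single)
  qed (simp_all add: mult_R_zero I_zero mult_R_add_right I_add)
qed

lemma ideal_I: "ideal I R"
  by (rule idealI[OF ring_R subgroup_I]) (simp_all add: I_mult)

text \<open>Brings \<open>not_semisimple_ring_if_square_zero\<close> back to the free algebra, where
  all later computations are congruences modulo \<open>I\<close> between explicit sums of biset
  classes.\<close>

lemma not_semisimple_quotientI:
  assumes x: "x \<in> carrier R" "x \<notin> I" and sq: "\<And>r. r \<in> carrier R \<Longrightarrow> x \<otimes>\<^bsub>R\<^esub> (r \<otimes>\<^bsub>R\<^esub> x) \<in> I"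
  shows "\<not> semisimple_ring (fibred_double_burnside_algebra TYPE('k) A G)"
proof -
  have zero: "\<zero>\<^bsub>R Quot I\<^esub> = I" by (simp add: FactRing_def)
  interpret ideal I R by (rule ideal_I)
  let ?Q = "fibred_double_burnside_algebra TYPE('k) A G"
  have Q: "?Q = R Quot I" by (simp add: fibred_double_burnside_algebra_def)
  interpret h: ring_hom_ring R "R Quot I" "(+>\<^bsub>R\<^esub>) I" by (rule rcos_ring_hom_ring)
  show ?thesis
  proof (rule not_semisimple_ring_if_square_zero)
    show "ring ?Q" unfolding Q by (rule quotient_is_ring)
    show "I +>\<^bsub>R\<^esub> x \<in> carrier ?Q" unfolding Q using x by simp
    show "I +>\<^bsub>R\<^esub> x \<noteq> \<zero>\<^bsub>?Q\<^esub>" unfolding Q zero using a_rcos_self[OF x(1)] x(2) by blast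
    fix q assume "q \<in> carrier ?Q"
    then obtain r where r: "r \<in> carrier R" "q = I +>\<^bsub>R\<^esub> r"
      unfolding Q by (auto simp: FactRing_def A_RCOSETS_def' a_r_coset_def')
    have "(I +>\<^bsub>R\<^esub> x) \<otimes>\<^bsub>?Q\<^esub> (q \<otimes>\<^bsub>?Q\<^esub> (I +>\<^bsub>R\<^esub> x)) = I +>\<^bsub>R\<^esub> (x \<otimes>\<^bsub>R\<^esub> (r \<otimes>\<^bsub>R\<^esub> x))"
      unfolding Q r(2) using r(1) x(1) by (metis h.hom_mult mult_closed_R)
    also have "\<dots> = \<zero>\<^bsub>?Q\<^esub>" unfolding Q zero using sq[OF r(1)] by (rule a_rcos_const)
    finally show "(I +>\<^bsub>R\<^esub> x) \<otimes>\<^bsub>?Q\<^esub> (q \<otimes>\<^bsub>?Q\<^esub> (I +>\<^bsub>R\<^esub> x)) = \<zero>\<^bsub>?Q\<^esub>" .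
  qed
qed

text \<open>The test for not lying in \<open>I\<close>: a function that adds up over disjoint unions
  vanishes on each generating relation once it is extended linearly.\<close>

lemma linear_extension_I:
  assumes "\<And>C D. C \<in> biset_classes A G \<Longrightarrow> D \<in> biset_classes A G \<Longrightarrow> \<phi> (class_union A G C D) = \<phi> C + \<phi> D"
    and "f \<in> I"
  shows "linear_extension \<phi> f = 0"
  using assms(2)
  by (induction f rule: I_induct)
    (auto simp: relators_def linear_extension_zero linear_extension_diff linear_extension_uminus
      linear_extension_add linear_extension_single assms(1) distrib_left)

end

section \<open>Counting fibre orbits\<close>

context fibre_setting
begin

text \<open>An analogue of the marks of a Burnside ring, with A-orbits in place of points. At the
  identity it is n(X); at (1, 1, c) it will separate x from zero.\<close>

definition fixed_orbits :: "'a \<times> 'g \<times> 'g \<Rightarrow> ('a, 'g, 'x) aset \<Rightarrow> nat" where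
  "fixed_orbits w X = card {W \<in> fibre_orbit X ` fst X. snd X w ` W = W}"

lemma fibre_orbit_subset:
  assumes "fibred X" "x \<in> fst X"
  shows "fibre_orbit X x \<subseteq> fst X"
  using assms by (auto simp: fibre_orbit_def act_closed)

lemma fibre_orbit_image: "fibre_orbit X x = (\<lambda>a. snd X (a, \<one>\<^bsub>G\<^esub>, \<one>\<^bsub>G\<^esub>) x) ` carrier A"
  by (auto simp: fibre_orbit_def)

lemma fixed_orbits_cong:
  assumes X: "fibred X" and "X \<approx> Y" and w: "w \<in> carrier acting_group"
  shows "fixed_orbits w X = fixed_orbits w Y"
proof -
  obtain f where f: "bij_betw f (fst X) (fst Y)"
    "\<And>a u v x. a \<in> carrier A \<Longrightarrow> u \<in> carrier G \<Longrightarrow> v \<in> carrier G \<Longrightarrow> x \<in> fst X \<Longrightarrow>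
      f (snd X (a, u, v) x) = snd Y (a, u, v) (f x)" by (rule isoE[OF assms(2)]) blast
  have fw: "f (snd X w x) = snd Y w (f x)" "snd X w x \<in> fst X" if "x \<in> fst X" for x
    using f(2) act_closed[OF X] w that by auto
  have orb: "fibre_orbit Y (f x) = f ` fibre_orbit X x" if "x \<in> fst X" for x
    unfolding fibre_orbit_image image_image using that f(2) by (intro image_cong) auto
  have inj: "inj_on f (fst X)" and img: "f ` fst X = fst Y" using f(1) by (auto simp: bij_betw_def)
  have iff: "snd Y w ` f ` W = f ` W \<longleftrightarrow> snd X w ` W = W" if "W \<subseteq> fst X" for W
  proof -
    have "snd Y w ` f ` W = f ` snd X w ` W"
      unfolding image_image using that fw(1) by (intro image_cong) auto
    then show ?thesis
      using inj_on_image_eq_iff[OF inj, of "snd X w ` W" W] that fw(2) by auto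
  qed
  have "{W \<in> fibre_orbit Y ` fst Y. snd Y w ` W = W} = (`) f ` {W \<in> fibre_orbit X ` fst X. snd X w ` W = W}"
    (is "?L = _ ` ?R")
  proof (intro equalityI subsetI)
    fix W assume W: "W \<in> ?L"
    then obtain y where "y \<in> fst Y" "W = fibre_orbit Y y" by auto
    moreover from this obtain x where "x \<in> fst X" "y = f x" using img by (metis imageE)
    ultimately have x: "x \<in> fst X" "W = f ` fibre_orbit X x" using orb by simp_all
    with W show "W \<in> (`) f ` ?R"
      by (auto simp: iff[OF fibre_orbit_subset[OF X]])
  next
    fix W assume "W \<in> (`) f ` ?R"
    then obtain x where x: "x \<in> fst X" "W = f ` fibre_orbit X x" "snd X w ` fibre_orbit X x = fibre_orbit X x"
      by auto
    then have "W = fibre_orbit Y (f x)" "f x \<in> fst Y" "snd Y w ` W = W"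
      using img by (auto simp: orb iff[OF fibre_orbit_subset[OF X]])
    then show "W \<in> ?L" by auto
  qed
  moreover have "inj_on ((`) f) {W \<in> fibre_orbit X ` fst X. snd X w ` W = W}"
    using fibre_orbit_subset[OF X] inj by (intro inj_on_subset[OF inj_on_image_Pow]) auto
  ultimately show ?thesis unfolding fixed_orbits_def by (simp add: card_image)
qed

lemma fixed_orbits_disjoint_union:
  fixes X :: "('a, 'g, 'x) aset" and Y :: "('a, 'g, 'y) aset"
  assumes X: "fibred X" and Y: "fibred Y"
  shows "fixed_orbits w (disjoint_union X Y) = fixed_orbits w X + fixed_orbits w Y"
proof -
  let ?U = "disjoint_union X Y"
  let ?X = "{W \<in> fibre_orbit X ` fst X. snd X w ` W = W}" and ?Y = "{W \<in> fibre_orbit Y ` fst Y. snd Y w ` W = W}"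
  have l: "snd ?U w ` Inl ` W = Inl ` W \<longleftrightarrow> snd X w ` W = W" if "W \<in> fibre_orbit X ` fst X" for W
  proof -
    have "W \<subseteq> fst X" using that fibre_orbit_subset[OF X] by auto
    then have "snd ?U w ` Inl ` W = Inl ` snd X w ` W"
      unfolding image_image by (intro image_cong) (auto simp: disjoint_union_act subsetD)
    then show ?thesis by (simp add: inj_image_eq_iff)
  qed
  have r: "snd ?U w ` Inr ` W = Inr ` W \<longleftrightarrow> snd Y w ` W = W" if "W \<in> fibre_orbit Y ` fst Y" for W
  proof -
    have "W \<subseteq> fst Y" using that fibre_orbit_subset[OF Y] by auto
    then have "snd ?U w ` Inr ` W = Inr ` snd Y w ` W"
      unfolding image_image by (intro image_cong) (auto simp: disjoint_union_act subsetD)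
    then show ?thesis by (simp add: inj_image_eq_iff)
  qed
  have "{W \<in> fibre_orbit ?U ` fst ?U. snd ?U w ` W = W} = (`) Inl ` ?X \<union> (`) Inr ` ?Y"
  proof -
    have *: "{W \<in> F ` S. P W} = F ` {x \<in> S. Q x}"
      if "\<And>x. x \<in> S \<Longrightarrow> P (F x) \<longleftrightarrow> Q x" for F :: "'e \<Rightarrow> 'f" and S P Q
      using that by auto
    have "{W \<in> fibre_orbit ?U ` fst ?U. snd ?U w ` W = W} =
      {W \<in> (`) Inl ` fibre_orbit X ` fst X. snd ?U w ` W = W} \<union> {W \<in> (`) Inr ` fibre_orbit Y ` fst Y. snd ?U w ` W = W}"
      unfolding fibre_orbits_disjoint_union by (rule Collect_disj_eq[THEN trans[rotated]]) blast
    also have "\<dots> = (`) Inl ` ?X \<union> (`) Inr ` ?Y"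
      by (intro arg_cong2[where f = "(\<union>)"] *) (simp_all only: l r)
    finally show ?thesis .
  qed
  \<comment> \<open>The empty set is the one set that is an image under both \<open>Inl\<close> and
    \<open>Inr\<close>, and A-orbits are nonempty.\<close>
  moreover have "(`) Inl ` ?X \<inter> (`) Inr ` ?Y = {}"
    using fibre_orbit_self[OF X] by auto
  moreover have "finite ?X" "finite ?Y"
    using finite_fibre_orbits[OF X] finite_fibre_orbits[OF Y] by (simp_all add: fibre_orbits_eq)
  moreover have "card ((`) Inl ` ?X :: ('x + 'y) set set) = card ?X"
    by (intro card_image inj_onI) (simp add: inj_image_eq_iff)
  moreover have "card ((`) Inr ` ?Y :: ('x + 'y) set set) = card ?Y"
    by (intro card_image inj_onI) (simp add: inj_image_eq_iff)
  ultimately show ?thesis unfolding fixed_orbits_def by (simp add: card_Un_disjoint)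
qed

text \<open>The choice is harmless: \<open>fixed_orbits\<close> is constant on the members of an isomorphism class, and
  these classes are nonempty.\<close>

definition class_fixed_orbits :: "'a \<times> 'g \<times> 'g \<Rightarrow> ('a, 'g) biset_class \<Rightarrow> nat" where
  "class_fixed_orbits w C = fixed_orbits w (SOME X. X \<in> C)"

lemma class_fixed_orbits_iso_class:
  assumes "fibred X" "w \<in> carrier acting_group"
  shows "class_fixed_orbits w (iso_class A G X) = fixed_orbits w X"
proof -
  have "(SOME Y. Y \<in> iso_class A G X) \<in> iso_class A G X"
    using iso_class_nonempty[OF assms(1)] by (simp add: some_in_eq)
  then show ?thesis
    using assms(2) by (auto simp: class_fixed_orbits_def iso_class_def intro: fixed_orbits_cong)
qed

lemma class_fixed_orbits_union:
  assumes "C \<in> biset_classes A G" "D \<in> biset_classes A G" "w \<in> carrier acting_group"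
  shows "class_fixed_orbits w (class_union A G C D) = class_fixed_orbits w C + class_fixed_orbits w D"
  using assms
  by (elim biset_classesE)
    (simp add: class_union_iso_class class_fixed_orbits_iso_class fibred_disjoint_union fixed_orbits_disjoint_union)

text \<open>Each of the n copies is the group A \<times> (G \<times> G) acting on itself by left
  multiplication; in terms of transitive bisets this is n times the one for U = 1. The case n = 0 is
  the empty biset.\<close>

definition free_biset :: "nat \<Rightarrow> ('a, 'g, nat \<times> 'a \<times> 'g \<times> 'g) aset" where
  "free_biset n = ({..<n} \<times> carrier A \<times> carrier G \<times> carrier G,
    \<lambda>(a, u, v). \<lambda>(i, b, s, t)\<in>{..<n} \<times> carrier A \<times> carrier G \<times> carrier G.
      (i, a \<otimes>\<^bsub>A\<^esub> b, u \<otimes>\<^bsub>G\<^esub> s, v \<otimes>\<^bsub>G\<^esub> t))"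

lemma fst_free_biset: "fst (free_biset n) = {..<n} \<times> carrier A \<times> carrier G \<times> carrier G"
  by (simp add: free_biset_def)

lemma free_biset_act:
  assumes "i < n" "b \<in> carrier A" "s \<in> carrier G" "t \<in> carrier G"
  shows "snd (free_biset n) (a, u, v) (i, b, s, t) = (i, a \<otimes>\<^bsub>A\<^esub> b, u \<otimes>\<^bsub>G\<^esub> s, v \<otimes>\<^bsub>G\<^esub> t)"
  using assms by (simp add: free_biset_def)

lemma fibred_free_biset:
  assumes "finite (carrier G)"
  shows "fibred (free_biset n)"
proof (rule fibred_bisetI)
  let ?F = "free_biset n"
  show "snd ?F (a, u, v) \<in> extensional (fst ?F)" for a u v by (simp add: free_biset_def)
  show "finite (fibre_orbit ?F ` fst ?F)"
  proof -
    have "fibre_orbit ?F x \<in> (\<lambda>(i, s, t). {i} \<times> carrier A \<times> {s} \<times> {t}) ` ({..<n} \<times> carrier G \<times> carrier G)"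
      if x: "x \<in> fst ?F" for x
    proof -
      obtain i b s t where ibst: "x = (i, b, s, t)" "i < n" "b \<in> carrier A" "s \<in> carrier G" "t \<in> carrier G"
        using x by (auto simp: fst_free_biset)
      have "fibre_orbit ?F x = {i} \<times> carrier A \<times> {s} \<times> {t}"
      proof (intro equalityI subsetI)
        fix y assume "y \<in> {i} \<times> carrier A \<times> {s} \<times> {t}"
        then have "y = snd ?F (fst (snd y) \<otimes>\<^bsub>A\<^esub> inv\<^bsub>A\<^esub> b, \<one>\<^bsub>G\<^esub>, \<one>\<^bsub>G\<^esub>) x" "fst (snd y) \<otimes>\<^bsub>A\<^esub> inv\<^bsub>A\<^esub> b \<in> carrier A"
          using ibst by (auto simp: free_biset_act A.m_assoc)
        then show "y \<in> fibre_orbit ?F x" unfolding fibre_orbit_def by blast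
      qed (use ibst in \<open>auto simp: fibre_orbit_def free_biset_act\<close>)
      then show ?thesis using ibst by (intro image_eqI[of _ _ "(i, s, t)"]) auto
    qed
    then have "fibre_orbit ?F ` fst ?F \<subseteq>
      (\<lambda>(i, s, t). {i} \<times> carrier A \<times> {s} \<times> {t}) ` ({..<n} \<times> carrier G \<times> carrier G)"
      by (rule image_subsetI)
    then show ?thesis by (rule finite_subset) (simp add: assms)
  qed
qed (auto simp: fst_free_biset free_biset_act A.m_assoc G.m_assoc)

text \<open>The empty biset is its own double, which forces its class to vanish in the Grothendieck
  group.\<close>

lemma free_biset_0: "disjoint_union (free_biset 0) (free_biset 0) \<approx> free_biset 0"
  by (rule isoI_pairing[where S = "{} :: nat set"])
    (auto simp: fst_disjoint_union fst_free_biset)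

lemma free_biset_Suc: "free_biset (Suc n) \<approx> disjoint_union (free_biset n) (free_biset (Suc 0))"
proof -
  \<comment> \<open>The last copy has index n and is renamed to 0, the single index of the second
    summand.\<close>
  define k where "k = (\<lambda>(i, q). if i < n then Inl (i, q) else Inr (0 :: nat, q :: 'a \<times> 'g \<times> 'g))"
  show ?thesis
  proof (rule isoI_pairing[where S = "fst (free_biset (Suc n))" and h = "\<lambda>x. x" and k = k])
    show "fst (disjoint_union (free_biset n) (free_biset (Suc 0))) = k ` fst (free_biset (Suc n))"
    proof (intro equalityI subsetI)
      fix x assume "x \<in> fst (disjoint_union (free_biset n) (free_biset (Suc 0)))"
      then consider i q where "x = Inl (i, q)" "i < n" "q \<in> carrier acting_group"
        | q where "x = Inr (0, q)" "q \<in> carrier acting_group"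
        by (auto simp: fst_disjoint_union fst_free_biset)
      then show "x \<in> k ` fst (free_biset (Suc n))"
      proof cases
        case 1
        then show ?thesis by (intro image_eqI[of _ _ "(i, q)"]) (auto simp: k_def fst_free_biset)
      next
        case 2
        then show ?thesis by (intro image_eqI[of _ _ "(n, q)"]) (auto simp: k_def fst_free_biset)
      qed
    qed (auto simp: k_def fst_free_biset fst_disjoint_union InlI InrI)
    show "s = t \<longleftrightarrow> k s = k t" if "s \<in> fst (free_biset (Suc n))" "t \<in> fst (free_biset (Suc n))" for s t
      using that by (auto simp: k_def fst_free_biset split: if_splits)
  next
    fix a u v s
    assume p: "a \<in> carrier A" "u \<in> carrier G" "v \<in> carrier G" and s: "s \<in> fst (free_biset (Suc n))"
    then show "\<exists>t\<in>fst (free_biset (Suc n)). snd (free_biset (Suc n)) (a, u, v) s = t \<and>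
      snd (disjoint_union (free_biset n) (free_biset (Suc 0))) (a, u, v) (k s) = k t"
      by (auto simp: fst_free_biset free_biset_act k_def disjoint_union_act)
  qed simp
qed

end

context finite_fibre_setting
begin

section \<open>Tensor products with the regular biset\<close>

abbreviation reg :: "('a, 'g, nat \<times> 'a \<times> 'g \<times> 'g) aset" where
  "reg \<equiv> free_biset (Suc 0)"

abbreviation reg_unit :: "nat \<times> 'a \<times> 'g \<times> 'g" where
  "reg_unit \<equiv> (0, \<one>\<^bsub>A\<^esub>, \<one>\<^bsub>G\<^esub>, \<one>\<^bsub>G\<^esub>)"

lemmas fibred_free = fibred_free_biset[OF finite_G]

lemma reg_unit_in: "reg_unit \<in> fst reg"
  by (simp add: fst_free_biset)

lemma reg_cases:
  assumes "x \<in> fst reg"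
  obtains a u v where "a \<in> carrier A" "u \<in> carrier G" "v \<in> carrier G" "x = snd reg (a, u, v) reg_unit"
  using assms by (auto simp: fst_free_biset free_biset_act)

lemma reg_act_eq_iff:
  assumes "x \<in> fst reg" "a \<in> carrier A" "u \<in> carrier G" "v \<in> carrier G"
    "b \<in> carrier A" "s \<in> carrier G" "t \<in> carrier G"
  shows "snd reg (a, u, v) x = snd reg (b, s, t) x \<longleftrightarrow> a = b \<and> u = s \<and> v = t"
  using assms by (auto simp: fst_free_biset free_biset_act)

text \<open>On the regular factor the coordinates of a middle element can be read off: agreement
  with a scalar a forces g = 1 and b = a^-1. Then b fixes y, so b = 1 by freeness on Y. Thus no
  class is discarded.\<close>

lemma good_reg_left:
  assumes Y: "fibred Y" and x: "x \<in> fst reg" and y: "y \<in> fst Y"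
  shows "good reg Y x y"
  unfolding good_mid_iff[OF fibred_free Y x y]
proof (intro ballI impI)
  fix a b g assume *: "a \<in> carrier A" "b \<in> carrier A" "g \<in> carrier G"
    "snd reg (a, \<one>\<^bsub>G\<^esub>, \<one>\<^bsub>G\<^esub>) x = snd reg (inv\<^bsub>A\<^esub> b, \<one>\<^bsub>G\<^esub>, g) x" "y = snd Y (b, g, \<one>\<^bsub>G\<^esub>) y"
  then have "a = inv\<^bsub>A\<^esub> b" "g = \<one>\<^bsub>G\<^esub>" using x by (auto simp: reg_act_eq_iff)
  then have "b = \<one>\<^bsub>A\<^esub>" using act_free[OF Y y, of b] * by simp
  then show "a = \<one>\<^bsub>A\<^esub>" using \<open>a = inv\<^bsub>A\<^esub> b\<close> by simp
qed

lemma good_reg_right: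
  assumes Y: "fibred Y" and y: "y \<in> fst Y" and x: "x \<in> fst reg"
  shows "good Y reg y x"
  unfolding good_mid_iff[OF Y fibred_free y x]
proof (intro ballI impI)
  fix a b g assume *: "a \<in> carrier A" "b \<in> carrier A" "g \<in> carrier G"
    "snd Y (a, \<one>\<^bsub>G\<^esub>, \<one>\<^bsub>G\<^esub>) y = snd Y (inv\<^bsub>A\<^esub> b, \<one>\<^bsub>G\<^esub>, g) y" "x = snd reg (b, g, \<one>\<^bsub>G\<^esub>) x"
  then have "snd reg (\<one>\<^bsub>A\<^esub>, \<one>\<^bsub>G\<^esub>, \<one>\<^bsub>G\<^esub>) x = snd reg (b, g, \<one>\<^bsub>G\<^esub>) x"
    using x by (simp add: act_one[OF fibred_free])
  then have "\<one>\<^bsub>A\<^esub> = b \<and> \<one>\<^bsub>G\<^esub> = g \<and> \<one>\<^bsub>G\<^esub> = \<one>\<^bsub>G\<^esub>"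
    by (rule iffD1[OF reg_act_eq_iff[OF x], rotated -1]) (use * in auto)
  then have "b = \<one>\<^bsub>A\<^esub>" "g = \<one>\<^bsub>G\<^esub>" by auto
  then show "a = \<one>\<^bsub>A\<^esub>" using act_free[OF Y y, of a] act_one[OF Y y] * by simp
qed

text \<open>The inner G-coordinates of the two regular factors and all scalars can be absorbed into
  Z, while the outer coordinates u and v stay free. What is left of Z is an A-set, that is n(Z)
  copies of A. So a point has coordinates (i, a, u, v), where a times \<open>r i\<close> is the
  point of Z and \<open>r i\<close> represents the A-orbit number i.\<close>

lemma tensor_reg_reg:
  assumes Z: "fibred Z"
  shows "free_biset (card (fibre_orbit Z ` fst Z)) \<approx> tensor A G reg (tensor A G Z reg)"
proof -
  let ?n = "card (fibre_orbit Z ` fst Z)" and ?T = "tensor A G Z reg" and ?e = reg_unit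
  note F = fibred_free[of "Suc 0"]
  note T = fibred_tensor[OF Z F]
  note simps = act_closed[OF Z] act_closed[OF F] act_closed[OF T]
    act_act[OF Z] act_act[OF F] act_act[OF T] act_one[OF Z] act_one[OF F] act_one[OF T] reg_unit_in
  have "finite (fibre_orbit Z ` fst Z)"
    using finite_fibre_orbits[OF Z] by (simp add: fibre_orbits_eq)
  then obtain h where h: "bij_betw h {0..<?n} (fibre_orbit Z ` fst Z)"
    using ex_bij_betw_nat_finite by blast
  have "\<exists>z\<in>fst Z. fibre_orbit Z z = h i" if "i < ?n" for i
  proof -
    have "h i \<in> fibre_orbit Z ` fst Z" using bij_betwE[OF h] that by simp
    then obtain z where "h i = fibre_orbit Z z" "z \<in> fst Z" by (rule imageE)
    then show ?thesis by (intro bexI[of _ z]) auto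
  qed
  then obtain r where r: "r i \<in> fst Z" "fibre_orbit Z (r i) = h i" if "i < ?n" for i
    by metis
  have tmem: "cls Z reg z x \<in> fst ?T" if "z \<in> fst Z" "x \<in> fst reg" for z x
    using that by (intro tensor_memI[OF Z F]) (auto intro: good_reg_right[OF Z])
  have tact: "snd ?T (a, u, v) (cls Z reg z x) = cls Z reg (snd Z (a, u, \<one>\<^bsub>G\<^esub>) z) (snd reg (\<one>\<^bsub>A\<^esub>, \<one>\<^bsub>G\<^esub>, v) x)"
    if "z \<in> fst Z" "x \<in> fst reg" "a \<in> carrier A" "u \<in> carrier G" "v \<in> carrier G" for a u v z x
    using that by (intro tensor_act[OF Z F] good_reg_right[OF Z])
  have n1: "cls Z reg z (snd reg (a, u, v) ?e) = cls Z reg (snd Z (a, \<one>\<^bsub>G\<^esub>, inv\<^bsub>G\<^esub> u) z) (snd reg (\<one>\<^bsub>A\<^esub>, \<one>\<^bsub>G\<^esub>, v) ?e)"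
    if "z \<in> fst Z" "a \<in> carrier A" "u \<in> carrier G" "v \<in> carrier G" for z a u v
    using cls_shift[OF Z F that(1), of "snd reg (\<one>\<^bsub>A\<^esub>, \<one>\<^bsub>G\<^esub>, v) ?e" a "inv\<^bsub>G\<^esub> u"] that by (simp add: simps)
  have n2: "cls reg ?T (snd reg (a, u, v) ?e) t = cls reg ?T (snd reg (\<one>\<^bsub>A\<^esub>, u, \<one>\<^bsub>G\<^esub>) ?e) (snd ?T (a, inv\<^bsub>G\<^esub> v, \<one>\<^bsub>G\<^esub>) t)"
    if "t \<in> fst ?T" "a \<in> carrier A" "u \<in> carrier G" "v \<in> carrier G" for t a u v
    using cls_shift[OF F T _ that(1), of "snd reg (\<one>\<^bsub>A\<^esub>, u, \<one>\<^bsub>G\<^esub>) ?e" a v] that by (simp add: simps)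
  define k where "k = (\<lambda>(i, a, u, v). cls reg ?T (snd reg (\<one>\<^bsub>A\<^esub>, u, \<one>\<^bsub>G\<^esub>) ?e)
    (cls Z reg (snd Z (a, \<one>\<^bsub>G\<^esub>, \<one>\<^bsub>G\<^esub>) (r i)) (snd reg (\<one>\<^bsub>A\<^esub>, \<one>\<^bsub>G\<^esub>, v) ?e)))"
  show ?thesis
  proof (rule isoI_pairing[where S = "fst (free_biset ?n)" and h = "\<lambda>x. x" and k = k])
    show "fst (tensor A G reg ?T) = k ` fst (free_biset ?n)"
    proof (intro equalityI subsetI)
      fix w assume "w \<in> fst (tensor A G reg ?T)"
      then obtain x t where w: "w = cls reg ?T x t" "x \<in> fst reg" "t \<in> fst ?T"
        by (rule tensor_memE[OF F T])
      obtain a u v where x: "a \<in> carrier A" "u \<in> carrier G" "v \<in> carrier G" "x = snd reg (a, u, v) ?e"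
        using w(2) by (rule reg_cases)
      obtain z y where t: "t = cls Z reg z y" "z \<in> fst Z" "y \<in> fst reg"
        using w(3) by (rule tensor_memE[OF Z F])
      obtain b s q where y: "b \<in> carrier A" "s \<in> carrier G" "q \<in> carrier G" "y = snd reg (b, s, q) ?e"
        using t(3) by (rule reg_cases)
      \<comment> \<open>Collects in Z all that can be moved there: a and the inner coordinate v of
        the left factor, b and the inner coordinate s of the right factor.\<close>
      define z' where "z' = snd Z (b, \<one>\<^bsub>G\<^esub>, inv\<^bsub>G\<^esub> s) (snd Z (a, inv\<^bsub>G\<^esub> v, \<one>\<^bsub>G\<^esub>) z)"
      have z': "z' \<in> fst Z" using x y t by (simp add: z'_def simps)
      have "w = cls reg ?T (snd reg (\<one>\<^bsub>A\<^esub>, u, \<one>\<^bsub>G\<^esub>) ?e) (cls Z reg (snd Z (a, inv\<^bsub>G\<^esub> v, \<one>\<^bsub>G\<^esub>) z) y)"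
        using w x t by (simp add: n2 tact simps)
      also have "cls Z reg (snd Z (a, inv\<^bsub>G\<^esub> v, \<one>\<^bsub>G\<^esub>) z) y = cls Z reg z' (snd reg (\<one>\<^bsub>A\<^esub>, \<one>\<^bsub>G\<^esub>, q) ?e)"
        unfolding y(4) z'_def using x y t by (intro n1) (simp_all add: simps)
      finally have w': "w = cls reg ?T (snd reg (\<one>\<^bsub>A\<^esub>, u, \<one>\<^bsub>G\<^esub>) ?e) (cls Z reg z' (snd reg (\<one>\<^bsub>A\<^esub>, \<one>\<^bsub>G\<^esub>, q) ?e))" .
      obtain i where i: "i < ?n" "h i = fibre_orbit Z z'"
      proof -
        have "fibre_orbit Z z' \<in> h ` {0..<?n}" using h z' by (simp add: bij_betw_def)
        then show thesis using that by auto
      qed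
      then obtain c where "c \<in> carrier A" "z' = snd Z (c, \<one>\<^bsub>G\<^esub>, \<one>\<^bsub>G\<^esub>) (r i)"
        using fibre_orbit_eq_iff[OF Z r(1)[OF i(1)] z'] r(2)[OF i(1)] by auto
      then show "w \<in> k ` fst (free_biset ?n)"
        using i(1) w' x(2) y(3) by (intro image_eqI[of _ _ "(i, c, u, q)"]) (auto simp: k_def fst_free_biset)
    next
      fix w assume "w \<in> k ` fst (free_biset ?n)"
      then obtain s where "w = k s" "s \<in> fst (free_biset ?n)" by blast
      moreover from this obtain i a u v where "s = (i, a, u, v)" "i < ?n" "a \<in> carrier A" "u \<in> carrier G" "v \<in> carrier G"
        by (auto simp: fst_free_biset)
      ultimately show "w \<in> fst (tensor A G reg ?T)"
        by (simp add: k_def simps r tensor_memI[OF F T] good_reg_left[OF T] tmem)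
    qed
    show "s = t \<longleftrightarrow> k s = k t" if st: "s \<in> fst (free_biset ?n)" "t \<in> fst (free_biset ?n)" for s t
    proof
      assume eq: "k s = k t"
      obtain i a u v j b x y where s: "s = (i, a, u, v)" "i < ?n" "a \<in> carrier A" "u \<in> carrier G" "v \<in> carrier G"
        and t: "t = (j, b, x, y)" "j < ?n" "b \<in> carrier A" "x \<in> carrier G" "y \<in> carrier G"
        using st by (auto simp: fst_free_biset)
      \<comment> \<open>Comparing the left factors makes the middle element (c, g) trivial, so the
        equality descends to the inner tensor product. There the comparison of right factors does
        the same.\<close>
      have "\<exists>c\<in>carrier A. \<exists>g\<in>carrier G. snd reg (\<one>\<^bsub>A\<^esub>, x, \<one>\<^bsub>G\<^esub>) ?e = snd reg (inv\<^bsub>A\<^esub> c, u, g) ?e \<and>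
        cls Z reg (snd Z (b, \<one>\<^bsub>G\<^esub>, \<one>\<^bsub>G\<^esub>) (r j)) (snd reg (\<one>\<^bsub>A\<^esub>, \<one>\<^bsub>G\<^esub>, y) ?e) =
        snd ?T (c, g, \<one>\<^bsub>G\<^esub>) (cls Z reg (snd Z (a, \<one>\<^bsub>G\<^esub>, \<one>\<^bsub>G\<^esub>) (r i)) (snd reg (\<one>\<^bsub>A\<^esub>, \<one>\<^bsub>G\<^esub>, v) ?e))"
        using eq s t by (simp add: k_def cls_eq_iff[OF F T] tmem simps r)
      then have u: "x = u" and "cls Z reg (snd Z (b, \<one>\<^bsub>G\<^esub>, \<one>\<^bsub>G\<^esub>) (r j)) (snd reg (\<one>\<^bsub>A\<^esub>, \<one>\<^bsub>G\<^esub>, y) ?e) =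
        cls Z reg (snd Z (a, \<one>\<^bsub>G\<^esub>, \<one>\<^bsub>G\<^esub>) (r i)) (snd reg (\<one>\<^bsub>A\<^esub>, \<one>\<^bsub>G\<^esub>, v) ?e)"
        using s t by (auto simp: reg_act_eq_iff simps tmem r eq_commute[of "\<one>\<^bsub>A\<^esub>"])
      then have "\<exists>c\<in>carrier A. \<exists>g\<in>carrier G.
        snd Z (a, \<one>\<^bsub>G\<^esub>, \<one>\<^bsub>G\<^esub>) (r i) = snd Z (inv\<^bsub>A\<^esub> c \<otimes>\<^bsub>A\<^esub> b, \<one>\<^bsub>G\<^esub>, g) (r j) \<and>
        snd reg (\<one>\<^bsub>A\<^esub>, \<one>\<^bsub>G\<^esub>, v) ?e = snd reg (c, g, y) ?e"
        using s t by (simp add: cls_eq_iff[OF Z F] simps r)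
      then have v: "v = y" and z: "snd Z (a, \<one>\<^bsub>G\<^esub>, \<one>\<^bsub>G\<^esub>) (r i) = snd Z (b, \<one>\<^bsub>G\<^esub>, \<one>\<^bsub>G\<^esub>) (r j)"
        using s t by (auto simp: reg_act_eq_iff simps r)
      have "h i = h j"
      proof -
        have "fibre_orbit Z (r i) = fibre_orbit Z (snd Z (a, \<one>\<^bsub>G\<^esub>, \<one>\<^bsub>G\<^esub>) (r i))"
          by (subst fibre_orbit_eq_iff[OF Z]) (use s r(1) in \<open>auto simp: simps\<close>)
        moreover have "fibre_orbit Z (r j) = fibre_orbit Z (snd Z (b, \<one>\<^bsub>G\<^esub>, \<one>\<^bsub>G\<^esub>) (r j))"
          by (subst fibre_orbit_eq_iff[OF Z]) (use t r(1) in \<open>auto simp: simps\<close>)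
        ultimately show ?thesis using z r s t by simp
      qed
      then have "i = j" using h s t by (auto simp: bij_betw_def inj_on_def)
      moreover have "a = b" using z s t act_fibre_eq_iff[OF Z r(1)] unfolding \<open>i = j\<close> by blast
      ultimately show "s = t" using s t u v by simp
    qed simp
  next
    fix a u v s
    assume p: "a \<in> carrier A" "u \<in> carrier G" "v \<in> carrier G" and "s \<in> fst (free_biset ?n)"
    then obtain i b x y where s: "s = (i, b, x, y)" "i < ?n" "b \<in> carrier A" "x \<in> carrier G" "y \<in> carrier G"
      by (auto simp: fst_free_biset)
    have "snd (tensor A G reg ?T) (a, u, v) (k s) =
      cls reg ?T (snd reg (a, u \<otimes>\<^bsub>G\<^esub> x, \<one>\<^bsub>G\<^esub>) ?e)
        (cls Z reg (snd Z (b, \<one>\<^bsub>G\<^esub>, \<one>\<^bsub>G\<^esub>) (r i)) (snd reg (\<one>\<^bsub>A\<^esub>, \<one>\<^bsub>G\<^esub>, v \<otimes>\<^bsub>G\<^esub> y) ?e))"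
      using p s by (simp add: k_def tensor_act[OF F T] good_reg_left[OF T] tmem tact simps r)
    \<comment> \<open>The action has put the scalar a on the left factor; \<open>n2\<close> with
      trivial inner coordinate moves it to Z and restores the normal form.\<close>
    also have "\<dots> = k (i, a \<otimes>\<^bsub>A\<^esub> b, u \<otimes>\<^bsub>G\<^esub> x, v \<otimes>\<^bsub>G\<^esub> y)"
    proof -
      let ?t = "cls Z reg (snd Z (b, \<one>\<^bsub>G\<^esub>, \<one>\<^bsub>G\<^esub>) (r i)) (snd reg (\<one>\<^bsub>A\<^esub>, \<one>\<^bsub>G\<^esub>, v \<otimes>\<^bsub>G\<^esub> y) ?e)"
      have "?t \<in> fst ?T" using p s r by (intro tmem) (simp_all add: simps)
      from n2[OF this, of a "u \<otimes>\<^bsub>G\<^esub> x" "\<one>\<^bsub>G\<^esub>"] show ?thesis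
        using p s by (simp add: k_def tact simps r)
    qed
    finally show "\<exists>t\<in>fst (free_biset ?n). snd (free_biset ?n) (a, u, v) s = t \<and>
      snd (tensor A G reg ?T) (a, u, v) (k s) = k t"
      using p s by (simp add: fst_free_biset free_biset_act)
  qed simp
qed

end

section \<open>Quotients by a subgroup of prime order\<close>

context fibre_setting
begin

lemma act_power:
  assumes Y: "fibred Y" and y: "y \<in> fst Y" and a: "a \<in> carrier A" and g: "g \<in> carrier G"
    and eq: "snd Y (\<one>\<^bsub>A\<^esub>, g, \<one>\<^bsub>G\<^esub>) y = snd Y (a, \<one>\<^bsub>G\<^esub>, \<one>\<^bsub>G\<^esub>) y"
  shows "snd Y (\<one>\<^bsub>A\<^esub>, g [^]\<^bsub>G\<^esub> (i::nat), \<one>\<^bsub>G\<^esub>) y = snd Y (a [^]\<^bsub>A\<^esub> i, \<one>\<^bsub>G\<^esub>, \<one>\<^bsub>G\<^esub>) y"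
proof (induction i)
  case (Suc i)
  have "snd Y (\<one>\<^bsub>A\<^esub>, g [^]\<^bsub>G\<^esub> Suc i, \<one>\<^bsub>G\<^esub>) y = snd Y (\<one>\<^bsub>A\<^esub>, g [^]\<^bsub>G\<^esub> i, \<one>\<^bsub>G\<^esub>) (snd Y (\<one>\<^bsub>A\<^esub>, g, \<one>\<^bsub>G\<^esub>) y)"
    using y a g by (simp add: act_act[OF Y])
  also have "\<dots> = snd Y (a, \<one>\<^bsub>G\<^esub>, \<one>\<^bsub>G\<^esub>) (snd Y (\<one>\<^bsub>A\<^esub>, g [^]\<^bsub>G\<^esub> i, \<one>\<^bsub>G\<^esub>) y)"
    unfolding eq using y a g by (simp add: act_act[OF Y])
  also have "\<dots> = snd Y (a [^]\<^bsub>A\<^esub> Suc i, \<one>\<^bsub>G\<^esub>, \<one>\<^bsub>G\<^esub>) y"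
    unfolding Suc using y a g by (simp add: act_act[OF Y] A.m_comm)
  finally show ?case .
qed simp

end

text \<open>The hypothesis on \<pi> enters through \<open>card_torsion\<close>: for p in \<pi>, the
  \<pi>-part of p is p itself.\<close>

locale prime_fibre_setting = finite_fibre_setting A G K
  for A :: "('a, 'm) monoid_scheme" and G :: "('g, 'n) monoid_scheme" and K :: "'k::field_char_0 itself" +
  fixes p :: nat and c :: 'g
  assumes prime_p: "prime p" and c_in: "c \<in> carrier G" and c_not_one: "c \<noteq> \<one>\<^bsub>G\<^esub>"
    and c_pow_p: "c [^]\<^bsub>G\<^esub> p = \<one>\<^bsub>G\<^esub>" and card_torsion: "card (torsion_subgroup A p) = p"
begin

lemma c_pow_eq_one_iff: "c [^]\<^bsub>G\<^esub> (i::nat) = \<one>\<^bsub>G\<^esub> \<longleftrightarrow> p dvd i"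
proof -
  have "G.ord c dvd p" "G.ord c \<noteq> 1"
    using G.pow_eq_id[OF c_in, of p] c_pow_p G.ord_eq_1[OF c_in] c_not_one by auto
  then have "G.ord c = p" using prime_p by (auto simp: prime_nat_iff)
  then show ?thesis using G.pow_eq_id[OF c_in, of i] by simp
qed

lemma torsion_closed: "z \<in> torsion_subgroup A p \<Longrightarrow> z \<in> carrier A"
  by (simp add: torsion_subgroup_def)

lemma torsion_pow:
  assumes "z \<in> torsion_subgroup A p" "p dvd i"
  shows "z [^]\<^bsub>A\<^esub> (i::nat) = \<one>\<^bsub>A\<^esub>"
proof -
  from assms(2) obtain j where "i = p * j" by (auto simp: dvd_def)
  then show ?thesis using assms(1) by (simp add: torsion_subgroup_def A.nat_pow_pow[symmetric])
qed

lemma finite_torsion: "finite (torsion_subgroup A p)"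
  using card_torsion prime_gt_0_nat[OF prime_p] card_ge_0_finite by metis

text \<open>For z in the p-torsion, (z, c) has order p, so natural exponents already give the whole
  subgroup generated by it.\<close>

definition coset :: "'a \<Rightarrow> 'a \<Rightarrow> 'g \<Rightarrow> ('a \<times> 'g) set" where
  "coset z b g = {(b \<otimes>\<^bsub>A\<^esub> z [^]\<^bsub>A\<^esub> i, g \<otimes>\<^bsub>G\<^esub> c [^]\<^bsub>G\<^esub> i) | i :: nat. True}"

text \<open>For z in the p-torsion, the coset of (1, 1) is stabilized by the triples (z^i, u, v)
  with u v^-1 = c^i. So this is a transitive biset whose subgroup U consists of the (u, v) with u
  v^-1 a power of c; its character on U is determined by z.\<close>

definition quotient_biset :: "'a \<Rightarrow> ('a, 'g, ('a \<times> 'g) set) aset" where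
  "quotient_biset z = ({coset z b g | b g. b \<in> carrier A \<and> g \<in> carrier G},
    \<lambda>(a, u, v). \<lambda>T\<in>{coset z b g | b g. b \<in> carrier A \<and> g \<in> carrier G}.
      (\<lambda>(b, g). (a \<otimes>\<^bsub>A\<^esub> b, u \<otimes>\<^bsub>G\<^esub> g \<otimes>\<^bsub>G\<^esub> inv\<^bsub>G\<^esub> v)) ` T)"

context
  fixes z :: 'a
  assumes z: "z \<in> torsion_subgroup A p"
begin

private lemma zc: "z \<in> carrier A"
  using z by (rule torsion_closed)

lemma coset_eq_iff:
  assumes "b \<in> carrier A" "g \<in> carrier G" "b' \<in> carrier A" "g' \<in> carrier G"
  shows "coset z b g = coset z b' g' \<longleftrightarrow> (\<exists>i::nat. b' = b \<otimes>\<^bsub>A\<^esub> z [^]\<^bsub>A\<^esub> i \<and> g' = g \<otimes>\<^bsub>G\<^esub> c [^]\<^bsub>G\<^esub> i)"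
proof
  assume eq: "coset z b g = coset z b' g'"
  have "(b', g') \<in> coset z b' g'"
    unfolding coset_def mem_Collect_eq using assms by (intro exI[of _ 0]) simp
  then have "(b', g') \<in> coset z b g" by (simp only: eq)
  then show "\<exists>i::nat. b' = b \<otimes>\<^bsub>A\<^esub> z [^]\<^bsub>A\<^esub> i \<and> g' = g \<otimes>\<^bsub>G\<^esub> c [^]\<^bsub>G\<^esub> i"
    by (auto simp: coset_def)
next
  have sub: "coset z (b \<otimes>\<^bsub>A\<^esub> z [^]\<^bsub>A\<^esub> i) (g \<otimes>\<^bsub>G\<^esub> c [^]\<^bsub>G\<^esub> i) \<subseteq> coset z b g"
    if "b \<in> carrier A" "g \<in> carrier G" for b g and i :: nat
  proof
    fix x assume "x \<in> coset z (b \<otimes>\<^bsub>A\<^esub> z [^]\<^bsub>A\<^esub> i) (g \<otimes>\<^bsub>G\<^esub> c [^]\<^bsub>G\<^esub> i)"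
    then obtain j :: nat where "x = (b \<otimes>\<^bsub>A\<^esub> z [^]\<^bsub>A\<^esub> i \<otimes>\<^bsub>A\<^esub> z [^]\<^bsub>A\<^esub> j, g \<otimes>\<^bsub>G\<^esub> c [^]\<^bsub>G\<^esub> i \<otimes>\<^bsub>G\<^esub> c [^]\<^bsub>G\<^esub> j)"
      by (auto simp: coset_def)
    then have "x = (b \<otimes>\<^bsub>A\<^esub> z [^]\<^bsub>A\<^esub> (i + j), g \<otimes>\<^bsub>G\<^esub> c [^]\<^bsub>G\<^esub> (i + j))"
      using that zc c_in by (simp add: A.m_assoc G.m_assoc A.nat_pow_mult G.nat_pow_mult)
    then show "x \<in> coset z b g" unfolding coset_def by blast
  qed
  assume "\<exists>i::nat. b' = b \<otimes>\<^bsub>A\<^esub> z [^]\<^bsub>A\<^esub> i \<and> g' = g \<otimes>\<^bsub>G\<^esub> c [^]\<^bsub>G\<^esub> i"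
  then obtain i :: nat where i: "b' = b \<otimes>\<^bsub>A\<^esub> z [^]\<^bsub>A\<^esub> i" "g' = g \<otimes>\<^bsub>G\<^esub> c [^]\<^bsub>G\<^esub> i" by blast
  \<comment> \<open>Exponents are natural numbers, so (p - 1) * i stands in for -i.\<close>
  have "i + (p - 1) * i = p * i"
    using prime_gt_0_nat[OF prime_p] by (cases p) simp_all
  then have "p dvd i + (p - 1) * i" by simp
  then have "b = b' \<otimes>\<^bsub>A\<^esub> z [^]\<^bsub>A\<^esub> ((p - 1) * i)" "g = g' \<otimes>\<^bsub>G\<^esub> c [^]\<^bsub>G\<^esub> ((p - 1) * i)"
    using assms zc c_in unfolding i
    by (simp_all add: A.m_assoc G.m_assoc A.nat_pow_mult G.nat_pow_mult torsion_pow[OF z] c_pow_eq_one_iff[THEN iffD2])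
  then have "coset z b g \<subseteq> coset z b' g'" using sub[OF assms(3,4), of "(p - 1) * i"] by simp
  moreover have "coset z b' g' \<subseteq> coset z b g" unfolding i by (rule sub[OF assms(1,2)])
  ultimately show "coset z b g = coset z b' g'" by blast
qed

lemma quotient_memI:
  "b \<in> carrier A \<Longrightarrow> g \<in> carrier G \<Longrightarrow> coset z b g \<in> fst (quotient_biset z)"
  by (auto simp: quotient_biset_def)

lemma quotient_memE:
  assumes "T \<in> fst (quotient_biset z)"
  obtains b g where "b \<in> carrier A" "g \<in> carrier G" "T = coset z b g"
  using assms by (auto simp: quotient_biset_def)

lemma quotient_act:
  assumes "b \<in> carrier A" "g \<in> carrier G" "a \<in> carrier A" "u \<in> carrier G" "v \<in> carrier G"
  shows "snd (quotient_biset z) (a, u, v) (coset z b g) = coset z (a \<otimes>\<^bsub>A\<^esub> b) (u \<otimes>\<^bsub>G\<^esub> g \<otimes>\<^bsub>G\<^esub> inv\<^bsub>G\<^esub> v)"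
proof -
  have "coset z b g \<in> {coset z b g | b g. b \<in> carrier A \<and> g \<in> carrier G}" using assms by blast
  then have "snd (quotient_biset z) (a, u, v) (coset z b g) =
    (\<lambda>(b, g). (a \<otimes>\<^bsub>A\<^esub> b, u \<otimes>\<^bsub>G\<^esub> g \<otimes>\<^bsub>G\<^esub> inv\<^bsub>G\<^esub> v)) ` coset z b g"
    by (simp add: quotient_biset_def)
  also have "\<dots> = (\<lambda>i. (a \<otimes>\<^bsub>A\<^esub> (b \<otimes>\<^bsub>A\<^esub> z [^]\<^bsub>A\<^esub> i), u \<otimes>\<^bsub>G\<^esub> (g \<otimes>\<^bsub>G\<^esub> c [^]\<^bsub>G\<^esub> i) \<otimes>\<^bsub>G\<^esub> inv\<^bsub>G\<^esub> v)) ` (UNIV :: nat set)"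
    by (auto simp: coset_def)
  also have "\<dots> = (\<lambda>i. (a \<otimes>\<^bsub>A\<^esub> b \<otimes>\<^bsub>A\<^esub> z [^]\<^bsub>A\<^esub> i, u \<otimes>\<^bsub>G\<^esub> g \<otimes>\<^bsub>G\<^esub> inv\<^bsub>G\<^esub> v \<otimes>\<^bsub>G\<^esub> c [^]\<^bsub>G\<^esub> i)) ` (UNIV :: nat set)"
    using assms zc c_in by (intro image_cong) (simp_all add: A.m_assoc G.m_ac)
  also have "\<dots> = coset z (a \<otimes>\<^bsub>A\<^esub> b) (u \<otimes>\<^bsub>G\<^esub> g \<otimes>\<^bsub>G\<^esub> inv\<^bsub>G\<^esub> v)"
    by (auto simp: coset_def)
  finally show ?thesis .
qed

lemma fibred_quotient: "fibred (quotient_biset z)"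
proof (rule fibred_bisetI)
  let ?Q = "quotient_biset z"
  show "snd ?Q (a, u, v) T \<in> fst ?Q"
    if q: "a \<in> carrier A" "u \<in> carrier G" "v \<in> carrier G" and T: "T \<in> fst ?Q" for a u v T
    using T q by (elim quotient_memE) (simp add: quotient_act quotient_memI)
  show "snd ?Q (a, u, v) \<in> extensional (fst ?Q)" for a u v by (simp add: quotient_biset_def)
  show "snd ?Q (\<one>\<^bsub>A\<^esub>, \<one>\<^bsub>G\<^esub>, \<one>\<^bsub>G\<^esub>) T = T" if "T \<in> fst ?Q" for T
    using that by (elim quotient_memE) (simp add: quotient_act)
  show "snd ?Q (a, u, v) (snd ?Q (b, s, t) T) = snd ?Q (a \<otimes>\<^bsub>A\<^esub> b, u \<otimes>\<^bsub>G\<^esub> s, v \<otimes>\<^bsub>G\<^esub> t) T"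
    if q: "a \<in> carrier A" "u \<in> carrier G" "v \<in> carrier G" "b \<in> carrier A" "s \<in> carrier G" "t \<in> carrier G"
      and T: "T \<in> fst ?Q" for a u v b s t T
    using T q by (elim quotient_memE) (simp add: quotient_act A.m_assoc G.m_ac G.inv_mult)
  show "a = \<one>\<^bsub>A\<^esub>" if a: "a \<in> carrier A" and T: "T \<in> fst ?Q" and fixed: "snd ?Q (a, \<one>\<^bsub>G\<^esub>, \<one>\<^bsub>G\<^esub>) T = T" for a T
  proof -
    obtain b g where bg: "b \<in> carrier A" "g \<in> carrier G" "T = coset z b g"
      using T by (rule quotient_memE)
    then obtain i :: nat where i: "b = a \<otimes>\<^bsub>A\<^esub> b \<otimes>\<^bsub>A\<^esub> z [^]\<^bsub>A\<^esub> i" "g = g \<otimes>\<^bsub>G\<^esub> c [^]\<^bsub>G\<^esub> i"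
      using fixed a by (auto simp: quotient_act coset_eq_iff)
    \<comment> \<open>Now p divides i, so z^i = 1 as well: the torsion condition on z is what keeps
      A free on the quotient.\<close>
    then have "c [^]\<^bsub>G\<^esub> i = \<one>\<^bsub>G\<^esub>" using bg c_in by (metis G.l_cancel_one' G.nat_pow_closed)
    then have "z [^]\<^bsub>A\<^esub> i = \<one>\<^bsub>A\<^esub>" using torsion_pow[OF z] c_pow_eq_one_iff by blast
    with i(1) a bg have "b = a \<otimes>\<^bsub>A\<^esub> b" by simp
    then show ?thesis using a bg by simp
  qed
  show "finite (fibre_orbit ?Q ` fst ?Q)"
  proof -
    have "fibre_orbit ?Q T \<in> (\<lambda>g. {coset z b g | b. b \<in> carrier A}) ` carrier G" if T: "T \<in> fst ?Q" for T
    proof -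
      obtain b g where bg: "b \<in> carrier A" "g \<in> carrier G" "T = coset z b g"
        using T by (rule quotient_memE)
      have "fibre_orbit ?Q T = {coset z b g | b. b \<in> carrier A}"
      proof (intro equalityI subsetI)
        fix x assume "x \<in> {coset z b g | b. b \<in> carrier A}"
        then obtain b' where "b' \<in> carrier A" "x = coset z b' g" by blast
        then have "x = snd ?Q (b' \<otimes>\<^bsub>A\<^esub> inv\<^bsub>A\<^esub> b, \<one>\<^bsub>G\<^esub>, \<one>\<^bsub>G\<^esub>) T" "b' \<otimes>\<^bsub>A\<^esub> inv\<^bsub>A\<^esub> b \<in> carrier A"
          using bg by (simp_all add: quotient_act A.m_assoc)
        then show "x \<in> fibre_orbit ?Q T" unfolding fibre_orbit_def by blast
      next
        fix x assume "x \<in> fibre_orbit ?Q T"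
        then obtain a where "a \<in> carrier A" "x = coset z (a \<otimes>\<^bsub>A\<^esub> b) g"
          using bg by (auto simp: fibre_orbit_def quotient_act)
        then show "x \<in> {coset z b g | b. b \<in> carrier A}" using bg by blast
      qed
      then show ?thesis using bg by blast
    qed
    then have "fibre_orbit ?Q ` fst ?Q \<subseteq> (\<lambda>g. {coset z b g | b. b \<in> carrier A}) ` carrier G"
      by (rule image_subsetI)
    then show ?thesis by (rule finite_subset) (simp add: finite_G)
  qed
qed

end

section \<open>Orbits of A together with the powers of c\<close>

text \<open>For a fibred \<open>Y\<close>, a block is a union of A-orbits that the powers of c
  permute transitively, hence of 1 or p of them.\<close>

definition block :: "('a, 'g, 'y) aset \<Rightarrow> 'y \<Rightarrow> 'y set" where
  "block Y y = {snd Y (a, c [^]\<^bsub>G\<^esub> i, \<one>\<^bsub>G\<^esub>) y | a (i::nat). a \<in> carrier A}"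

text \<open>\<open>A\<close> acts freely at the class of \<open>y\<close> in the quotient of \<open>Y\<close> by the group generated by \<open>(z, c, 1)\<close>.\<close>

definition compatible :: "('a, 'g, 'y) aset \<Rightarrow> 'a \<Rightarrow> 'y \<Rightarrow> bool" where
  "compatible Y z y \<longleftrightarrow> (\<forall>a\<in>carrier A. \<forall>i::nat.
    y = snd Y (a \<otimes>\<^bsub>A\<^esub> z [^]\<^bsub>A\<^esub> i, c [^]\<^bsub>G\<^esub> i, \<one>\<^bsub>G\<^esub>) y \<longrightarrow> a = \<one>\<^bsub>A\<^esub>)"

context
  fixes Y :: "('a, 'g, 'y) aset"
  assumes Y: "fibred Y"
begin

private lemmas simps = act_closed[OF Y] act_act[OF Y] act_one[OF Y] c_in

lemma block_self: "y \<in> fst Y \<Longrightarrow> y \<in> block Y y"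
  unfolding block_def mem_Collect_eq
  by (intro exI[of _ "\<one>\<^bsub>A\<^esub>"] exI[of _ 0]) (simp add: simps)

lemma block_subset: "y \<in> fst Y \<Longrightarrow> block Y y \<subseteq> fst Y"
  by (auto simp: block_def simps)

lemma block_eqI:
  assumes y: "y \<in> fst Y" and y': "y' \<in> block Y y"
  shows "block Y y' = block Y y"
proof -
  have sub: "block Y y' \<subseteq> block Y y" if y: "y \<in> fst Y" and y': "y' \<in> block Y y" for y y'
  proof
    fix x assume x: "x \<in> block Y y'"
    from y' obtain a and i :: nat where ai: "a \<in> carrier A" "y' = snd Y (a, c [^]\<^bsub>G\<^esub> i, \<one>\<^bsub>G\<^esub>) y"
      by (auto simp: block_def)
    from x obtain b and j :: nat where bj: "b \<in> carrier A" "x = snd Y (b, c [^]\<^bsub>G\<^esub> j, \<one>\<^bsub>G\<^esub>) y'"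
      by (auto simp: block_def)
    have "x = snd Y (b \<otimes>\<^bsub>A\<^esub> a, c [^]\<^bsub>G\<^esub> (j + i), \<one>\<^bsub>G\<^esub>) y"
      using ai bj y by (simp add: simps G.nat_pow_mult)
    then show "x \<in> block Y y" using ai bj unfolding block_def by blast
  qed
  from y' obtain a and i :: nat where ai: "a \<in> carrier A" "y' = snd Y (a, c [^]\<^bsub>G\<^esub> i, \<one>\<^bsub>G\<^esub>) y"
    by (auto simp: block_def)
  have "(p - 1) * i + i = p * i"
    using prime_gt_0_nat[OF prime_p] by (cases p) simp_all
  then have "p dvd (p - 1) * i + i" by simp
  then have "y = snd Y (inv\<^bsub>A\<^esub> a, c [^]\<^bsub>G\<^esub> ((p - 1) * i), \<one>\<^bsub>G\<^esub>) y'"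
    using ai y by (simp add: simps G.nat_pow_mult c_pow_eq_one_iff[THEN iffD2])
  then have "y \<in> block Y y'" using ai(1) unfolding block_def by blast
  moreover have "y' \<in> fst Y" using y y' block_subset by blast
  ultimately show ?thesis using sub[OF y y'] sub[of y' y] by blast
qed

lemma block_eq_iff:
  assumes "y \<in> fst Y" "y' \<in> fst Y"
  shows "block Y y = block Y y' \<longleftrightarrow> (\<exists>a\<in>carrier A. \<exists>i::nat. y' = snd Y (a, c [^]\<^bsub>G\<^esub> i, \<one>\<^bsub>G\<^esub>) y)"
proof -
  have "block Y y = block Y y' \<longleftrightarrow> y' \<in> block Y y"
    using block_self[OF assms(2)] block_eqI[OF assms(1), of y'] by blast
  then show ?thesis by (auto simp: block_def)
qed

text \<open>Compatibility is a condition on the stabilizer of y, and in an action of an abelian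
  group stabilizers are constant along orbits.\<close>

lemma compatible_block:
  assumes y: "y \<in> fst Y" and y': "y' \<in> fst Y" and eq: "block Y y = block Y y'" and z: "z \<in> carrier A"
  shows "compatible Y z y \<longleftrightarrow> compatible Y z y'"
proof -
  have *: "compatible Y z y" if "compatible Y z y'" and y: "y \<in> fst Y" and y': "y' \<in> fst Y"
    and eq: "block Y y = block Y y'" for y y'
    unfolding compatible_def
  proof (intro ballI allI impI)
    fix b and j :: nat assume bj: "b \<in> carrier A" "y = snd Y (b \<otimes>\<^bsub>A\<^esub> z [^]\<^bsub>A\<^esub> j, c [^]\<^bsub>G\<^esub> j, \<one>\<^bsub>G\<^esub>) y"
    obtain a and i :: nat where ai: "a \<in> carrier A" "y' = snd Y (a, c [^]\<^bsub>G\<^esub> i, \<one>\<^bsub>G\<^esub>) y"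
      using eq block_eq_iff[OF y y'] by blast
    have "y' = snd Y (a, c [^]\<^bsub>G\<^esub> i, \<one>\<^bsub>G\<^esub>) (snd Y (b \<otimes>\<^bsub>A\<^esub> z [^]\<^bsub>A\<^esub> j, c [^]\<^bsub>G\<^esub> j, \<one>\<^bsub>G\<^esub>) y)"
      using ai(2) bj(2)[symmetric] by simp
    also have "\<dots> = snd Y (b \<otimes>\<^bsub>A\<^esub> z [^]\<^bsub>A\<^esub> j, c [^]\<^bsub>G\<^esub> j, \<one>\<^bsub>G\<^esub>) y'"
      unfolding ai(2) using ai(1) bj(1) y z by (simp add: simps A.m_comm G.m_comm)
    finally show "b = \<one>\<^bsub>A\<^esub>" using \<open>compatible Y z y'\<close> bj(1) by (auto simp: compatible_def)
  qed
  show ?thesis using *[OF _ y y' eq] *[OF _ y' y eq[symmetric]] by blast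
qed

text \<open>Tensoring with Q_z divides Y by the group generated by (z, c, 1) and keeps the classes
  at which A is free. Indeed each class has the form o \<otimes> y with o the coset of (1, 1), and o
  \<otimes> y = o \<otimes> y' holds iff y' is a translate of y by that group. Dividing by A as well
  leaves blocks: they do not depend on z, in contrast to compatibility.\<close>

lemma card_orbits_tensor_quotient:
  assumes z: "z \<in> torsion_subgroup A p"
  shows "card (fibre_orbit (tensor A G (quotient_biset z) Y) ` fst (tensor A G (quotient_biset z) Y)) =
    card (block Y ` {y \<in> fst Y. compatible Y z y})"
proof -
  let ?Q = "quotient_biset z" and ?o = "coset z \<one>\<^bsub>A\<^esub> \<one>\<^bsub>G\<^esub>"
  let ?T = "tensor A G ?Q Y"
  note Q = fibred_quotient[OF z]
  have zc: "z \<in> carrier A" using z by (rule torsion_closed)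
  note simps = simps zc
  have o: "?o \<in> fst ?Q" by (rule quotient_memI[OF z]) simp_all
  have cls: "cls ?Q Y ?o y = cls ?Q Y ?o y' \<longleftrightarrow> (\<exists>i::nat. y' = snd Y (z [^]\<^bsub>A\<^esub> i, c [^]\<^bsub>G\<^esub> i, \<one>\<^bsub>G\<^esub>) y)"
    if "y \<in> fst Y" "y' \<in> fst Y" for y y'
  proof -
    have "cls ?Q Y ?o y = cls ?Q Y ?o y' \<longleftrightarrow> (\<exists>a\<in>carrier A. \<exists>g\<in>carrier G.
        coset z (inv\<^bsub>A\<^esub> a) (inv\<^bsub>G\<^esub> g) = ?o \<and> y' = snd Y (a, g, \<one>\<^bsub>G\<^esub>) y)"
      using that o by (simp add: cls_eq_iff[OF Q Y] quotient_act[OF z] eq_commute[of ?o] cong: conj_cong)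
    also have "\<dots> \<longleftrightarrow> (\<exists>a\<in>carrier A. \<exists>g\<in>carrier G.
        (\<exists>i::nat. z [^]\<^bsub>A\<^esub> i = a \<and> c [^]\<^bsub>G\<^esub> i = g) \<and> y' = snd Y (a, g, \<one>\<^bsub>G\<^esub>) y)"
      using zc c_in by (simp add: coset_eq_iff[OF z] A.inv_solve_left G.inv_solve_left cong: conj_cong)
    also have "\<dots> \<longleftrightarrow> (\<exists>i::nat. y' = snd Y (z [^]\<^bsub>A\<^esub> i, c [^]\<^bsub>G\<^esub> i, \<one>\<^bsub>G\<^esub>) y)"
      using zc c_in by auto
    finally show ?thesis .
  qed
  have shift: "cls ?Q Y (snd ?Q (a, \<one>\<^bsub>G\<^esub>, \<one>\<^bsub>G\<^esub>) ?o) y = cls ?Q Y ?o (snd Y (a, \<one>\<^bsub>G\<^esub>, \<one>\<^bsub>G\<^esub>) y)"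
    if "a \<in> carrier A" "y \<in> fst Y" for a y
    using cls_shift[OF Q Y o that(2,1), of "\<one>\<^bsub>G\<^esub>"] by simp
  have good: "good ?Q Y ?o y \<longleftrightarrow> compatible Y z y" if "y \<in> fst Y" for y
    unfolding good_def compatible_def using that
    by (simp add: shift cls simps A.m_comm)
  have fst: "fst ?T = cls ?Q Y ?o ` {y \<in> fst Y. compatible Y z y}"
  proof (intro equalityI subsetI)
    fix t assume "t \<in> fst ?T"
    then obtain x y where t: "t = cls ?Q Y x y" "x \<in> fst ?Q" "y \<in> fst Y" "good ?Q Y x y"
      by (rule tensor_memE[OF Q Y])
    obtain b g where bg: "b \<in> carrier A" "g \<in> carrier G" "x = coset z b g"
      using t(2) by (rule quotient_memE[OF z])
    have "t = cls ?Q Y ?o (snd Y (b, g, \<one>\<^bsub>G\<^esub>) y)"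
      using cls_shift[OF Q Y o t(3), of b "inv\<^bsub>G\<^esub> g"] bg t by (simp add: quotient_act[OF z])
    moreover from this have "compatible Y z (snd Y (b, g, \<one>\<^bsub>G\<^esub>) y)"
      using good_cls_cong[OF Q Y t(2,3) o, of "snd Y (b, g, \<one>\<^bsub>G\<^esub>) y"] good t bg by (simp add: simps)
    ultimately show "t \<in> cls ?Q Y ?o ` {y \<in> fst Y. compatible Y z y}"
      using bg t by (simp add: simps)
  next
    fix t assume "t \<in> cls ?Q Y ?o ` {y \<in> fst Y. compatible Y z y}"
    then show "t \<in> fst ?T" using good by (auto intro!: tensor_memI[OF Q Y] o)
  qed
  have "fibre_orbit ?T (cls ?Q Y ?o y) = fibre_orbit ?T (cls ?Q Y ?o y') \<longleftrightarrow> block Y y = block Y y'"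
    if "y \<in> {y \<in> fst Y. compatible Y z y}" "y' \<in> {y \<in> fst Y. compatible Y z y}" for y y'
  proof -
    from that have y: "y \<in> fst Y" "good ?Q Y ?o y" and y': "y' \<in> fst Y" "good ?Q Y ?o y'"
      using good by auto
    have "fibre_orbit ?T (cls ?Q Y ?o y) = fibre_orbit ?T (cls ?Q Y ?o y') \<longleftrightarrow>
      (\<exists>a\<in>carrier A. cls ?Q Y ?o y' = cls ?Q Y ?o (snd Y (a, \<one>\<^bsub>G\<^esub>, \<one>\<^bsub>G\<^esub>) y))"
      using y y' o
      by (simp add: fibre_orbit_eq_iff[OF fibred_tensor[OF Q Y]] tensor_memI[OF Q Y] tensor_act[OF Q Y] shift simps)
    also have "\<dots> \<longleftrightarrow> (\<exists>a\<in>carrier A. \<exists>i::nat. y' = snd Y (z [^]\<^bsub>A\<^esub> i \<otimes>\<^bsub>A\<^esub> a, c [^]\<^bsub>G\<^esub> i, \<one>\<^bsub>G\<^esub>) y)"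
      using y y' by (simp add: eq_commute[of "cls ?Q Y ?o y'"] cls simps cong: bex_cong)
    also have "\<dots> \<longleftrightarrow> (\<exists>a\<in>carrier A. \<exists>i::nat. y' = snd Y (a, c [^]\<^bsub>G\<^esub> i, \<one>\<^bsub>G\<^esub>) y)"
    proof
      assume "\<exists>a\<in>carrier A. \<exists>i::nat. y' = snd Y (z [^]\<^bsub>A\<^esub> i \<otimes>\<^bsub>A\<^esub> a, c [^]\<^bsub>G\<^esub> i, \<one>\<^bsub>G\<^esub>) y"
      then show "\<exists>a\<in>carrier A. \<exists>i::nat. y' = snd Y (a, c [^]\<^bsub>G\<^esub> i, \<one>\<^bsub>G\<^esub>) y"
        using zc by blast
    next
      assume "\<exists>a\<in>carrier A. \<exists>i::nat. y' = snd Y (a, c [^]\<^bsub>G\<^esub> i, \<one>\<^bsub>G\<^esub>) y"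
      then obtain a and i :: nat where "a \<in> carrier A" "y' = snd Y (a, c [^]\<^bsub>G\<^esub> i, \<one>\<^bsub>G\<^esub>) y" by blast
      then show "\<exists>a\<in>carrier A. \<exists>i::nat. y' = snd Y (z [^]\<^bsub>A\<^esub> i \<otimes>\<^bsub>A\<^esub> a, c [^]\<^bsub>G\<^esub> i, \<one>\<^bsub>G\<^esub>) y"
        using zc by (intro bexI[of _ "inv\<^bsub>A\<^esub> (z [^]\<^bsub>A\<^esub> i) \<otimes>\<^bsub>A\<^esub> a"] exI[of _ i])
          (simp_all add: A.m_assoc[symmetric])
    qed
    finally show ?thesis using block_eq_iff y y' by simp
  qed
  then show ?thesis unfolding fst image_image by (rule card_image_cong)
qed

text \<open>The local balance of the count. If c y = a y for a scalar a, then c^p = 1 and freeness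
  give a^p = 1. Dividing by (z, c) identifies y with z a y, so A stays free exactly for z = a^-1,
  and the block is a single A-orbit. Otherwise c^i preserves the A-orbit of y just for p dividing i;
  then all p elements z are compatible, and the block consists of p A-orbits.\<close>

lemma card_compatible:
  assumes y: "y \<in> fst Y"
  shows "card {z \<in> torsion_subgroup A p. compatible Y z y} = card (fibre_orbit Y ` block Y y)"
proof (cases "\<exists>a\<in>carrier A. snd Y (\<one>\<^bsub>A\<^esub>, c, \<one>\<^bsub>G\<^esub>) y = snd Y (a, \<one>\<^bsub>G\<^esub>, \<one>\<^bsub>G\<^esub>) y")
  case True
  then obtain a where a: "a \<in> carrier A" "snd Y (\<one>\<^bsub>A\<^esub>, c, \<one>\<^bsub>G\<^esub>) y = snd Y (a, \<one>\<^bsub>G\<^esub>, \<one>\<^bsub>G\<^esub>) y" by blast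
  note pow = act_power[OF Y y a(1) c_in a(2)]
  have pow': "snd Y (b, c [^]\<^bsub>G\<^esub> i, \<one>\<^bsub>G\<^esub>) y = snd Y (b \<otimes>\<^bsub>A\<^esub> a [^]\<^bsub>A\<^esub> i, \<one>\<^bsub>G\<^esub>, \<one>\<^bsub>G\<^esub>) y"
    if "b \<in> carrier A" for b and i :: nat
  proof -
    have "snd Y (b, c [^]\<^bsub>G\<^esub> i, \<one>\<^bsub>G\<^esub>) y = snd Y (b, \<one>\<^bsub>G\<^esub>, \<one>\<^bsub>G\<^esub>) (snd Y (\<one>\<^bsub>A\<^esub>, c [^]\<^bsub>G\<^esub> i, \<one>\<^bsub>G\<^esub>) y)"
      using that y by (simp add: simps)
    then show ?thesis unfolding pow using that y a by (simp add: simps)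
  qed
  have fix_iff: "y = snd Y (b, \<one>\<^bsub>G\<^esub>, \<one>\<^bsub>G\<^esub>) y \<longleftrightarrow> b = \<one>\<^bsub>A\<^esub>" if "b \<in> carrier A" for b
    using act_free[OF Y y that] act_one[OF Y y] by auto
  have "a [^]\<^bsub>A\<^esub> p = \<one>\<^bsub>A\<^esub>"
    using pow[of p] fix_iff[of "a [^]\<^bsub>A\<^esub> p"] a y by (simp add: c_pow_p simps)
  then have ia: "inv\<^bsub>A\<^esub> a \<in> torsion_subgroup A p"
    using a by (simp add: torsion_subgroup_def A.nat_pow_inv)
  have "compatible Y z y \<longleftrightarrow> z = inv\<^bsub>A\<^esub> a" if "z \<in> torsion_subgroup A p" for z
  proof
    have zc: "z \<in> carrier A" using that by (rule torsion_closed)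
    {
      assume "compatible Y z y"
      \<comment> \<open>(z, c) moves y by the scalar z a, so its inverse is the scalar to test
        compatibility with, at exponent 1.\<close>
      moreover have "y = snd Y (inv\<^bsub>A\<^esub> (z \<otimes>\<^bsub>A\<^esub> a) \<otimes>\<^bsub>A\<^esub> z [^]\<^bsub>A\<^esub> (1::nat), c [^]\<^bsub>G\<^esub> (1::nat), \<one>\<^bsub>G\<^esub>) y"
        using zc a y pow'[of "inv\<^bsub>A\<^esub> (z \<otimes>\<^bsub>A\<^esub> a) \<otimes>\<^bsub>A\<^esub> z" 1] by (simp add: A.m_assoc simps)
      ultimately have "inv\<^bsub>A\<^esub> (z \<otimes>\<^bsub>A\<^esub> a) = \<one>\<^bsub>A\<^esub>"
        using zc a unfolding compatible_def by blast
      then have "z \<otimes>\<^bsub>A\<^esub> a = \<one>\<^bsub>A\<^esub>" using zc a by (metis A.inv_inv A.inv_one A.m_closed)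
      then show "z = inv\<^bsub>A\<^esub> a" using zc a by (simp add: A.inv_equality)
    }
    {
      assume z: "z = inv\<^bsub>A\<^esub> a"
      show "compatible Y z y"
        unfolding compatible_def
      proof (intro ballI allI impI)
        fix b and i :: nat assume b: "b \<in> carrier A" "y = snd Y (b \<otimes>\<^bsub>A\<^esub> z [^]\<^bsub>A\<^esub> i, c [^]\<^bsub>G\<^esub> i, \<one>\<^bsub>G\<^esub>) y"
        have "z [^]\<^bsub>A\<^esub> i \<otimes>\<^bsub>A\<^esub> a [^]\<^bsub>A\<^esub> i = \<one>\<^bsub>A\<^esub>"
          unfolding z using a by (simp add: A.nat_pow_inv)
        then have "y = snd Y (b, \<one>\<^bsub>G\<^esub>, \<one>\<^bsub>G\<^esub>) y"
          using b(2) pow'[of "b \<otimes>\<^bsub>A\<^esub> z [^]\<^bsub>A\<^esub> i" i] b(1) a zc by (simp add: A.m_assoc)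
        then show "b = \<one>\<^bsub>A\<^esub>" using fix_iff b(1) by blast
      qed
    }
  qed
  then have "{z \<in> torsion_subgroup A p. compatible Y z y} = {inv\<^bsub>A\<^esub> a}" using ia by auto
  moreover have "fibre_orbit Y ` block Y y = {fibre_orbit Y y}"
  proof -
    have "fibre_orbit Y x = fibre_orbit Y y" if x: "x \<in> block Y y" for x
    proof -
      obtain b and i :: nat where "b \<in> carrier A" "x = snd Y (b, c [^]\<^bsub>G\<^esub> i, \<one>\<^bsub>G\<^esub>) y"
        using x by (auto simp: block_def)
      then have "x = snd Y (b \<otimes>\<^bsub>A\<^esub> a [^]\<^bsub>A\<^esub> i, \<one>\<^bsub>G\<^esub>, \<one>\<^bsub>G\<^esub>) y" "b \<otimes>\<^bsub>A\<^esub> a [^]\<^bsub>A\<^esub> i \<in> carrier A"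
        using pow' a by simp_all
      then show ?thesis
        using fibre_orbit_eq_iff[OF Y y, of x] x block_subset[OF y] by blast
    qed
    then show ?thesis using block_self[OF y] by blast
  qed
  ultimately show ?thesis by simp
next
  case False
  have dvd: "p dvd i"
    if eq: "snd Y (\<one>\<^bsub>A\<^esub>, c [^]\<^bsub>G\<^esub> i, \<one>\<^bsub>G\<^esub>) y = snd Y (b, \<one>\<^bsub>G\<^esub>, \<one>\<^bsub>G\<^esub>) y" and b: "b \<in> carrier A" for i :: nat and b
  proof (rule ccontr)
    assume "\<not> p dvd i"
    then have "coprime i p" using prime_imp_coprime[OF prime_p] by (simp add: coprime_commute)
    moreover have "i \<noteq> 0" using \<open>\<not> p dvd i\<close> by (cases "i = 0") simp_all
    \<comment> \<open>With i j = 1 modulo p, c is a power of c^i, so if c^i acted on y by a scalar,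
      c would too.\<close>
    ultimately obtain j k where ij: "i * j = p * k + 1" using bezout_nat[of i p] by auto
    have "c [^]\<^bsub>G\<^esub> (i * j) = c"
    proof -
      have "c [^]\<^bsub>G\<^esub> (p * k + 1) = c [^]\<^bsub>G\<^esub> (p * k) \<otimes>\<^bsub>G\<^esub> c"
        using c_in by (simp add: G.nat_pow_mult[symmetric])
      also have "\<dots> = c" using c_in by (simp add: c_pow_eq_one_iff[THEN iffD2])
      finally show ?thesis using ij by simp
    qed
    then have "snd Y (\<one>\<^bsub>A\<^esub>, c, \<one>\<^bsub>G\<^esub>) y = snd Y (b [^]\<^bsub>A\<^esub> j, \<one>\<^bsub>G\<^esub>, \<one>\<^bsub>G\<^esub>) y"
      using act_power[OF Y y b _ eq, of j] c_in by (simp add: G.nat_pow_pow)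
    then show False using False b by blast
  qed
  have "compatible Y z y" if z: "z \<in> torsion_subgroup A p" for z
    unfolding compatible_def
  proof (intro ballI allI impI)
    have zc: "z \<in> carrier A" using z by (rule torsion_closed)
    fix b and i :: nat assume b: "b \<in> carrier A" "y = snd Y (b \<otimes>\<^bsub>A\<^esub> z [^]\<^bsub>A\<^esub> i, c [^]\<^bsub>G\<^esub> i, \<one>\<^bsub>G\<^esub>) y"
    have "snd Y (inv\<^bsub>A\<^esub> (b \<otimes>\<^bsub>A\<^esub> z [^]\<^bsub>A\<^esub> i), \<one>\<^bsub>G\<^esub>, \<one>\<^bsub>G\<^esub>) y =
      snd Y (inv\<^bsub>A\<^esub> (b \<otimes>\<^bsub>A\<^esub> z [^]\<^bsub>A\<^esub> i), \<one>\<^bsub>G\<^esub>, \<one>\<^bsub>G\<^esub>) (snd Y (b \<otimes>\<^bsub>A\<^esub> z [^]\<^bsub>A\<^esub> i, c [^]\<^bsub>G\<^esub> i, \<one>\<^bsub>G\<^esub>) y)"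
      using b(2) by simp
    also have "\<dots> = snd Y (\<one>\<^bsub>A\<^esub>, c [^]\<^bsub>G\<^esub> i, \<one>\<^bsub>G\<^esub>) y"
      using b(1) zc y by (simp add: act_act[OF Y] c_in del: A.inv_mult_group)
    finally have "p dvd i" using dvd[of i "inv\<^bsub>A\<^esub> (b \<otimes>\<^bsub>A\<^esub> z [^]\<^bsub>A\<^esub> i)"] b(1) zc by simp
    then have "y = snd Y (b, \<one>\<^bsub>G\<^esub>, \<one>\<^bsub>G\<^esub>) y"
      using b z zc by (simp add: torsion_pow c_pow_eq_one_iff[THEN iffD2])
    then show "b = \<one>\<^bsub>A\<^esub>" using act_free[OF Y y b(1)] by simp
  qed
  then have "{z \<in> torsion_subgroup A p. compatible Y z y} = torsion_subgroup A p" by blast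
  then have "card {z \<in> torsion_subgroup A p. compatible Y z y} = p" by (simp add: card_torsion)
  moreover have "fibre_orbit Y ` block Y y = (\<lambda>i. fibre_orbit Y (snd Y (\<one>\<^bsub>A\<^esub>, c [^]\<^bsub>G\<^esub> i, \<one>\<^bsub>G\<^esub>) y)) ` {..<p}"
  proof (intro equalityI subsetI)
    fix W assume "W \<in> fibre_orbit Y ` block Y y"
    then obtain b and i :: nat where b: "b \<in> carrier A" "W = fibre_orbit Y (snd Y (b, c [^]\<^bsub>G\<^esub> i, \<one>\<^bsub>G\<^esub>) y)"
      by (auto simp: block_def)
    have ci: "c [^]\<^bsub>G\<^esub> i = c [^]\<^bsub>G\<^esub> (i mod p)"
    proof -
      have "c [^]\<^bsub>G\<^esub> i = c [^]\<^bsub>G\<^esub> (p * (i div p)) \<otimes>\<^bsub>G\<^esub> c [^]\<^bsub>G\<^esub> (i mod p)"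
        using c_in by (simp add: G.nat_pow_mult)
      then show ?thesis using c_in by (simp add: c_pow_eq_one_iff[THEN iffD2])
    qed
    have "snd Y (b, c [^]\<^bsub>G\<^esub> i, \<one>\<^bsub>G\<^esub>) y = snd Y (b, \<one>\<^bsub>G\<^esub>, \<one>\<^bsub>G\<^esub>) (snd Y (\<one>\<^bsub>A\<^esub>, c [^]\<^bsub>G\<^esub> (i mod p), \<one>\<^bsub>G\<^esub>) y)"
      using b y by (simp add: ci simps)
    then have "W = fibre_orbit Y (snd Y (\<one>\<^bsub>A\<^esub>, c [^]\<^bsub>G\<^esub> (i mod p), \<one>\<^bsub>G\<^esub>) y)"
      unfolding b(2) using b(1) y by (subst eq_commute, subst fibre_orbit_eq_iff[OF Y]) (auto simp: simps)
    then show "W \<in> (\<lambda>i. fibre_orbit Y (snd Y (\<one>\<^bsub>A\<^esub>, c [^]\<^bsub>G\<^esub> i, \<one>\<^bsub>G\<^esub>) y)) ` {..<p}"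
      using prime_gt_0_nat[OF prime_p] by auto
  next
    fix W assume "W \<in> (\<lambda>i. fibre_orbit Y (snd Y (\<one>\<^bsub>A\<^esub>, c [^]\<^bsub>G\<^esub> i, \<one>\<^bsub>G\<^esub>) y)) ` {..<p}"
    then show "W \<in> fibre_orbit Y ` block Y y" unfolding block_def by blast
  qed
  moreover have "inj_on (\<lambda>i. fibre_orbit Y (snd Y (\<one>\<^bsub>A\<^esub>, c [^]\<^bsub>G\<^esub> i, \<one>\<^bsub>G\<^esub>) y)) {..<p}"
  proof (rule linorder_inj_onI')
    fix i j assume ij: "i \<in> {..<p}" "j \<in> {..<p}" "i < j"
    show "fibre_orbit Y (snd Y (\<one>\<^bsub>A\<^esub>, c [^]\<^bsub>G\<^esub> i, \<one>\<^bsub>G\<^esub>) y) \<noteq> fibre_orbit Y (snd Y (\<one>\<^bsub>A\<^esub>, c [^]\<^bsub>G\<^esub> j, \<one>\<^bsub>G\<^esub>) y)"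
    proof
      assume "fibre_orbit Y (snd Y (\<one>\<^bsub>A\<^esub>, c [^]\<^bsub>G\<^esub> i, \<one>\<^bsub>G\<^esub>) y) = fibre_orbit Y (snd Y (\<one>\<^bsub>A\<^esub>, c [^]\<^bsub>G\<^esub> j, \<one>\<^bsub>G\<^esub>) y)"
      then obtain a where a: "a \<in> carrier A"
        "snd Y (\<one>\<^bsub>A\<^esub>, c [^]\<^bsub>G\<^esub> j, \<one>\<^bsub>G\<^esub>) y = snd Y (a, \<one>\<^bsub>G\<^esub>, \<one>\<^bsub>G\<^esub>) (snd Y (\<one>\<^bsub>A\<^esub>, c [^]\<^bsub>G\<^esub> i, \<one>\<^bsub>G\<^esub>) y)"
        using y by (auto simp: fibre_orbit_eq_iff[OF Y] simps)
      \<comment> \<open>c^(p - i) cancels c^i with a natural exponent, and i < j makes p - i + j = p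
        + (j - i), where 0 < j - i < p.\<close>
      have "snd Y (\<one>\<^bsub>A\<^esub>, c [^]\<^bsub>G\<^esub> (p - i), \<one>\<^bsub>G\<^esub>) (snd Y (\<one>\<^bsub>A\<^esub>, c [^]\<^bsub>G\<^esub> j, \<one>\<^bsub>G\<^esub>) y) =
        snd Y (\<one>\<^bsub>A\<^esub>, c [^]\<^bsub>G\<^esub> (p - i), \<one>\<^bsub>G\<^esub>) (snd Y (a, \<one>\<^bsub>G\<^esub>, \<one>\<^bsub>G\<^esub>) (snd Y (\<one>\<^bsub>A\<^esub>, c [^]\<^bsub>G\<^esub> i, \<one>\<^bsub>G\<^esub>) y))"
        using a(2) by simp
      then have "snd Y (\<one>\<^bsub>A\<^esub>, c [^]\<^bsub>G\<^esub> (p - i + j), \<one>\<^bsub>G\<^esub>) y = snd Y (a, \<one>\<^bsub>G\<^esub>, \<one>\<^bsub>G\<^esub>) y"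
        using a(1) y ij by (simp add: simps G.nat_pow_mult c_pow_p)
      then have "p dvd p - i + j" using dvd a(1) by blast
      moreover have "p - i + j = p + (j - i)" using ij by auto
      ultimately have "p dvd j - i" by simp
      then show False using ij by (auto dest: dvd_imp_le)
    qed
  qed
  ultimately show ?thesis by (simp add: card_image)
qed

text \<open>Double counting of pairs of an element z and a block compatible with it. For fixed z,
  such blocks number the A-orbits of Q_z \<otimes> Y; for a fixed block, such z number the A-orbits
  inside it, and the blocks partition the A-orbits of Y.\<close>

lemma sum_card_orbits:
  "(\<Sum>z\<in>torsion_subgroup A p.
     card (fibre_orbit (tensor A G (quotient_biset z) Y) ` fst (tensor A G (quotient_biset z) Y))) =
   card (fibre_orbit Y ` fst Y)"
proof -
  let ?B = "block Y ` fst Y" and ?T = "torsion_subgroup A p"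
  have "finite (fibre_orbit Y ` fst Y)"
    using finite_fibre_orbits[OF Y] by (simp add: fibre_orbits_eq)
  \<comment> \<open>A block depends only on the A-orbit of its point; writing it as a function of
    that orbit shows that there are finitely many blocks.\<close>
  moreover have "block Y y = (\<Union>x\<in>fibre_orbit Y y. block Y x)" if "y \<in> fst Y" for y
  proof -
    have "block Y x = block Y y" if x: "x \<in> fibre_orbit Y y" for x
    proof (rule block_eqI[OF \<open>y \<in> fst Y\<close>])
      obtain a where "a \<in> carrier A" "x = snd Y (a, \<one>\<^bsub>G\<^esub>, \<one>\<^bsub>G\<^esub>) y"
        using x by (auto simp: fibre_orbit_def)
      then show "x \<in> block Y y"
        unfolding block_def mem_Collect_eq by (intro exI[of _ a] exI[of _ 0]) simp
    qed
    then have "(\<Union>x\<in>fibre_orbit Y y. block Y x) = (\<Union>x\<in>fibre_orbit Y y. block Y y)"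
      by (intro SUP_cong refl)
    moreover have "fibre_orbit Y y \<noteq> {}" using fibre_orbit_self[OF Y that] by blast
    ultimately show ?thesis by simp
  qed
  then have "?B \<subseteq> (\<lambda>W. \<Union>x\<in>W. block Y x) ` fibre_orbit Y ` fst Y"
    unfolding image_image by (simp add: image_subset_iff)
  ultimately have finB: "finite ?B" by (rule finite_surj)
  \<comment> \<open>Compatibility as a property of the block: for z in the p-torsion the chosen
    point does not matter, by \<open>compatible_block\<close>.\<close>
  define P where "P z b \<longleftrightarrow> (\<exists>y\<in>fst Y. block Y y = b \<and> compatible Y z y)" for z b
  have P: "P z (block Y y) \<longleftrightarrow> compatible Y z y" if "y \<in> fst Y" "z \<in> ?T" for y z
    unfolding P_def using that compatible_block torsion_closed by blast
  have "card (fibre_orbit (tensor A G (quotient_biset z) Y) ` fst (tensor A G (quotient_biset z) Y)) =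
    (\<Sum>b\<in>?B. of_bool (P z b))" if "z \<in> ?T" for z
  proof -
    have "block Y ` {y \<in> fst Y. compatible Y z y} = {b \<in> ?B. P z b}"
      using P that by (auto simp: P_def)
    then show ?thesis using card_orbits_tensor_quotient[OF that] finB by (simp add: Int_def)
  qed
  then have "(\<Sum>z\<in>?T.
     card (fibre_orbit (tensor A G (quotient_biset z) Y) ` fst (tensor A G (quotient_biset z) Y))) =
    (\<Sum>z\<in>?T. \<Sum>b\<in>?B. of_bool (P z b))" by simp
  also have "\<dots> = (\<Sum>b\<in>?B. \<Sum>z\<in>?T. of_bool (P z b))" by (rule sum.swap)
  also have "\<dots> = (\<Sum>b\<in>?B. card (fibre_orbit Y ` b))"
  proof (rule sum.cong[OF refl])
    fix b assume "b \<in> ?B"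
    then obtain y where y: "y \<in> fst Y" "b = block Y y" by blast
    have "(\<Sum>z\<in>?T. of_bool (P z b)) = card {z \<in> ?T. compatible Y z y}"
      using y P finite_torsion by (simp add: Int_def cong: conj_cong)
    then show "(\<Sum>z\<in>?T. of_bool (P z b)) = card (fibre_orbit Y ` b)"
      using card_compatible[OF y(1)] y(2) by simp
  qed
  also have "\<dots> = card (\<Union>b\<in>?B. fibre_orbit Y ` b)"
  proof (rule card_UN_disjoint[symmetric])
    show "finite ?B" by (rule finB)
    show "\<forall>b\<in>?B. finite (fibre_orbit Y ` b)"
      using \<open>finite (fibre_orbit Y ` fst Y)\<close> block_subset by (auto intro: finite_subset[OF image_mono])
    show "\<forall>b\<in>?B. \<forall>b'\<in>?B. b \<noteq> b' \<longrightarrow> fibre_orbit Y ` b \<inter> fibre_orbit Y ` b' = {}"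
    proof (intro ballI impI)
      fix b b' assume "b \<in> ?B" "b' \<in> ?B" "b \<noteq> b'"
      then obtain y y' where y: "y \<in> fst Y" "b = block Y y" and y': "y' \<in> fst Y" "b' = block Y y'" by blast
      show "fibre_orbit Y ` b \<inter> fibre_orbit Y ` b' = {}"
      proof (rule ccontr)
        assume "fibre_orbit Y ` b \<inter> fibre_orbit Y ` b' \<noteq> {}"
        then obtain x x' where x: "x \<in> b" "x' \<in> b'" "fibre_orbit Y x = fibre_orbit Y x'" by blast
        have xY: "x \<in> fst Y" "x' \<in> fst Y" using x y y' block_subset by blast+
        then obtain a where a: "a \<in> carrier A" "x' = snd Y (a, \<one>\<^bsub>G\<^esub>, \<one>\<^bsub>G\<^esub>) x"
          using x fibre_orbit_eq_iff[OF Y] by blast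
        have "block Y x = block Y x'"
          using a block_eq_iff[OF xY] by (metis G.nat_pow_0)
        then show False using \<open>b \<noteq> b'\<close> x y y' block_eqI by metis
      qed
    qed
  qed
  also have "(\<Union>b\<in>?B. fibre_orbit Y ` b) = fibre_orbit Y ` fst Y"
    using block_self block_subset by blast
  finally show ?thesis .
qed

end

end

section \<open>An element generating a nilpotent ideal\<close>

context finite_fibre_setting
begin

lemma mult_R_sum_left: "(\<Sum>i\<in>S. f i) \<otimes>\<^bsub>R\<^esub> h = (\<Sum>i\<in>S. f i \<otimes>\<^bsub>R\<^esub> h)"
  by (induction S rule: infinite_finite_induct) (simp_all add: mult_R_zero mult_R_add_left)

lemma mult_R_sum_right: "h \<otimes>\<^bsub>R\<^esub> (\<Sum>i\<in>S. f i) = (\<Sum>i\<in>S. h \<otimes>\<^bsub>R\<^esub> f i)"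
  by (induction S rule: infinite_finite_induct) (simp_all add: mult_R_zero mult_R_add_right)

lemma sum_closed_R: "(\<And>i. i \<in> S \<Longrightarrow> f i \<in> carrier R) \<Longrightarrow> (\<Sum>i\<in>S. f i) \<in> carrier R"
  by (induction S rule: infinite_finite_induct) (simp_all add: zero_closed_R add_closed_R)

lemma linear_extension_sum: "linear_extension \<phi> (\<Sum>i\<in>S. f i) = (\<Sum>i\<in>S. linear_extension \<phi> (f i))"
  by (induction S rule: infinite_finite_induct) (simp_all add: linear_extension_zero linear_extension_add)

text \<open>One copy is split off at a time. For n = 0 the relation of the empty biset with itself
  reads E - E - E = -E, which puts E into \<open>I\<close>.\<close>

lemma free_biset_multiple:
  "Poly_Mapping.single (iso_class A G (free_biset n)) k - Poly_Mapping.single (iso_class A G reg) (k * of_nat n) \<in> I"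
proof (induction n)
  case 0
  let ?E = "iso_class A G (free_biset 0)"
  have "class_union A G ?E ?E = ?E"
    using iso_class_eqI[OF fibred_disjoint_union free_biset_0] by (simp add: class_union_iso_class fibred_free)
  moreover have "Poly_Mapping.single (class_union A G ?E ?E) k - Poly_Mapping.single ?E k - Poly_Mapping.single ?E k \<in> relators"
    unfolding relators_def using iso_class_in_biset_classes[OF fibred_free[of 0]] by blast
  ultimately have "- Poly_Mapping.single ?E k \<in> I" using relators_incl by fastforce
  then show ?case using I_uminus by fastforce
next
  case (Suc n)
  let ?E = "iso_class A G (free_biset n)" and ?X = "iso_class A G reg"
  have "iso_class A G (free_biset (Suc n)) = class_union A G ?E ?X"
    using iso_class_eqI[OF fibred_free free_biset_Suc[of n]] by (simp add: class_union_iso_class fibred_free)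
  moreover have "Poly_Mapping.single (class_union A G ?E ?X) k - Poly_Mapping.single ?E k - Poly_Mapping.single ?X k \<in> I"
    unfolding relators_def
    using iso_class_in_biset_classes[OF fibred_free[of n]] iso_class_in_biset_classes[OF fibred_free[of "Suc 0"]]
    by (intro relators_incl) (auto simp: relators_def)
  ultimately have "(Poly_Mapping.single (iso_class A G (free_biset (Suc n))) k - Poly_Mapping.single ?E k - Poly_Mapping.single ?X k) +
    (Poly_Mapping.single ?E k - Poly_Mapping.single ?X (k * of_nat n)) \<in> I"
    using Suc by (intro I_add) simp_all
  moreover have "Poly_Mapping.single ?X (k * of_nat (Suc n)) = Poly_Mapping.single ?X k + Poly_Mapping.single ?X (k * of_nat n)"
    by (simp add: distrib_left Poly_Mapping.single_add)
  ultimately show ?case by (simp add: algebra_simps)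
qed

text \<open>The linear extension of n: the identity fixes every A-orbit.\<close>

definition rank :: "(('a, 'g) biset_class \<Rightarrow>\<^sub>0 'k) \<Rightarrow> 'k" where
  "rank = linear_extension (\<lambda>C. of_nat (class_fixed_orbits (\<one>\<^bsub>A\<^esub>, \<one>\<^bsub>G\<^esub>, \<one>\<^bsub>G\<^esub>) C))"

lemma class_orbits_iso_class:
  assumes X: "fibred X"
  shows "class_fixed_orbits (\<one>\<^bsub>A\<^esub>, \<one>\<^bsub>G\<^esub>, \<one>\<^bsub>G\<^esub>) (iso_class A G X) = card (fibre_orbit X ` fst X)"
proof -
  have "snd X (\<one>\<^bsub>A\<^esub>, \<one>\<^bsub>G\<^esub>, \<one>\<^bsub>G\<^esub>) ` W = W" if "W \<in> fibre_orbit X ` fst X" for W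
  proof -
    have "W \<subseteq> fst X" using that fibre_orbit_subset[OF X] by auto
    then have "snd X (\<one>\<^bsub>A\<^esub>, \<one>\<^bsub>G\<^esub>, \<one>\<^bsub>G\<^esub>) ` W = (\<lambda>x. x) ` W"
      by (intro image_cong refl) (simp add: act_one[OF X] subsetD)
    then show ?thesis by simp
  qed
  then have "{W \<in> fibre_orbit X ` fst X. snd X (\<one>\<^bsub>A\<^esub>, \<one>\<^bsub>G\<^esub>, \<one>\<^bsub>G\<^esub>) ` W = W} = fibre_orbit X ` fst X" by blast
  then show ?thesis using X by (simp add: class_fixed_orbits_iso_class fixed_orbits_def)
qed

text \<open>On a basis element this is \<open>tensor_reg_reg\<close> combined with
  \<open>free_biset_multiple\<close>; both sides are additive in \<open>f\<close>.\<close>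

lemma reg_mult_reg:
  assumes "f \<in> carrier R"
  shows "bas reg \<otimes>\<^bsub>R\<^esub> (f \<otimes>\<^bsub>R\<^esub> bas reg) - Poly_Mapping.single (iso_class A G reg) (rank f) \<in> I"
  using assms
proof (induction f rule: R_induct)
  case zero
  then show ?case by (simp add: mult_R_zero rank_def linear_extension_zero I_zero)
next
  case (single C k)
  then obtain Z :: "('a, 'g, nat \<times> 'a) aset" where Z: "fibred Z" "C = iso_class A G Z" by (rule biset_classesE)
  have "iso_class A G (tensor A G reg (tensor A G Z reg)) = iso_class A G (free_biset (card (fibre_orbit Z ` fst Z)))"
    by (rule iso_class_eqI[OF fibred_free tensor_reg_reg[OF Z(1)], symmetric])
  then show ?case
    using free_biset_multiple Z
    by (simp add: mult_R_single class_tensor_iso_class fibred_free fibred_tensor rank_def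
        linear_extension_single class_orbits_iso_class)
next
  case (add f g)
  have "bas reg \<otimes>\<^bsub>R\<^esub> ((f + g) \<otimes>\<^bsub>R\<^esub> bas reg) - Poly_Mapping.single (iso_class A G reg) (rank (f + g)) =
    (bas reg \<otimes>\<^bsub>R\<^esub> (f \<otimes>\<^bsub>R\<^esub> bas reg) - Poly_Mapping.single (iso_class A G reg) (rank f)) +
    (bas reg \<otimes>\<^bsub>R\<^esub> (g \<otimes>\<^bsub>R\<^esub> bas reg) - Poly_Mapping.single (iso_class A G reg) (rank g))"
    by (simp add: mult_R_add_left mult_R_add_right rank_def linear_extension_add Poly_Mapping.single_add)
  then show ?case using I_add add by simp
qed

end

context prime_fibre_setting
begin

text \<open>The element u. By the product formula the classes of the Q_z are pairwise orthogonal
  idempotents of the algebra, since the characters for z and z' agree on the powers of c just for z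
  = z'. So u represents the complementary idempotent.\<close>

definition defect :: "('a, 'g) biset_class \<Rightarrow>\<^sub>0 'k" where
  "defect = bas Id - (\<Sum>z\<in>torsion_subgroup A p. bas (quotient_biset z))"

lemma defect_closed: "defect \<in> carrier R"
  unfolding defect_def
  by (intro diff_closed_R sum_closed_R bas_closed fibred_identity fibred_quotient finite_G)

text \<open>By linearity it suffices to take one biset for \<open>f\<close>, and there the claim is
  \<open>sum_card_orbits\<close>.\<close>

lemma rank_defect_mult:
  assumes "f \<in> carrier R"
  shows "rank (defect \<otimes>\<^bsub>R\<^esub> f) = 0"
  using assms
proof (induction f rule: R_induct)
  case zero
  then show ?case by (simp add: mult_R_zero rank_def linear_extension_zero)
next
  case (single C k)
  then obtain Z :: "('a, 'g, nat \<times> 'a) aset" where Z: "fibred Z" "C = iso_class A G Z" by (rule biset_classesE)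
  let ?n = "\<lambda>z. card (fibre_orbit (tensor A G (quotient_biset z) Z) ` fst (tensor A G (quotient_biset z) Z))"
  have q: "rank (bas (quotient_biset z) \<otimes>\<^bsub>R\<^esub> Poly_Mapping.single C k) = k * of_nat (?n z)"
    if "z \<in> torsion_subgroup A p" for z
    using that Z by (simp add: rank_def mult_R_single class_tensor_iso_class fibred_quotient fibred_tensor
        linear_extension_single class_orbits_iso_class)
  have "rank (defect \<otimes>\<^bsub>R\<^esub> Poly_Mapping.single C k) =
    rank (Poly_Mapping.single C k) - (\<Sum>z\<in>torsion_subgroup A p. rank (bas (quotient_biset z) \<otimes>\<^bsub>R\<^esub> Poly_Mapping.single C k))"
    using mult_one_R(1)[OF single_closed_R[OF single]]
    by (simp add: defect_def mult_R_diff_left mult_R_sum_left rank_def linear_extension_diff linear_extension_sum)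
  also have "\<dots> = k * of_nat (card (fibre_orbit Z ` fst Z)) - (\<Sum>z\<in>torsion_subgroup A p. k * of_nat (?n z))"
  proof -
    have "rank (Poly_Mapping.single C k) = k * of_nat (card (fibre_orbit Z ` fst Z))"
      using Z by (simp add: rank_def linear_extension_single class_orbits_iso_class)
    then show ?thesis by (simp add: q)
  qed
  also have "\<dots> = k * (of_nat (card (fibre_orbit Z ` fst Z)) - of_nat (\<Sum>z\<in>torsion_subgroup A p. ?n z))"
    by (simp add: right_diff_distrib sum_distrib_left)
  also have "\<dots> = 0" by (simp only: sum_card_orbits[OF Z(1)]) simp
  finally show ?case .
next
  case (add f g)
  then show ?case by (simp add: mult_R_add_right rank_def linear_extension_add)
qed

lemma fixed_orbits_reg: "fixed_orbits (\<one>\<^bsub>A\<^esub>, \<one>\<^bsub>G\<^esub>, c) reg = 0"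
proof -
  let ?w = "(\<one>\<^bsub>A\<^esub>, \<one>\<^bsub>G\<^esub>, c)"
  have "snd reg ?w ` fibre_orbit reg x \<noteq> fibre_orbit reg x" if x: "x \<in> fst reg" for x
  proof
    assume "snd reg ?w ` fibre_orbit reg x = fibre_orbit reg x"
    then have "snd reg ?w x \<in> fibre_orbit reg x" using fibre_orbit_self[OF fibred_free x] by blast
    then obtain a where "a \<in> carrier A" "snd reg ?w x = snd reg (a, \<one>\<^bsub>G\<^esub>, \<one>\<^bsub>G\<^esub>) x"
      by (auto simp: fibre_orbit_def)
    then show False using reg_act_eq_iff[OF x] c_in c_not_one by simp
  qed
  then have "{W \<in> fibre_orbit reg ` fst reg. snd reg ?w ` W = W} = {}" by blast
  then show ?thesis unfolding fixed_orbits_def by (simp only: card.empty)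
qed

text \<open>Since (z, c) has been divided out, c acts on Q_z from the right like the scalar z at the
  coset of (1, 1). That scalar passes through the tensor sign, so the A-orbit of this elementary
  tensor is fixed.\<close>

lemma fixed_orbits_reg_quotient:
  assumes z: "z \<in> torsion_subgroup A p"
  shows "fixed_orbits (\<one>\<^bsub>A\<^esub>, \<one>\<^bsub>G\<^esub>, c) (tensor A G reg (quotient_biset z)) > 0"
proof -
  let ?w = "(\<one>\<^bsub>A\<^esub>, \<one>\<^bsub>G\<^esub>, c)" and ?Q = "quotient_biset z" and ?o = "coset z \<one>\<^bsub>A\<^esub> \<one>\<^bsub>G\<^esub>"
  let ?T = "tensor A G reg ?Q"
  let ?t = "cls reg ?Q reg_unit ?o"
  note F = fibred_free[of "Suc 0"] and Q = fibred_quotient[OF z]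
  note T = fibred_tensor[OF F Q]
  have zc: "z \<in> carrier A" using z by (rule torsion_closed)
  have o: "?o \<in> fst ?Q" by (rule quotient_memI[OF z]) simp_all
  have good: "good reg ?Q reg_unit ?o" by (rule good_reg_left[OF Q reg_unit_in o])
  have t: "?t \<in> fst ?T" by (rule tensor_memI[OF F Q reg_unit_in o good])
  \<comment> \<open>Multiply (1, c^-1) by (z, c).\<close>
  have co: "coset z \<one>\<^bsub>A\<^esub> (inv\<^bsub>G\<^esub> c) = coset z z \<one>\<^bsub>G\<^esub>"
    using zc c_in by (subst coset_eq_iff[OF z]) (auto intro!: exI[of _ 1])
  have "snd ?T ?w ?t = cls reg ?Q reg_unit (snd ?Q (z, \<one>\<^bsub>G\<^esub>, \<one>\<^bsub>G\<^esub>) ?o)"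
    using zc c_in co by (simp add: tensor_act[OF F Q reg_unit_in o good] act_one[OF F reg_unit_in] quotient_act[OF z])
  also have "\<dots> = snd ?T (z, \<one>\<^bsub>G\<^esub>, \<one>\<^bsub>G\<^esub>) ?t"
    using cls_shift[OF F Q reg_unit_in o zc, of "\<one>\<^bsub>G\<^esub>"] zc
    by (simp add: tensor_act[OF F Q reg_unit_in o good] act_one[OF Q o])
  finally have wt: "snd ?T ?w ?t = snd ?T (z, \<one>\<^bsub>G\<^esub>, \<one>\<^bsub>G\<^esub>) ?t" .
  have "snd ?T ?w ` fibre_orbit ?T ?t = fibre_orbit ?T (snd ?T ?w ?t)"
  proof -
    have "snd ?T ?w (snd ?T (a, \<one>\<^bsub>G\<^esub>, \<one>\<^bsub>G\<^esub>) ?t) = snd ?T (a, \<one>\<^bsub>G\<^esub>, \<one>\<^bsub>G\<^esub>) (snd ?T ?w ?t)" if "a \<in> carrier A" for a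
      using that c_in by (simp add: act_act[OF T t])
    then show ?thesis unfolding fibre_orbit_image image_image by (rule image_cong[OF refl])
  qed
  also have "\<dots> = fibre_orbit ?T ?t"
    unfolding wt using fibre_orbit_eq_iff[OF T t act_closed[OF T t zc]] zc by auto
  finally have "fibre_orbit ?T ?t \<in> {W \<in> fibre_orbit ?T ` fst ?T. snd ?T ?w ` W = W}" using t by blast
  moreover have "finite {W \<in> fibre_orbit ?T ` fst ?T. snd ?T ?w ` W = W}"
    using finite_fibre_orbits[OF T] by (simp add: fibre_orbits_eq)
  ultimately show ?thesis unfolding fixed_orbits_def card_gt_0_iff by blast
qed

text \<open>The functional attached to (1, 1, c) takes the value -\<open>?S\<close> on x. The number
  \<open>?S\<close> is a sum of positive terms over the nonempty set A_p, and characteristic zero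
  keeps it nonzero among the scalars.\<close>

lemma reg_defect_notin_I: "bas reg \<otimes>\<^bsub>R\<^esub> defect \<notin> I"
proof
  let ?w = "(\<one>\<^bsub>A\<^esub>, \<one>\<^bsub>G\<^esub>, c)"
  have w: "?w \<in> carrier acting_group" using c_in by simp
  let ?\<phi> = "\<lambda>C. of_nat (class_fixed_orbits ?w C) :: 'k"
  let ?S = "\<Sum>z\<in>torsion_subgroup A p. fixed_orbits ?w (tensor A G reg (quotient_biset z))"
  assume "bas reg \<otimes>\<^bsub>R\<^esub> defect \<in> I"
  then have "linear_extension ?\<phi> (bas reg \<otimes>\<^bsub>R\<^esub> defect) = 0"
    using class_fixed_orbits_union[OF _ _ w] by (intro linear_extension_I) simp_all
  moreover have "bas reg \<otimes>\<^bsub>R\<^esub> defect = bas reg - (\<Sum>z\<in>torsion_subgroup A p. bas (tensor A G reg (quotient_biset z)))"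
    by (simp add: defect_def mult_R_diff_right mult_R_sum_right mult_one_R(2)[OF bas_closed[OF fibred_free]]
        mult_R_bas fibred_free fibred_quotient)
  moreover have "linear_extension ?\<phi> (bas reg - (\<Sum>z\<in>torsion_subgroup A p. bas (tensor A G reg (quotient_biset z)))) = - of_nat ?S"
    by (simp add: linear_extension_diff linear_extension_sum linear_extension_single
        class_fixed_orbits_iso_class[OF _ w] fibred_free fibred_quotient fibred_tensor fixed_orbits_reg)
  ultimately have "of_nat ?S = (0::'k)" by simp
  then have "?S = 0" by (simp only: of_nat_eq_0_iff)
  moreover have "torsion_subgroup A p \<noteq> {}" using card_torsion prime_gt_0_nat[OF prime_p] by force
  ultimately show False using fixed_orbits_reg_quotient finite_torsion by force
qed

lemma not_semisimple: "\<not> semisimple_ring (fibred_double_burnside_algebra TYPE('k) A G)"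
proof (rule not_semisimple_quotientI)
  let ?x = "bas reg \<otimes>\<^bsub>R\<^esub> defect"
  have reg: "bas reg \<in> carrier R" by (rule bas_closed[OF fibred_free])
  show "?x \<in> carrier R" by (rule mult_closed_R[OF reg defect_closed])
  show "?x \<notin> I" by (rule reg_defect_notin_I)
  fix r assume r: "r \<in> carrier R"
  let ?f = "defect \<otimes>\<^bsub>R\<^esub> r"
  have f: "?f \<in> carrier R" by (rule mult_closed_R[OF defect_closed r])
  have "bas reg \<otimes>\<^bsub>R\<^esub> (?f \<otimes>\<^bsub>R\<^esub> bas reg) \<in> I"
    using reg_mult_reg[OF f] by (simp add: rank_defect_mult[OF r])
  then have "bas reg \<otimes>\<^bsub>R\<^esub> (?f \<otimes>\<^bsub>R\<^esub> bas reg) \<otimes>\<^bsub>R\<^esub> defect \<in> I"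
    by (rule I_mult(2)[OF _ defect_closed])
  also have "bas reg \<otimes>\<^bsub>R\<^esub> (?f \<otimes>\<^bsub>R\<^esub> bas reg) \<otimes>\<^bsub>R\<^esub> defect = ?x \<otimes>\<^bsub>R\<^esub> (r \<otimes>\<^bsub>R\<^esub> ?x)"
    by (simp add: mult_assoc_R mult_closed_R reg defect_closed r)
  finally show "?x \<otimes>\<^bsub>R\<^esub> (r \<otimes>\<^bsub>R\<^esub> ?x) \<in> I" .
qed

end

theorem corollary4p8:
  fixes G :: "'g monoid" and A :: "'a monoid" and \<pi> :: "nat set"
  assumes "comm_group G" and "finite (carrier G)" and "carrier G \<noteq> {\<one>\<^bsub>G\<^esub>}"
    and "comm_group A"
    and "\<exists>!\<rho>. cyclic_torsion A \<rho>" and "cyclic_torsion A \<pi>"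
    and "\<And>p. prime p \<Longrightarrow> p dvd order G \<Longrightarrow> p \<in> \<pi>"
    and "\<exists>\<zeta> :: 'k::field_char_0. primitive_root_of_unity (group_exponent G) \<zeta>"
  shows "\<not> semisimple_ring (fibred_double_burnside_algebra TYPE('k) A G)"
proof -
  interpret G: comm_group G by fact
  interpret A: comm_group A by fact
  obtain g where g: "g \<in> carrier G" "g \<noteq> \<one>\<^bsub>G\<^esub>" using assms(3) G.one_closed by blast
  then have "G.ord g \<noteq> 1" using G.ord_eq_1 by blast
  then obtain p where p: "prime p" "p dvd G.ord g" using prime_factor_nat by blast
  then obtain m where m: "G.ord g = p * m" by (auto simp: dvd_def)
  \<comment> \<open>From an element of order p m, its m-th power has order p.\<close>
  let ?c = "g [^]\<^bsub>G\<^esub> m"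
  have pos: "G.ord g > 0" using G.ord_ge_1[OF assms(2) g(1)] by simp
  have "?c \<noteq> \<one>\<^bsub>G\<^esub>"
  proof
    assume "?c = \<one>\<^bsub>G\<^esub>"
    then have "p * m dvd m" using G.pow_eq_id[OF g(1), of m] m by simp
    then show False using pos m prime_gt_1_nat[OF p(1)] by (auto dest: dvd_imp_le)
  qed
  moreover have "?c [^]\<^bsub>G\<^esub> p = \<one>\<^bsub>G\<^esub>"
    using g m G.pow_ord_eq_1[OF g(1)] by (simp add: G.nat_pow_pow mult.commute)
  moreover have "card (torsion_subgroup A p) = p"
  proof -
    \<comment> \<open>p divides the order of g and hence the order of G, so the hypothesis on \<pi>
      applies to p.\<close>
    have "p \<in> \<pi>" using assms(7)[OF p(1)] p(2) G.ord_dvd_group_order[OF g(1)] dvd_trans by blast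
    moreover have "prime_factors p = {p}" "multiplicity p p = 1"
      using p(1) by (simp_all add: prime_prime_factors prime_imp_prime_elem)
    ultimately have "pi_part \<pi> p = p" by (simp add: pi_part_def)
    then show ?thesis using assms(6) prime_gt_0_nat[OF p(1)] by (simp add: cyclic_torsion_def)
  qed
  ultimately have "prime_fibre_setting A G p ?c"
    using p(1) g(1) assms(2)
    by (intro prime_fibre_setting.intro finite_fibre_setting.intro fibre_setting.intro
        finite_fibre_setting_axioms.intro prime_fibre_setting_axioms.intro
        A.comm_group_axioms G.comm_group_axioms) auto
  then show ?thesis by (rule prime_fibre_setting.not_semisimple)
qed

end
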